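(* Let $\mathcal{S}$ be an operator system, let $\mathcal{A}=C^*(\mathcal{S})$ be the unital $C^*$-algebra it generates, and let $n\in\mathbb{N}$. A point $\phi\in \mathrm{UCP}(\mathcal{S},\mathbb{M}_n)$ is an absolute matrix extreme point of the matrix state space $\mathrm{UCP}(\mathcal{S})$ if and only if it extends to a boundary representation on $\mathcal{A}$, i.e. there is a boundary representation $\pi:\mathcal{A}\to\mathbb{M}_n$ for $\mathcal{S}$ with $\pi|_{\mathcal{S}}=\phi$.
   Context: An operator system is a unital self-adjoint linear subspace of a unital $C^*$-algebra. $\mathbb{M}_n$ denotes the complex $n\times n$ matrices and $\mathbb{M}_{m,n}$ the complex $m\times n$ matrices. UCP means unital and completely positive. $\mathrm{UCP}(\mathcal{S},\mathcal{B})$ is the set of UCP maps $\mathcal{S}\to\mathcal{B}$, and the matrix state space is $\mathrm{UCP}(\mathcal{S})=(\mathrm{UCP}(\mathcal{S},\mathbb{M}_n))_{n\in\mathbb{N}}$. Absolute matrix extreme point: $\phi\in \mathrm{UCP}(\mathcal{S},\mathbb{M}_n)$ is an absolute matrix extreme point of $\mathrm{UCP}(\mathcal{S})$ if whenever $\phi=\sum_{i=1}^k\gamma_i^*\phi_i\gamma_i$ with $\phi_i\in \mathrm{UCP}(\mathcal{S},\mathbb{M}_{n_i})$, all $\gamma_i\in\mathbb{M}_{n_i,n}$ non-zero, and $\sum_i\gamma_i^*\gamma_i=1_n$, then for each $i$: (a) if $n_i\le n$, then $n_i=n$ and $\phi=u_i^*\phi_iu_i$ for some unitary $u_i\in\mathbb{M}_n$;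 (b) if $n_i>n$, then there are $\rho_i\in \mathrm{UCP}(\mathcal{S},\mathbb{M}_{n_i-n})$ and a unitary $u_i\in\mathbb{M}_{n_i}$ with $\phi_i=u_i^*(\phi\oplus\rho_i)u_i$. Unique extension property: a UCP map $\phi:\mathcal{S}\to B(\mathcal{H})$ has it if $\phi$ has a unique UCP extension $\Phi:C^*(\mathcal{S})\to B(\mathcal{H})$ and $\Phi$ is multiplicative. A boundary representation for $\mathcal{S}$ is an irreducible $*$-representation $\pi:C^*(\mathcal{S})\to B(\mathcal{H})$ such that $\pi|_{\mathcal{S}}$ has the unique extension property. *)

theory Defs
  imports Complex_Main "Jordan_Normal_Form.Schur_Decomposition"
begin

section \<open>Unital C*-algebras and operator systems\<close>

text \<open>The superclass \<^class>\<open>real_normed_algebra_1\<close> contains the axiom that 1 has norm 1, so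
  the zero algebra is excluded; it admits no unital map into the matrices of a positive size.\<close>

class unital_cstar_algebra = real_normed_algebra_1 + banach +
  fixes scaleC :: "complex \<Rightarrow> 'a \<Rightarrow> 'a"
    and star :: "'a \<Rightarrow> 'a"
  assumes scaleC_add_right: "scaleC c (x + y) = scaleC c x + scaleC c y"
    and scaleC_add_left: "scaleC (c + d) x = scaleC c x + scaleC d x"
    and scaleC_scaleC: "scaleC c (scaleC d x) = scaleC (c * d) x"
    and scaleC_of_real: "scaleC (complex_of_real r) x = scaleR r x"
    and scaleC_mult_left: "scaleC c x * y = scaleC c (x * y)"
    and scaleC_mult_right: "x * scaleC c y = scaleC c (x * y)"
    and norm_scaleC: "norm (scaleC c x) = cmod c * norm x"
    and star_star: "star (star x) = x"
    and star_add: "star (x + y) = star x + star y"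
    and star_scaleC: "star (scaleC c x) = scaleC (cnj c) (star x)"
    and star_mult: "star (x * y) = star y * star x"
    and cstar_identity: "norm (star x * x) = (norm x)\<^sup>2"

definition operator_system :: "'a::unital_cstar_algebra set \<Rightarrow> bool" where
  "operator_system S \<longleftrightarrow>
     1 \<in> S \<and> (\<forall>x\<in>S. \<forall>y\<in>S. x + y \<in> S) \<and> (\<forall>c. \<forall>x\<in>S. scaleC c x \<in> S) \<and> (\<forall>x\<in>S. star x \<in> S)"

definition unital_cstar_subalgebra :: "'a::unital_cstar_algebra set \<Rightarrow> bool" where
  "unital_cstar_subalgebra B \<longleftrightarrow>
     operator_system B \<and> (\<forall>x\<in>B. \<forall>y\<in>B. x * y \<in> B) \<and> closed B"

definition generated_cstar :: "'a::unital_cstar_algebra set \<Rightarrow> 'a set" where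
  "generated_cstar S = unital_cstar_subalgebra hull S"


section \<open>Unital completely positive maps into matrix algebras\<close>

text \<open>Positivity of a \<open>k \<times> k\<close> matrix over the ambient algebra, as an element \<open>b\<^sup>* b\<close> of the
  C*-algebra of all such matrices. An operator system, and likewise the C*-algebra it generates,
  inherits its matrix order from the ambient algebra.\<close>

definition cstar_mat_pos :: "nat \<Rightarrow> 'a::unital_cstar_algebra mat \<Rightarrow> bool" where
  "cstar_mat_pos k x \<longleftrightarrow> (\<exists>b\<in>carrier_mat k k. x = map_mat star (transpose_mat b) * b)"

text \<open>Over \<^typ>\<open>complex\<close>, \<open>0 \<le> z\<close> means that \<open>z\<close> is real and nonnegative.\<close>

definition complex_mat_pos :: "nat \<Rightarrow> complex mat \<Rightarrow> bool" where
  "complex_mat_pos m A \<longleftrightarrow>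
     A \<in> carrier_mat m m \<and> (\<forall>v\<in>carrier_vec m. 0 \<le> (A *\<^sub>v v) \<bullet>c v)"

text \<open>The amplification \<open>[x\<^sub>p\<^sub>q] \<mapsto> [\<phi> x\<^sub>p\<^sub>q]\<close>, where a \<open>k \<times> k\<close> matrix of \<open>n \<times> n\<close> blocks is
  flattened to a \<open>k n \<times> k n\<close> matrix.\<close>

definition amplification :: "nat \<Rightarrow> ('a \<Rightarrow> complex mat) \<Rightarrow> 'a mat \<Rightarrow> complex mat" where
  "amplification n \<phi> x =
     mat (dim_row x * n) (dim_col x * n)
       (\<lambda>(r, c). \<phi> (x $$ (r div n, c div n)) $$ (r mod n, c mod n))"

definition linear_map_on ::
  "'a::unital_cstar_algebra set \<Rightarrow> nat \<Rightarrow> ('a \<Rightarrow> complex mat) \<Rightarrow> bool" where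
  "linear_map_on S n \<phi> \<longleftrightarrow>
     (\<forall>x\<in>S. \<phi> x \<in> carrier_mat n n) \<and>
     (\<forall>x\<in>S. \<forall>y\<in>S. \<phi> (x + y) = \<phi> x + \<phi> y) \<and>
     (\<forall>c. \<forall>x\<in>S. \<phi> (scaleC c x) = c \<cdot>\<^sub>m \<phi> x)"

definition completely_positive ::
  "'a::unital_cstar_algebra set \<Rightarrow> nat \<Rightarrow> ('a \<Rightarrow> complex mat) \<Rightarrow> bool" where
  "completely_positive S n \<phi> \<longleftrightarrow>
     (\<forall>k. \<forall>x\<in>carrier_mat k k. elements_mat x \<subseteq> S \<longrightarrow> cstar_mat_pos k x \<longrightarrow>
        complex_mat_pos (k * n) (amplification n \<phi> x))"

text \<open>Maps on \<open>S\<close> are represented by total functions whose values outside \<open>S\<close> are irrelevant;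
  equality of maps is therefore always equality on the domain.\<close>

definition UCP :: "'a::unital_cstar_algebra set \<Rightarrow> nat \<Rightarrow> ('a \<Rightarrow> complex mat) set" where
  "UCP S n = {\<phi>. linear_map_on S n \<phi> \<and> \<phi> 1 = 1\<^sub>m n \<and> completely_positive S n \<phi>}"


section \<open>Absolute matrix extreme points\<close>

definition unitary_mat :: "nat \<Rightarrow> complex mat \<Rightarrow> bool" where
  "unitary_mat n u \<longleftrightarrow>
     u \<in> carrier_mat n n \<and> mat_adjoint u * u = 1\<^sub>m n \<and> u * mat_adjoint u = 1\<^sub>m n"

definition mat_sum :: "nat \<Rightarrow> nat \<Rightarrow> (nat \<Rightarrow> complex mat) \<Rightarrow> complex mat" where
  "mat_sum n k M = mat n n (\<lambda>(r, c). \<Sum>i<k. M i $$ (r, c))"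

definition direct_sum_mat :: "complex mat \<Rightarrow> complex mat \<Rightarrow> complex mat" where
  "direct_sum_mat A B =
     four_block_mat A (0\<^sub>m (dim_row A) (dim_col B)) (0\<^sub>m (dim_row B) (dim_col A)) B"

definition matrix_convex_combination ::
  "'a::unital_cstar_algebra set \<Rightarrow> nat \<Rightarrow> ('a \<Rightarrow> complex mat) \<Rightarrow>
     nat \<Rightarrow> (nat \<Rightarrow> nat) \<Rightarrow> (nat \<Rightarrow> 'a \<Rightarrow> complex mat) \<Rightarrow> (nat \<Rightarrow> complex mat) \<Rightarrow> bool" where
  "matrix_convex_combination S n \<phi> k d \<psi> \<gamma> \<longleftrightarrow>
     (\<forall>i<k. 1 \<le> d i \<and> \<psi> i \<in> UCP S (d i) \<and>
            \<gamma> i \<in> carrier_mat (d i) n \<and> \<gamma> i \<noteq> 0\<^sub>m (d i) n) \<and>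
     mat_sum n k (\<lambda>i. mat_adjoint (\<gamma> i) * \<gamma> i) = 1\<^sub>m n \<and>
     (\<forall>x\<in>S. \<phi> x = mat_sum n k (\<lambda>i. mat_adjoint (\<gamma> i) * \<psi> i x * \<gamma> i))"

definition absolute_matrix_extreme_point ::
  "'a::unital_cstar_algebra set \<Rightarrow> nat \<Rightarrow> ('a \<Rightarrow> complex mat) \<Rightarrow> bool" where
  "absolute_matrix_extreme_point S n \<phi> \<longleftrightarrow>
     \<phi> \<in> UCP S n \<and>
     (\<forall>k d \<psi> \<gamma>. matrix_convex_combination S n \<phi> k d \<psi> \<gamma> \<longrightarrow>
        (\<forall>i<k.
          (d i \<le> n \<longrightarrow> d i = n \<and>
             (\<exists>u. unitary_mat n u \<and> (\<forall>x\<in>S. \<phi> x = mat_adjoint u * \<psi> i x * u))) \<and>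
          (n < d i \<longrightarrow>
             (\<exists>\<rho>\<in>UCP S (d i - n). \<exists>u. unitary_mat (d i) u \<and>
                (\<forall>x\<in>S. \<psi> i x = mat_adjoint u * direct_sum_mat (\<phi> x) (\<rho> x) * u)))))"


section \<open>Boundary representations on finite-dimensional Hilbert spaces\<close>

text \<open>All representations below act on the Hilbert space \<open>\<complex>\<^sup>n\<close>, whose bounded operators are the
  \<open>n \<times> n\<close> matrices.\<close>

definition unique_extension_property ::
  "'a::unital_cstar_algebra set \<Rightarrow> nat \<Rightarrow> ('a \<Rightarrow> complex mat) \<Rightarrow> bool" where
  "unique_extension_property S n \<phi> \<longleftrightarrow>
     \<phi> \<in> UCP S n \<and>
     (\<exists>\<Phi>\<in>UCP (generated_cstar S) n.
        (\<forall>x\<in>S. \<Phi> x = \<phi> x) \<and>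
        (\<forall>\<Psi>\<in>UCP (generated_cstar S) n.
           (\<forall>x\<in>S. \<Psi> x = \<phi> x) \<longrightarrow> (\<forall>a\<in>generated_cstar S. \<Psi> a = \<Phi> a)) \<and>
        (\<forall>a\<in>generated_cstar S. \<forall>b\<in>generated_cstar S. \<Phi> (a * b) = \<Phi> a * \<Phi> b))"

definition star_representation ::
  "'a::unital_cstar_algebra set \<Rightarrow> nat \<Rightarrow> ('a \<Rightarrow> complex mat) \<Rightarrow> bool" where
  "star_representation B n \<pi> \<longleftrightarrow>
     linear_map_on B n \<pi> \<and> \<pi> 1 = 1\<^sub>m n \<and>
     (\<forall>a\<in>B. \<forall>b\<in>B. \<pi> (a * b) = \<pi> a * \<pi> b) \<and>
     (\<forall>a\<in>B. \<pi> (star a) = mat_adjoint (\<pi> a))"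

text \<open>Every linear subspace of \<open>\<complex>\<^sup>n\<close> is closed, so no closedness condition appears.\<close>

definition irreducible_representation ::
  "'a::unital_cstar_algebra set \<Rightarrow> nat \<Rightarrow> ('a \<Rightarrow> complex mat) \<Rightarrow> bool" where
  "irreducible_representation B n \<pi> \<longleftrightarrow>
     star_representation B n \<pi> \<and> 0 < n \<and>
     (\<forall>W. W \<subseteq> carrier_vec n \<and> 0\<^sub>v n \<in> W \<and>
          (\<forall>v\<in>W. \<forall>w\<in>W. v + w \<in> W) \<and> (\<forall>c. \<forall>v\<in>W. c \<cdot>\<^sub>v v \<in> W) \<and>
          (\<forall>a\<in>B. \<forall>v\<in>W. \<pi> a *\<^sub>v v \<in> W)
        \<longrightarrow> W = {0\<^sub>v n} \<or> W = carrier_vec n)"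

definition boundary_representation ::
  "'a::unital_cstar_algebra set \<Rightarrow> nat \<Rightarrow> ('a \<Rightarrow> complex mat) \<Rightarrow> bool" where
  "boundary_representation S n \<pi> \<longleftrightarrow>
     irreducible_representation (generated_cstar S) n \<pi> \<and> unique_extension_property S n \<pi>"

end

theory Submission
  imports Defs "HOL-Library.Function_Algebras" "HOL-Computational_Algebra.Formal_Power_Series"
    "HOL-Analysis.Elementary_Topology" "Jordan_Normal_Form.Spectral_Radius"
begin

text \<open>If \<open>\<pi>\<close> is a boundary representation and \<open>\<pi>|\<^sub>S = \<Sum>i. \<gamma>\<^sub>i\<^sup>* \<psi>\<^sub>i \<gamma>\<^sub>i\<close>, extend the
  \<open>\<psi>\<^sub>i\<close> to maps \<open>\<Psi>\<^sub>i\<close> on \<open>C\<^sup>*(S)\<close> by Arveson's theorem. By uniqueness the extended combination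
  is \<open>\<pi>\<close>, and since \<open>\<pi>\<close> is multiplicative the Schwarz inequality is an equality, which forces
  \<open>\<Psi>\<^sub>i(a) \<gamma>\<^sub>i = \<gamma>\<^sub>i \<pi>(a)\<close>. Hence \<open>\<gamma>\<^sub>i\<^sup>* \<gamma>\<^sub>i\<close> commutes with \<open>\<pi>\<close>, so it is a
  scalar, and \<open>\<gamma>\<^sub>i\<close> is a multiple of an isometry embedding \<open>\<pi>\<close> into \<open>\<Psi>\<^sub>i\<close>.

  Conversely, let \<open>\<phi>\<close> be absolute matrix extreme and \<open>\<Phi>\<close> any UCP extension of it. If \<open>\<Phi>\<close> were not
  multiplicative, the Stinespring representation would give a UCP map into the matrices of size
  \<open>n + 1\<close> with corner \<open>\<phi>\<close> and nonzero off-diagonal part. Absolute extremality makes it unitarily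
  equivalent to \<open>\<phi> \<oplus> \<rho>\<close>, where \<open>\<rho>\<close> is scalar; comparing traces and then Frobenius norms shows
  that the off-diagonal part vanishes. So every UCP extension is a representation, and all of them
  agree. It is irreducible because an invariant subspace would write \<open>\<phi>\<close> as a combination
  involving a map into smaller matrices.\<close>

section \<open>Unital C*-algebras\<close>

text \<open>Gram families whose number of rows is independent of their number of columns remove this
  obstacle: sums are formed by stacking rows, and zero padding leads back to the square case. The
  only functional calculus in the algebra is then the square root of \<open>1 - y\<close> for
  self-adjoint \<open>y\<close> of norm below 1, which turns \<open>t\<^sup>2 - star a * a\<close>
  into a square as soon as \<open>norm a < t\<close>.

  A full Stinespring space may be infinite dimensional, whereas absolute extremality speaks about
  matrix sizes only. For this reason a single vector is adjoined, one for each \<open>a\<close> in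
  \<open>S\<close> and each coordinate at which multiplicativity could fail. Testing elements of
  \<open>S\<close> is enough, because the elements on which a UCP map is multiplicative form a
  closed algebra. The same argument applied to every extension at once gives uniqueness:
  representations are continuous and determined by their values on \<open>S\<close>.\<close>

lemma scaleC_zero_left [simp]: "scaleC 0 (x::'a::unital_cstar_algebra) = 0"
  using scaleC_of_real[of 0 x] by simp

lemma scaleC_one [simp]: "scaleC 1 (x::'a::unital_cstar_algebra) = x"
  using scaleC_of_real[of 1 x] by simp

lemma scaleC_zero_right [simp]: "scaleC c (0::'a::unital_cstar_algebra) = 0"
  using scaleC_add_right[of c 0 "0::'a"] by simp

lemma scaleC_minus_one: "scaleC (- 1) (x::'a::unital_cstar_algebra) = - x"
  using scaleC_of_real[of "-1" x] by simp

lemma scaleC_minus_left: "scaleC (- c) x = - scaleC c (x::'a::unital_cstar_algebra)"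
  using scaleC_add_left[of c "-c" x] by (simp add: eq_neg_iff_add_eq_0 add.commute)

lemma scaleC_minus_right: "scaleC c (- x) = - scaleC c (x::'a::unital_cstar_algebra)"
  using scaleC_add_right[of c x "-x"] by (simp add: eq_neg_iff_add_eq_0 add.commute)

lemma scaleC_sum_right: "scaleC c (\<Sum>i\<in>I. f i) = (\<Sum>i\<in>I. scaleC c (f i :: 'a::unital_cstar_algebra))"
  by (induction I rule: infinite_finite_induct) (auto simp: scaleC_add_right)

lemma star_zero [simp]: "star (0::'a::unital_cstar_algebra) = 0"
  using star_add[of 0 "0::'a"] by simp

lemma star_one [simp]: "star (1::'a::unital_cstar_algebra) = 1"
  using star_mult[of "star 1" "1::'a"] by (simp add: star_star)

lemma star_scaleR: "star (r *\<^sub>R x) = r *\<^sub>R star (x::'a::unital_cstar_algebra)"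
  by (simp add: star_scaleC flip: scaleC_of_real)

lemma star_minus: "star (- x) = - star (x::'a::unital_cstar_algebra)"
  using star_add[of x "-x"] by (simp add: eq_neg_iff_add_eq_0 add.commute)

lemma star_diff: "star (x - y) = star x - star (y::'a::unital_cstar_algebra)"
  using star_add[of x "-y"] by (simp add: star_minus)

lemma star_sum: "star (\<Sum>i\<in>I. f i) = (\<Sum>i\<in>I. star (f i :: 'a::unital_cstar_algebra))"
  by (induction I rule: infinite_finite_induct) (auto simp: star_add)

lemma star_power: "star (x ^ k) = star (x::'a::unital_cstar_algebra) ^ k"
  by (induction k) (auto simp: star_mult power_commutes)

text \<open>The class postulates only the C*-identity. That the involution is isometric follows from
  it by submultiplicativity, and gives the continuity of \<open>star\<close> needed for series and
  for closed subalgebras.\<close>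

lemma norm_star [simp]: "norm (star (x::'a::unital_cstar_algebra)) = norm x"
proof -
  have le: "norm y \<le> norm (star y)" for y :: 'a
  proof (cases "y = 0")
    case False
    have "norm y * norm y \<le> norm (star y) * norm y"
      using norm_mult_ineq[of "star y" y] cstar_identity[of y] by (simp add: power2_eq_square)
    then show ?thesis using False by simp
  qed auto
  show ?thesis using le[of x] le[of "star x"] by (simp add: star_star)
qed

lemma bounded_linear_star: "bounded_linear (star :: 'a::unital_cstar_algebra \<Rightarrow> 'a)"
  by (rule bounded_linear_intro[where K = 1]) (auto simp: star_add star_scaleR)

section \<open>Operator systems and the subalgebras they generate\<close>

lemma operator_systemD:
  assumes "operator_system S"
  shows "1 \<in> S" and "0 \<in> S" and "\<And>x y. x \<in> S \<Longrightarrow> y \<in> S \<Longrightarrow> x + y \<in> S"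
    and "\<And>c x. x \<in> S \<Longrightarrow> scaleC c x \<in> S" and "\<And>r x. x \<in> S \<Longrightarrow> r *\<^sub>R x \<in> S"
    and "\<And>x. x \<in> S \<Longrightarrow> star x \<in> S" and "\<And>x. x \<in> S \<Longrightarrow> - x \<in> S"
    and "\<And>x y. x \<in> S \<Longrightarrow> y \<in> S \<Longrightarrow> x - y \<in> S"
proof -
  note D = assms[unfolded operator_system_def]
  show 1: "1 \<in> S" and add: "\<And>x y. x \<in> S \<Longrightarrow> y \<in> S \<Longrightarrow> x + y \<in> S"
    and sc: "\<And>c x. x \<in> S \<Longrightarrow> scaleC c x \<in> S" and "\<And>x. x \<in> S \<Longrightarrow> star x \<in> S"
    using D by auto
  show "0 \<in> S" using sc[OF 1, of 0] by simp
  show "\<And>r x. x \<in> S \<Longrightarrow> r *\<^sub>R x \<in> S" by (metis sc scaleC_of_real)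
  show m: "\<And>x. x \<in> S \<Longrightarrow> - x \<in> S" by (metis sc scaleC_minus_one)
  show "\<And>x y. x \<in> S \<Longrightarrow> y \<in> S \<Longrightarrow> x - y \<in> S" by (metis add m add_uminus_conv_diff)
qed

lemma operator_system_sum:
  assumes "operator_system S" "\<And>i. i \<in> I \<Longrightarrow> f i \<in> S"
  shows "(\<Sum>i\<in>I. f i) \<in> S"
  using assms(2) by (induction I rule: infinite_finite_induct) (auto simp: operator_systemD[OF assms(1)])

lemma unital_cstar_subalgebraD:
  assumes "unital_cstar_subalgebra B"
  shows "operator_system B" and "\<And>x y. x \<in> B \<Longrightarrow> y \<in> B \<Longrightarrow> x * y \<in> B" and "closed B"
  using assms by (auto simp: unital_cstar_subalgebra_def)

lemma unital_cstar_subalgebra_UNIV: "unital_cstar_subalgebra (UNIV :: 'a::unital_cstar_algebra set)"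
  by (auto simp: unital_cstar_subalgebra_def operator_system_def)

lemma unital_cstar_subalgebra_generated: "unital_cstar_subalgebra (generated_cstar S)"
  unfolding generated_cstar_def
  by (rule hull_in) (auto simp: unital_cstar_subalgebra_def operator_system_def)

lemma subset_generated_cstar: "S \<subseteq> generated_cstar S"
  unfolding generated_cstar_def by (rule hull_subset)

lemma generated_cstar_minimal: "S \<subseteq> B \<Longrightarrow> unital_cstar_subalgebra B \<Longrightarrow> generated_cstar S \<subseteq> B"
  unfolding generated_cstar_def by (rule hull_minimal)

text \<open>Consecutive coefficients have ratio \<open>(1/2 - k) / (k + 1)\<close>, of modulus at
  most 1. This crude bound suffices to dominate the series of the square root by a geometric series
  when \<open>norm y < 1\<close>.\<close>

lemma abs_half_gchoose_le_one: "\<bar>(1/2::real) gchoose k\<bar> \<le> 1"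
proof (induction k)
  case (Suc k)
  have "(1/2::real) gchoose Suc k = (1/2 gchoose k) * ((1/2 - real k) / real (Suc k))"
    using gbinomial_mult_1[of "1/2::real" k] by (simp add: field_simps)
  moreover have "\<bar>(1/2 - real k) / real (Suc k)\<bar> \<le> 1" by (simp add: field_simps abs_le_iff)
  ultimately show ?case
    using mult_mono[OF Suc, of "\<bar>(1/2 - real k) / real (Suc k)\<bar>" 1] by (simp add: abs_mult)
qed auto

text \<open>The binomial series of \<open>\<surd>(1 - y)\<close> converges inside any closed subalgebra containing \<open>y\<close>.\<close>

lemma sqrt_one_minus:
  fixes y :: "'a::unital_cstar_algebra"
  assumes "norm y < 1" "star y = y" and B: "unital_cstar_subalgebra B" and y: "y \<in> B"
  obtains z where "star z = z" "z * z = 1 - y" "z \<in> B"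
proof -
  define c :: "nat \<Rightarrow> real" where "c k = ((1/2) gchoose k) * (- 1) ^ k" for k
  define f where "f k = c k *\<^sub>R y ^ k" for k
  have le: "norm (f k) \<le> norm y ^ k" for k
  proof -
    have "norm (f k) \<le> 1 * norm (y ^ k)"
      unfolding f_def norm_scaleR c_def
      by (intro mult_right_mono) (auto simp: abs_mult abs_half_gchoose_le_one)
    also have "\<dots> \<le> norm y ^ k" by (simp add: norm_power_ineq)
    finally show ?thesis .
  qed
  have sn: "summable (\<lambda>k. norm (f k))"
    by (rule summable_comparison_test'[where N = 0, OF summable_geometric[of "norm y"]]) (use assms le in auto)
  define z where "z = (\<Sum>k. f k)"
  have fz: "f sums z" unfolding z_def using sn summable_norm_cancel by blast
  have "star z = (\<Sum>k. star (f k))"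
    unfolding z_def by (rule bounded_linear.suminf[OF bounded_linear_star]) (use sn summable_norm_cancel in blast)
  also have "(\<lambda>k. star (f k)) = f" by (simp add: f_def star_scaleR star_power assms fun_eq_iff)
  finally have 1: "star z = z" by (simp add: z_def)
  \<comment> \<open>Vandermonde's identity adds the two upper arguments \<open>1/2\<close> to 1, and
    \<open>1 choose k\<close> vanishes from \<open>k = 2\<close> on; so the square of the series has
    only the terms \<open>1\<close> and \<open>- y\<close>.\<close>
  have conv: "(\<Sum>i\<le>k. f i * f (k - i)) = (if k = 0 then 1 else if k = 1 then - y else 0)" for k
  proof -
    have "(\<Sum>i\<le>k. f i * f (k - i)) = (\<Sum>i\<le>k. (c i * c (k - i)) *\<^sub>R y ^ k)"
      by (intro sum.cong) (auto simp: f_def simp flip: power_add)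
    also have "\<dots> = (\<Sum>i\<le>k. c i * c (k - i)) *\<^sub>R y ^ k" by (simp add: scaleR_sum_left)
    also have "(\<Sum>i\<le>k. c i * c (k - i)) = (\<Sum>i\<le>k. ((1/2) gchoose i) * ((1/2) gchoose (k - i))) * (-1) ^ k"
      unfolding sum_distrib_right by (intro sum.cong) (auto simp: c_def simp flip: power_add)
    also have "(\<Sum>i\<le>k. ((1/2::real) gchoose i) * ((1/2) gchoose (k - i))) = 1 gchoose k"
      using gbinomial_Vandermonde[of "1/2::real" "1/2" k] by (simp add: atMost_atLeast0)
    also have "(1::real) gchoose k = of_nat (1 choose k)" by (simp add: binomial_gbinomial)
    finally show ?thesis by (cases k rule: nat.exhaust; cases "k = 1") (auto simp: binomial_eq_0)
  qed
  have "z * z = (\<Sum>k. \<Sum>i\<le>k. f i * f (k - i))"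
    unfolding z_def by (rule Cauchy_product[OF sn sn])
  also have "\<dots> = (\<Sum>k\<in>{0,1::nat}. (if k = 0 then 1 else if k = 1 then - y else 0))"
    unfolding conv by (rule suminf_finite) auto
  finally have 2: "z * z = 1 - y" by simp
  note Bo = operator_systemD[OF unital_cstar_subalgebraD(1)[OF B]]
  have yk: "y ^ k \<in> B" for k by (induction k) (auto simp: Bo y unital_cstar_subalgebraD(2)[OF B])
  have "z \<in> B"
  proof (rule Lim_in_closed_set)
    show "(\<lambda>m. \<Sum>k<m. f k) \<longlonglongrightarrow> z" using fz by (simp add: sums_def)
    show "\<forall>\<^sub>F m in sequentially. (\<Sum>k<m. f k) \<in> B"
      by (auto simp: f_def intro!: always_eventually operator_system_sum unital_cstar_subalgebraD(1)[OF B] Bo yk)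
  qed (auto simp: unital_cstar_subalgebraD(3)[OF B])
  with 1 2 that show thesis by blast
qed

text \<open>The strict inequality puts \<open>star a * a / t\<^sup>2\<close> into the open unit
  ball, where the binomial series converges. That the root stays in \<open>B\<close> matters for
  maps whose values are controlled on \<open>B\<close> only.\<close>

lemma scaled_one_minus_star_mult:
  fixes a :: "'a::unital_cstar_algebra"
  assumes B: "unital_cstar_subalgebra B" and a: "a \<in> B" and t: "norm a < t"
  obtains z where "z \<in> B" "star z * z = t\<^sup>2 *\<^sub>R 1 - star a * a"
proof -
  note Bo = operator_systemD[OF unital_cstar_subalgebraD(1)[OF B]]
  have t0: "t > 0" using t norm_ge_zero[of a] by linarith
  define y where "y = (1 / t\<^sup>2) *\<^sub>R (star a * a)"
  have "norm y = (norm a / t)\<^sup>2" using t0 by (simp add: y_def cstar_identity power_divide)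
  also have "\<dots> < 1" using t t0 by (intro power_less_one_iff[THEN iffD2]) auto
  finally have "norm y < 1" .
  moreover have "star y = y" by (simp add: y_def star_scaleR star_mult star_star)
  moreover have "y \<in> B" using B a Bo unital_cstar_subalgebraD(2)[OF B] by (simp add: y_def)
  ultimately obtain z where z: "star z = z" "z * z = 1 - y" "z \<in> B"
    using sqrt_one_minus[OF _ _ B] by blast
  have "star (t *\<^sub>R z) * (t *\<^sub>R z) = t\<^sup>2 *\<^sub>R 1 - star a * a"
    using t0 by (simp add: star_scaleR z power2_eq_square scaleR_diff_right y_def)
  then show thesis using that[of "t *\<^sub>R z"] Bo(5)[OF z(3)] by blast
qed

section \<open>Extension of positive functionals\<close>

text \<open>Matrices over the algebra are modelled in the extension argument as functions of two
  indices; this makes them a real vector space to which the extension lemma applies.\<close>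

instantiation "fun" :: (type, real_vector) real_vector
begin

definition "r *\<^sub>R f = (\<lambda>x. r *\<^sub>R f x)"

instance
  by standard (auto simp: scaleR_fun_def fun_eq_iff scaleR_add_right scaleR_add_left)

end

text \<open>Extensions are handled as graphs: a positive linear relation is automatically single-valued,
  because 0 lies in the cone.\<close>

lemma positive_linear_extension:
  fixes M C :: "'b::real_vector set" and f :: "'b \<Rightarrow> real"
  assumes M: "subspace M"
    and f_add: "\<And>x y. x \<in> M \<Longrightarrow> y \<in> M \<Longrightarrow> f (x + y) = f x + f y"
    and f_scale: "\<And>t x. x \<in> M \<Longrightarrow> f (t *\<^sub>R x) = t * f x"
    and C0: "0 \<in> C" and C_add: "\<And>x y. x \<in> C \<Longrightarrow> y \<in> C \<Longrightarrow> x + y \<in> C"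
    and C_scale: "\<And>t x. 0 \<le> t \<Longrightarrow> x \<in> C \<Longrightarrow> t *\<^sub>R x \<in> C"
    and pos: "\<And>x. x \<in> M \<Longrightarrow> x \<in> C \<Longrightarrow> 0 \<le> f x"
    and cofinal: "\<And>x. \<exists>m\<in>M. m - x \<in> C"
  obtains F where "linear F" "\<And>x. x \<in> M \<Longrightarrow> F x = f x" "\<And>x. x \<in> C \<Longrightarrow> 0 \<le> F x"
proof -
  define adm where "adm G \<longleftrightarrow> (\<forall>x\<in>M. (x, f x) \<in> G) \<and>
    (\<forall>x r y s. (x, r) \<in> G \<longrightarrow> (y, s) \<in> G \<longrightarrow> (x + y, r + s) \<in> G) \<and>
    (\<forall>t x r. (x, r) \<in> G \<longrightarrow> (t *\<^sub>R x, t * r) \<in> G) \<and>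
    (\<forall>x r. (x, r) \<in> G \<longrightarrow> x \<in> C \<longrightarrow> 0 \<le> r)" for G :: "('b \<times> real) set"
  have "\<exists>G\<in>{G. adm G}. \<forall>G'\<in>{G. adm G}. G \<subseteq> G' \<longrightarrow> G' = G"
  proof (rule subset_Zorn_nonempty)
    have "adm ((\<lambda>x. (x, f x)) ` M)"
      unfolding adm_def using M pos
      by (auto simp: f_add f_scale image_iff subspace_add subspace_scale)
    then show "{G. adm G} \<noteq> {}" by blast
  next
    fix \<C> :: "('b \<times> real) set set"
    assume ne: "\<C> \<noteq> {}" and ch: "subset.chain {G. adm G} \<C>"
    have ad: "adm G" if "G \<in> \<C>" for G using ch that by (auto simp: subset.chain_def)
    have "\<forall>x\<in>M. (x, f x) \<in> \<Union>\<C>" using ne ad unfolding adm_def by blast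
    moreover have "(x + y, r + s) \<in> \<Union>\<C>" if xy: "(x, r) \<in> \<Union>\<C>" "(y, s) \<in> \<Union>\<C>" for x r y s
    proof -
      obtain G G' where G: "G \<in> \<C>" "(x, r) \<in> G" "G' \<in> \<C>" "(y, s) \<in> G'" using xy by blast
      then have "G \<subseteq> G' \<or> G' \<subseteq> G" using ch by (auto simp: subset.chain_def)
      moreover have "(x + y, r + s) \<in> H" if "H \<in> \<C>" "(x, r) \<in> H" "(y, s) \<in> H" for H
        using ad[OF that(1)] that(2,3) unfolding adm_def by blast
      ultimately have "(x + y, r + s) \<in> G \<or> (x + y, r + s) \<in> G'" using G by (meson subsetD)
      then show ?thesis using G by blast
    qed
    moreover have "\<forall>t x r. (x, r) \<in> \<Union>\<C> \<longrightarrow> (t *\<^sub>R x, t * r) \<in> \<Union>\<C>" using ad unfolding adm_def by blast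
    moreover have "\<forall>x r. (x, r) \<in> \<Union>\<C> \<longrightarrow> x \<in> C \<longrightarrow> 0 \<le> r" using ad unfolding adm_def by blast
    ultimately have "adm (\<Union>\<C>)" unfolding adm_def by blast
    then show "\<Union>\<C> \<in> {G. adm G}" by blast
  qed
  then obtain G where G: "adm G" and mx: "\<And>G'. adm G' \<Longrightarrow> G \<subseteq> G' \<Longrightarrow> G' = G" by blast
  have gM: "\<And>x. x \<in> M \<Longrightarrow> (x, f x) \<in> G"
    and ga: "\<And>x r y s. (x, r) \<in> G \<Longrightarrow> (y, s) \<in> G \<Longrightarrow> (x + y, r + s) \<in> G"
    and gs: "\<And>t x r. (x, r) \<in> G \<Longrightarrow> (t *\<^sub>R x, t * r) \<in> G"
    and gp: "\<And>x r. (x, r) \<in> G \<Longrightarrow> x \<in> C \<Longrightarrow> 0 \<le> r"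
    using G unfolding adm_def by blast+
  have gd: "(x - y, r - s) \<in> G" if "(x, r) \<in> G" "(y, s) \<in> G" for x r y s
    using ga[OF that(1) gs[OF that(2), of "-1"]] by simp
  have single: "r = s" if "(x, r) \<in> G" "(x, s) \<in> G" for x r s
    using gp[OF gd[OF that]] gp[OF gd[OF that(2,1)]] C0 by simp
  have total: "\<exists>r. (x0, r) \<in> G" for x0
  proof (rule ccontr)
    assume no: "\<nexists>r. (x0, r) \<in> G"
    \<comment> \<open>A value at \<open>x0\<close> must lie above the values at points below
      \<open>x0\<close> and below those at points above it, in the order given by \<open>C\<close>.
      Cofinality, used for \<open>x0\<close> and for \<open>- x0\<close>, makes both sets nonempty;
      \<open>Sup L\<close> is one admissible choice.\<close>
    define L where "L = {r. \<exists>m. (m, r) \<in> G \<and> x0 - m \<in> C}"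
    define U where "U = {r. \<exists>m. (m, r) \<in> G \<and> m - x0 \<in> C}"
    have LU: "l \<le> u" if lu: "l \<in> L" "u \<in> U" for l u
    proof -
      obtain m m' where m: "(m, l) \<in> G" "x0 - m \<in> C" "(m', u) \<in> G" "m' - x0 \<in> C"
        using lu by (auto simp: L_def U_def)
      have "m' - m \<in> C" using C_add[OF m(4,2)] by simp
      then show ?thesis using gp[OF gd[OF m(3,1)]] by simp
    qed
    obtain m where m: "m \<in> M" "m - x0 \<in> C" using cofinal by blast
    then have Une: "f m \<in> U" using gM by (auto simp: U_def)
    obtain m' where m': "m' \<in> M" "m' - (- x0) \<in> C" using cofinal by blast
    then have "f (- m') \<in> L"
      using gM[of "- m'"] subspace_neg[OF M] by (auto simp: L_def add.commute intro!: exI[of _ "- m'"])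
    then have Lne: "L \<noteq> {}" by blast
    define c where "c = Sup L"
    have cL: "l \<le> c" if "l \<in> L" for l
      unfolding c_def by (rule cSup_upper[OF that]) (use LU Une in \<open>auto simp: bdd_above_def\<close>)
    have cU: "c \<le> u" if "u \<in> U" for u
      unfolding c_def by (rule cSup_least[OF Lne]) (use LU that in auto)
    define G' where "G' = {(m + t *\<^sub>R x0, r + t * c) |m r t. (m, r) \<in> G}"
    have G'I: "(y, s) \<in> G'" if "(m, r) \<in> G" "y = m + t *\<^sub>R x0" "s = r + t * c" for m r t y s
      using that unfolding G'_def by blast
    have sub: "G \<subseteq> G'" using G'I[where t = 0] by auto
    have "adm G'"
      unfolding adm_def
    proof (intro conjI allI impI ballI)
      show "(x, f x) \<in> G'" if "x \<in> M" for x using gM that sub by blast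
    next
      fix x r y s assume "(x, r) \<in> G'" "(y, s) \<in> G'"
      then obtain m a t m' a' t' where
        "(m, a) \<in> G" "x = m + t *\<^sub>R x0" "r = a + t * c" "(m', a') \<in> G" "y = m' + t' *\<^sub>R x0" "s = a' + t' * c"
        unfolding G'_def by blast
      then show "(x + y, r + s) \<in> G'"
        by (intro G'I[where m = "m + m'" and r = "a + a'" and t = "t + t'"])
          (auto simp: ga algebra_simps)
    next
      fix t x r assume "(x, r) \<in> G'"
      then obtain m a t' where "(m, a) \<in> G" "x = m + t' *\<^sub>R x0" "r = a + t' * c"
        unfolding G'_def by blast
      then show "(t *\<^sub>R x, t * r) \<in> G'"
        by (intro G'I[where m = "t *\<^sub>R m" and r = "t * a" and t = "t * t'"], intro gs) (auto simp: algebra_simps)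
    next
      fix x r assume "(x, r) \<in> G'" and xC: "x \<in> C"
      then obtain m a t where m: "(m, a) \<in> G" "x = m + t *\<^sub>R x0" "r = a + t * c"
        unfolding G'_def by blast
      \<comment> \<open>After division by \<open>\<bar>t\<bar>\<close>, membership of
        \<open>x\<close> in the cone places a multiple of \<open>m\<close> below \<open>x0\<close>
        if \<open>t > 0\<close> and above it if \<open>t < 0\<close>; the claim is then the bound of
        \<open>c\<close> against \<open>L\<close> or \<open>U\<close>.\<close>
      consider "t = 0" | "t > 0" | "t < 0" by linarith
      then show "0 \<le> r"
      proof cases
        case 1
        then show ?thesis using gp m xC by simp
      next
        case 2
        have "x0 - (- (1 / t)) *\<^sub>R m = (1 / t) *\<^sub>R x" using 2 m by (simp add: scaleR_add_right)
        then have "x0 - (- (1 / t)) *\<^sub>R m \<in> C" using C_scale[of "1 / t" x] 2 xC by simp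
        then have "- (1 / t) * a \<in> L" using gs[OF m(1), of "- (1 / t)"] unfolding L_def by blast
        from cL[OF this] show ?thesis using 2 m by (simp add: field_simps)
      next
        case 3
        have "(- (1 / t)) *\<^sub>R m - x0 = (- (1 / t)) *\<^sub>R x" using 3 m by (simp add: scaleR_add_right)
        then have "(- (1 / t)) *\<^sub>R m - x0 \<in> C" using C_scale[of "- (1 / t)" x] 3 xC by simp
        then have "- (1 / t) * a \<in> U" using gs[OF m(1), of "- (1 / t)"] unfolding U_def by blast
        from cU[OF this] show ?thesis using 3 m by (simp add: field_simps)
      qed
    qed
    then have "G' = G" using mx sub by blast
    moreover have "(0, 0) \<in> G" using gM[OF subspace_0[OF M]] f_scale[OF subspace_0[OF M], of 0] by simp
    then have "(x0, c) \<in> G'" by (intro G'I[where m = 0 and r = 0 and t = 1]) auto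
    ultimately show False using no by blast
  qed
  define F where "F x = (THE r. (x, r) \<in> G)" for x
  have FG: "(x, F x) \<in> G" for x
    unfolding F_def by (rule theI') (use total single in blast)
  show thesis
  proof
    show "linear F"
    proof (rule linearI)
      show "F (x + y) = F x + F y" for x y by (rule single[OF FG ga[OF FG FG]])
      show "F (t *\<^sub>R x) = t *\<^sub>R F x" for t x
        unfolding real_scaleR_def by (rule single[OF FG gs[OF FG]])
    qed
    show "F x = f x" if "x \<in> M" for x by (rule single[OF FG gM[OF that]])
    show "0 \<le> F x" if "x \<in> C" for x by (rule gp[OF FG that])
  qed
qed

section \<open>Complete positivity via Gram matrices\<close>

lemma dim_mat_adjoint [simp]:
  "dim_row (mat_adjoint A) = dim_col A" "dim_col (mat_adjoint A) = dim_row A"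
  by (auto simp: mat_adjoint_def mat_of_rows_def)

lemma mat_adjoint_carrier [simp, intro]: "A \<in> carrier_mat m n \<Longrightarrow> mat_adjoint A \<in> carrier_mat n m"
  by (metis carrier_matD carrier_matI dim_mat_adjoint)

lemma index_mat_adjoint [simp]:
  assumes "i < dim_col A" "j < dim_row A"
  shows "mat_adjoint A $$ (i, j) = conjugate (A $$ (j, i))"
  using assms by (auto simp: mat_adjoint_def mat_of_rows_def)

lemma sum_lessThan_mult:
  fixes f :: "nat \<Rightarrow> 'b::comm_monoid_add"
  shows "(\<Sum>r<k * n. f r) = (\<Sum>p<k. \<Sum>i<n. f (p * n + i))"
proof (induction k)
  case (Suc k)
  have "(\<Sum>r<Suc k * n. f r) = (\<Sum>r<k * n. f r) + (\<Sum>r=k * n..<k * n + n. f r)"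
    by (simp add: lessThan_atLeast0 sum.atLeastLessThan_concat add.commute)
  also have "(\<Sum>r=k * n..<k * n + n. f r) = (\<Sum>i<n. f (k * n + i))"
    using sum.shift_bounds_nat_ivl[of f 0 "k * n" n] by (simp add: lessThan_atLeast0 add.commute)
  finally show ?case using Suc by simp
qed simp

lemma block_index_less: "p < k \<Longrightarrow> i < n \<Longrightarrow> p * n + i < k * (n::nat)"
proof -
  assume "p < k" "i < n"
  then have "p * n + i < Suc p * n" "Suc p * n \<le> k * n" by (simp, intro mult_le_mono1, simp)
  then show ?thesis by linarith
qed

lemma sum_swap_inner:
  "(\<Sum>a\<in>A. \<Sum>b\<in>B. \<Sum>c\<in>C. \<Sum>d\<in>D. \<Sum>i\<in>I. \<Sum>j\<in>J. f a b c d i j) =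
   (\<Sum>c\<in>C. \<Sum>d\<in>D. \<Sum>i\<in>I. \<Sum>j\<in>J. \<Sum>a\<in>A. \<Sum>b\<in>B. (f a b c d i j :: 'b::comm_monoid_add))"
  by (simp only: sum.swap[where A = B]) (simp only: sum.swap[where A = A])

text \<open>Entry \<open>(p, q)\<close> of \<open>b\<^sup>* b\<close>, where \<open>b\<close> has
  \<open>m\<close> rows and columns indexed by an arbitrary type. Free choice of the column index
  allows pairs and option values later.\<close>

definition gram :: "nat \<Rightarrow> (nat \<Rightarrow> 'i \<Rightarrow> 'a::unital_cstar_algebra) \<Rightarrow> 'i \<Rightarrow> 'i \<Rightarrow> 'a" where
  "gram m b p q = (\<Sum>l<m. star (b l p) * b l q)"

text \<open>The quadratic form of the amplified matrix at a block vector \<open>v\<close>, with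
  block index and inner index kept apart, so that the \<open>div\<close> and \<open>mod\<close>
  arithmetic of the flattened matrix does not spread.\<close>

definition mform :: "('a \<Rightarrow> complex mat) \<Rightarrow> nat \<Rightarrow> 'i set \<Rightarrow> ('i \<Rightarrow> 'i \<Rightarrow> 'a) \<Rightarrow>
    ('i \<Rightarrow> nat \<Rightarrow> complex) \<Rightarrow> complex" where
  "mform \<phi> n I x v = (\<Sum>p\<in>I. \<Sum>q\<in>I. \<Sum>i<n. \<Sum>j<n. cnj (v p i) * \<phi> (x p q) $$ (i, j) * v q j)"

lemma quadratic_form_eq:
  assumes "A \<in> carrier_mat m m" "u \<in> carrier_vec m"
  shows "(A *\<^sub>v u) \<bullet>c u = (\<Sum>r<m. \<Sum>c<m. cnj (u $ r) * A $$ (r, c) * u $ c)"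
  using assms
  by (auto simp: scalar_prod_def lessThan_atLeast0 sum_distrib_left sum_distrib_right mult_ac
      intro!: sum.cong)

lemma amplification_form_eq:
  assumes "x \<in> carrier_mat k k" "u \<in> carrier_vec (k * n)"
  shows "(amplification n \<phi> x *\<^sub>v u) \<bullet>c u =
    mform \<phi> n {..<k} (\<lambda>p q. x $$ (p, q)) (\<lambda>p i. u $ (p * n + i))"
proof -
  have lt: "p * n + i < k * n" if "p < k" "i < n" for p i
    using that by (rule block_index_less)
  have "(amplification n \<phi> x *\<^sub>v u) \<bullet>c u = (\<Sum>r<k * n. \<Sum>c<k * n.
      cnj (u $ r) * amplification n \<phi> x $$ (r, c) * u $ c)"
    by (rule quadratic_form_eq) (use assms in \<open>auto simp: amplification_def\<close>)
  also have "\<dots> = (\<Sum>p<k. \<Sum>i<n. \<Sum>q<k. \<Sum>j<n. cnj (u $ (p * n + i)) *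
      \<phi> (x $$ (p, q)) $$ (i, j) * u $ (q * n + j))"
    unfolding sum_lessThan_mult
    by (intro sum.cong refl) (use assms lt in \<open>auto simp: amplification_def\<close>)
  also have "\<dots> = mform \<phi> n {..<k} (\<lambda>p q. x $$ (p, q)) (\<lambda>p i. u $ (p * n + i))"
    unfolding mform_def by (intro sum.cong refl sum.swap)
  finally show ?thesis .
qed

text \<open>Rectangular families \<open>b\<close> are allowed on the right: they become square after padding with zeros.\<close>

lemma completely_positive_iff_nat:
  assumes S: "operator_system S"
  shows "completely_positive S n \<phi> \<longleftrightarrow>
    (\<forall>k m (b :: nat \<Rightarrow> nat \<Rightarrow> 'a::unital_cstar_algebra) v.
       (\<forall>p<k. \<forall>q<k. gram m b p q \<in> S) \<longrightarrow> 0 \<le> mform \<phi> n {..<k} (gram m b) v)"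
    (is "_ = (\<forall>k m b v. ?P k m b v)")
proof
  assume cp: "completely_positive S n \<phi>"
  show "\<forall>k m b v. ?P k m b v"
  proof (intro allI impI)
    fix k m and v :: "nat \<Rightarrow> nat \<Rightarrow> complex" and b :: "nat \<Rightarrow> nat \<Rightarrow> 'a"
    assume gS: "\<forall>p<k. \<forall>q<k. gram m b p q \<in> S"
    define K where "K = max k m"
    define c where "c = mat K K (\<lambda>(l, p). if l < m \<and> p < k then b l p else 0)"
    define x where "x = map_mat star (transpose_mat c) * c"
    define u where "u = vec (K * n) (\<lambda>r. if r div n < k then v (r div n) (r mod n) else 0)"
    have c: "c \<in> carrier_mat K K" and x: "x \<in> carrier_mat K K" and u: "u \<in> carrier_vec (K * n)"
      by (auto simp: c_def x_def u_def)
    have xe: "x $$ (p, q) = (if p < k \<and> q < k then gram m b p q else 0)" if "p < K" "q < K" for p q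
    proof -
      have "x $$ (p, q) = (\<Sum>l<K. star (if l < m \<and> p < k then b l p else 0) *
          (if l < m \<and> q < k then b l q else 0))"
        using that by (auto simp: x_def c_def scalar_prod_def lessThan_atLeast0 intro!: sum.cong)
      also have "\<dots> = (\<Sum>l<m. star (if l < m \<and> p < k then b l p else 0) *
          (if l < m \<and> q < k then b l q else 0))"
        by (rule sum.mono_neutral_right) (auto simp: K_def)
      also have "\<dots> = (if p < k \<and> q < k then gram m b p q else 0)"
        unfolding gram_def by auto
      finally show ?thesis .
    qed
    have "elements_mat x \<subseteq> S"
      using x gS operator_systemD(2)[OF S] by (auto simp: elements_mat_def xe)
    moreover have "cstar_mat_pos K x" using c by (auto simp: cstar_mat_pos_def x_def)
    ultimately have "complex_mat_pos (K * n) (amplification n \<phi> x)"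
      using cp x unfolding completely_positive_def by blast
    then have "0 \<le> (amplification n \<phi> x *\<^sub>v u) \<bullet>c u" using u by (auto simp: complex_mat_pos_def)
    also have "\<dots> = mform \<phi> n {..<K} (\<lambda>p q. x $$ (p, q)) (\<lambda>p i. u $ (p * n + i))"
      by (rule amplification_form_eq[OF x u])
    also have "\<dots> = mform \<phi> n {..<k} (gram m b) v"
    proof -
      have ue: "u $ (p * n + i) = (if p < k then v p i else 0)" if "p < K" "i < n" for p i
      proof -
        have "p * n + i < K * n" using that by (rule block_index_less)
        then show ?thesis using that by (simp add: u_def)
      qed
      have "mform \<phi> n {..<K} (\<lambda>p q. x $$ (p, q)) (\<lambda>p i. u $ (p * n + i)) =
        (\<Sum>p<K. \<Sum>q<K. \<Sum>i<n. \<Sum>j<n. if p < k \<and> q < k then cnj (v p i) * \<phi> (gram m b p q) $$ (i, j) * v q j else 0)"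
        unfolding mform_def by (intro sum.cong refl) (simp add: xe ue)
      also have "\<dots> = (\<Sum>p<k. \<Sum>q<K. \<Sum>i<n. \<Sum>j<n. if p < k \<and> q < k then cnj (v p i) * \<phi> (gram m b p q) $$ (i, j) * v q j else 0)"
        by (rule sum.mono_neutral_right) (auto simp: K_def)
      also have "\<dots> = (\<Sum>p<k. \<Sum>q<k. \<Sum>i<n. \<Sum>j<n. if p < k \<and> q < k then cnj (v p i) * \<phi> (gram m b p q) $$ (i, j) * v q j else 0)"
        by (rule sum.cong[OF refl], rule sum.mono_neutral_right) (auto simp: K_def)
      also have "\<dots> = mform \<phi> n {..<k} (gram m b) v"
        unfolding mform_def by (intro sum.cong refl) auto
      finally show ?thesis .
    qed
    finally show "0 \<le> mform \<phi> n {..<k} (gram m b) v" .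
  qed
next
  assume P: "\<forall>k m b v. ?P k m b v"
  show "completely_positive S n \<phi>"
    unfolding completely_positive_def
  proof (intro allI ballI impI)
    fix k and x :: "'a mat"
    assume x: "x \<in> carrier_mat k k" and xS: "elements_mat x \<subseteq> S" and "cstar_mat_pos k x"
    then obtain c where c: "c \<in> carrier_mat k k" "x = map_mat star (transpose_mat c) * c"
      unfolding cstar_mat_pos_def by blast
    have xe: "x $$ (p, q) = gram k (\<lambda>l p. c $$ (l, p)) p q" if "p < k" "q < k" for p q
      using that c by (auto simp: gram_def scalar_prod_def lessThan_atLeast0 intro!: sum.cong)
    have xin: "x $$ (p, q) \<in> S" if "p < k" "q < k" for p q
      using xS x that elements_matI[of x k k p q] by auto
    show "complex_mat_pos (k * n) (amplification n \<phi> x)"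
      unfolding complex_mat_pos_def
    proof (intro conjI ballI)
      show "amplification n \<phi> x \<in> carrier_mat (k * n) (k * n)" using x by (auto simp: amplification_def)
      fix u :: "complex vec" assume u: "u \<in> carrier_vec (k * n)"
      have "mform \<phi> n {..<k} (\<lambda>p q. x $$ (p, q)) (\<lambda>p i. u $ (p * n + i)) =
        mform \<phi> n {..<k} (gram k (\<lambda>l p. c $$ (l, p))) (\<lambda>p i. u $ (p * n + i))"
        unfolding mform_def by (intro sum.cong refl) (simp add: xe)
      moreover have "0 \<le> mform \<phi> n {..<k} (gram k (\<lambda>l p. c $$ (l, p))) (\<lambda>p i. u $ (p * n + i))"
        using P xin xe by metis
      ultimately show "0 \<le> (amplification n \<phi> x *\<^sub>v u) \<bullet>c u"
        using amplification_form_eq[OF x u] by metis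
    qed
  qed
qed

text \<open>Enumerating \<open>I\<close> carries positivity from initial segments of the naturals to
  any finite index set.\<close>

lemma completely_positive_form_nonneg:
  fixes b :: "nat \<Rightarrow> 'i \<Rightarrow> 'a::unital_cstar_algebra"
  assumes S: "operator_system S" and cp: "completely_positive S n \<phi>" and I: "finite I"
    and gS: "\<And>p q. p \<in> I \<Longrightarrow> q \<in> I \<Longrightarrow> gram m b p q \<in> S"
  shows "0 \<le> mform \<phi> n I (gram m b) v"
proof -
  obtain h where h: "bij_betw h {..<card I} I"
    using ex_bij_betw_nat_finite[OF I] by (auto simp: lessThan_atLeast0)
  have "mform \<phi> n I (gram m b) v = mform \<phi> n {..<card I} (gram m (\<lambda>l p. b l (h p))) (\<lambda>p. v (h p))"
    unfolding mform_def sum.reindex_bij_betw[OF h, symmetric] by (simp add: gram_def)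
  moreover have "gram m (\<lambda>l p. b l (h p)) p q \<in> S" if "p < card I" "q < card I" for p q
  proof -
    have "h p \<in> I" "h q \<in> I" using h that by (auto dest: bij_betwE)
    from gS[OF this] show ?thesis by (simp add: gram_def)
  qed
  ultimately show ?thesis using cp unfolding completely_positive_iff_nat[OF S] by simp
qed

lemma completely_positiveI:
  assumes S: "operator_system S"
    and "\<And>k m (b :: nat \<Rightarrow> nat \<Rightarrow> 'a::unital_cstar_algebra) v.
      (\<And>p q. p < k \<Longrightarrow> q < k \<Longrightarrow> gram m b p q \<in> S) \<Longrightarrow> 0 \<le> mform \<phi> n {..<k} (gram m b) v"
  shows "completely_positive S n \<phi>"
  unfolding completely_positive_iff_nat[OF S] using assms(2) by auto

section \<open>Entrywise linearity of maps into matrices\<close>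

lemma linear_map_onD:
  assumes "linear_map_on S n \<phi>"
  shows "\<And>x. x \<in> S \<Longrightarrow> \<phi> x \<in> carrier_mat n n"
    and "\<And>x y. x \<in> S \<Longrightarrow> y \<in> S \<Longrightarrow> \<phi> (x + y) = \<phi> x + \<phi> y"
    and "\<And>c x. x \<in> S \<Longrightarrow> \<phi> (scaleC c x) = c \<cdot>\<^sub>m \<phi> x"
  using assms by (auto simp: linear_map_on_def)

lemma linear_map_on_index:
  assumes L: "linear_map_on S n \<phi>" and S: "operator_system S" and ij: "i < n" "j < n"
  shows "x \<in> S \<Longrightarrow> y \<in> S \<Longrightarrow> \<phi> (x + y) $$ (i, j) = \<phi> x $$ (i, j) + \<phi> y $$ (i, j)"
    and "x \<in> S \<Longrightarrow> \<phi> (scaleC c x) $$ (i, j) = c * \<phi> x $$ (i, j)"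
    and "x \<in> S \<Longrightarrow> \<phi> (r *\<^sub>R x) $$ (i, j) = r *\<^sub>R \<phi> x $$ (i, j)"
    and "\<phi> 0 $$ (i, j) = 0"
    and "x \<in> S \<Longrightarrow> \<phi> (- x) $$ (i, j) = - \<phi> x $$ (i, j)"
    and "x \<in> S \<Longrightarrow> y \<in> S \<Longrightarrow> \<phi> (x - y) $$ (i, j) = \<phi> x $$ (i, j) - \<phi> y $$ (i, j)"
proof -
  note D = linear_map_onD[OF L]
  have add: "\<phi> (x + y) $$ (i, j) = \<phi> x $$ (i, j) + \<phi> y $$ (i, j)" if "x \<in> S" "y \<in> S" for x y
    using D(1)[OF that(1)] D(1)[OF that(2)] ij by (simp add: D(2) that)
  have sc: "\<phi> (scaleC c x) $$ (i, j) = c * \<phi> x $$ (i, j)" if "x \<in> S" for c x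
    using D(1)[OF that] ij by (simp add: D(3) that)
  have mi: "\<phi> (- x) $$ (i, j) = - \<phi> x $$ (i, j)" if "x \<in> S" for x
    using sc[OF that, of "-1"] by (simp add: scaleC_minus_one)
  show "x \<in> S \<Longrightarrow> y \<in> S \<Longrightarrow> \<phi> (x + y) $$ (i, j) = \<phi> x $$ (i, j) + \<phi> y $$ (i, j)" by (rule add)
  show "x \<in> S \<Longrightarrow> \<phi> (scaleC c x) $$ (i, j) = c * \<phi> x $$ (i, j)" by (rule sc)
  show "x \<in> S \<Longrightarrow> \<phi> (r *\<^sub>R x) $$ (i, j) = r *\<^sub>R \<phi> x $$ (i, j)"
    using sc[of x "of_real r"] by (simp add: scaleC_of_real scaleR_conv_of_real)
  show "\<phi> 0 $$ (i, j) = 0" using sc[OF operator_systemD(2)[OF S], of 0] by simp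
  show "x \<in> S \<Longrightarrow> \<phi> (- x) $$ (i, j) = - \<phi> x $$ (i, j)" by (rule mi)
  show "\<phi> (x - y) $$ (i, j) = \<phi> x $$ (i, j) - \<phi> y $$ (i, j)" if "x \<in> S" "y \<in> S"
    using add[OF that(1) operator_systemD(7)[OF S that(2)]] mi[OF that(2)] by simp
qed

lemma linear_map_on_index_sum:
  assumes L: "linear_map_on S n \<phi>" and S: "operator_system S" and ij: "i < n" "j < n"
    and "\<And>k. k \<in> K \<Longrightarrow> f k \<in> S"
  shows "\<phi> (\<Sum>k\<in>K. f k) $$ (i, j) = (\<Sum>k\<in>K. \<phi> (f k) $$ (i, j))"
  using assms(5)
proof (induction K rule: infinite_finite_induct)
  case (insert k K)
  then have "(\<Sum>k\<in>K. f k) \<in> S" by (intro operator_system_sum[OF S]) auto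
  then show ?case using insert linear_map_on_index(1)[OF L S ij, of "f k" "\<Sum>k\<in>K. f k"] by simp
qed (simp_all add: linear_map_on_index(4)[OF L S ij])

lemma UCP_D:
  assumes "\<phi> \<in> UCP S n"
  shows "linear_map_on S n \<phi>" "\<phi> 1 = 1\<^sub>m n" "completely_positive S n \<phi>"
  using assms by (auto simp: UCP_def)

lemma UCP_subset: "\<phi> \<in> UCP T n \<Longrightarrow> S \<subseteq> T \<Longrightarrow> \<phi> \<in> UCP S n"
  unfolding UCP_def linear_map_on_def completely_positive_def by blast

lemma sum_mult_delta:
  fixes f :: "'b \<Rightarrow> complex"
  assumes "finite A" "a \<in> A"
  shows "(\<Sum>j\<in>A. f j * (if j = a then c else 0)) = f a * c"
  by (subst sum.remove[OF assms]) auto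

text \<open>A vector supported in block \<open>p\<close> at the single coordinate \<open>r p\<close>
  selects one entry from each block. This is how complete positivity yields statements about
  individual matrix entries.\<close>

lemma mform_single:
  assumes "\<And>p. p \<in> I \<Longrightarrow> r p < n"
  shows "mform \<phi> n I x (\<lambda>p i. if i = r p then u p else 0) =
    (\<Sum>p\<in>I. \<Sum>q\<in>I. cnj (u p) * \<phi> (x p q) $$ (r p, r q) * u q)"
proof -
  have "(\<Sum>i<n. \<Sum>j<n. cnj (if i = r p then u p else 0) * \<phi> (x p q) $$ (i, j) * (if j = r q then u q else 0))
    = cnj (u p) * \<phi> (x p q) $$ (r p, r q) * u q" if "p \<in> I" "q \<in> I" for p q
  proof -
    have "(\<Sum>i<n. \<Sum>j<n. cnj (if i = r p then u p else 0) * \<phi> (x p q) $$ (i, j) * (if j = r q then u q else 0))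
      = (\<Sum>i<n. if i = r p then (\<Sum>j<n. if j = r q then cnj (u p) * \<phi> (x p q) $$ (i, j) * u q else 0) else 0)"
      by (intro sum.cong refl) (use assms that in \<open>auto simp: sum_mult_delta\<close>)
    also have "\<dots> = cnj (u p) * \<phi> (x p q) $$ (r p, r q) * u q" using assms that by (simp add: sum.delta)
    finally show ?thesis .
  qed
  then show ?thesis unfolding mform_def by (intro sum.cong refl) auto
qed

text \<open>Apply complete positivity to \<open>[1, y; y\<^sup>*, t\<^sup>2]\<close>, which is the Gram matrix of
  the rows \<open>(1, y)\<close> and \<open>(0, z)\<close> with \<open>z\<^sup>* z = t\<^sup>2 - y\<^sup>* y\<close>.\<close>

lemma UCP_star:
  assumes S: "operator_system S" and \<phi>: "\<phi> \<in> UCP S n" and y: "y \<in> S"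
  shows "\<phi> (star y) = mat_adjoint (\<phi> y)"
proof (rule eq_matI)
  note L = UCP_D(1)[OF \<phi>]
  note So = operator_systemD[OF S]
  have c: "\<phi> y \<in> carrier_mat n n" "\<phi> (star y) \<in> carrier_mat n n" using linear_map_onD(1)[OF L] So y by auto
  then show "dim_row (\<phi> (star y)) = dim_row (mat_adjoint (\<phi> y))"
    "dim_col (\<phi> (star y)) = dim_col (mat_adjoint (\<phi> y))" by auto
  fix j i assume "j < dim_row (mat_adjoint (\<phi> y))" "i < dim_col (mat_adjoint (\<phi> y))"
  then have ij: "i < n" "j < n" using c by auto
  obtain t where t: "norm y < t" using gt_ex by blast
  obtain z where z: "star z * z = t\<^sup>2 *\<^sub>R 1 - star y * y"
    by (rule scaled_one_minus_star_mult[OF unital_cstar_subalgebra_UNIV UNIV_I t])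
  define b where "b l p = (if l = (0::nat) then (if p = (0::nat) then 1 else y) else (if p = 0 then 0 else z))" for l p
  have g: "gram 2 b 0 0 = 1" "gram 2 b 0 1 = y" "gram 2 b 1 0 = star y" "gram 2 b 1 1 = t\<^sup>2 *\<^sub>R 1"
    by (auto simp: gram_def b_def z numeral_2_eq_2)
  have gS: "gram 2 b p q \<in> S" if "p \<in> {0,1}" "q \<in> {0,1}" for p q
    using that g So y by auto
  have im: "Im (\<phi> (t\<^sup>2 *\<^sub>R 1) $$ (j, j)) = 0"
    using linear_map_on_index(3)[OF L S ij(2) ij(2) So(1), of "t\<^sup>2"] UCP_D(2)[OF \<phi>] ij by simp
  \<comment> \<open>Both diagonal terms of the form are real, so the off-diagonal ones have
    imaginary parts summing to zero for every \<open>u\<close>. The choices \<open>u = 1\<close> and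
    \<open>u = \<i>\<close> then fix real and imaginary part of the entry of
    \<open>\<phi> (star y)\<close>.\<close>
  have key: "Im (cnj u * \<phi> y $$ (i, j) + \<phi> (star y) $$ (j, i) * u) = 0" for u
  proof -
    have "0 \<le> mform \<phi> n {0,1} (gram 2 b) (\<lambda>p a. if a = (if p = 0 then i else j) then (if p = 0 then u else 1) else 0)"
      by (rule completely_positive_form_nonneg[OF S UCP_D(3)[OF \<phi>]]) (use gS in auto)
    also have "\<dots> = (\<Sum>p\<in>{0,1}. \<Sum>q\<in>{0,1}. cnj (if p = 0 then u else 1) * \<phi> (gram 2 b p q) $$ ((if p = 0 then i else j), (if q = 0 then i else j)) * (if q = 0 then u else 1))"
      by (rule mform_single) (use ij in auto)
    also have "\<dots> = cnj u * u + cnj u * \<phi> y $$ (i, j) + \<phi> (star y) $$ (j, i) * u + \<phi> (t\<^sup>2 *\<^sub>R 1) $$ (j, j)"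
      using g by (simp add: UCP_D(2)[OF \<phi>] ij)
    finally have "Im (cnj u * u + cnj u * \<phi> y $$ (i, j) + \<phi> (star y) $$ (j, i) * u + \<phi> (t\<^sup>2 *\<^sub>R 1) $$ (j, j)) = 0"
      by (simp add: less_eq_complex_def)
    then show ?thesis using im by (simp add: algebra_simps)
  qed
  have "\<phi> (star y) $$ (j, i) = cnj (\<phi> y $$ (i, j))"
    using key[of 1] key[of \<i>] by (auto simp: complex_eq_iff)
  then show "\<phi> (star y) $$ (j, i) = mat_adjoint (\<phi> y) $$ (j, i)" using c ij by simp
qed

text \<open>The compression of the Stinespring representation of \<open>\<Phi>\<close> along the map
  \<open>e\<^sub>\<alpha> \<mapsto> \<Sum>c. x c \<otimes> R c e\<^sub>\<alpha>\<close>.\<close>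

definition compression :: "('a::unital_cstar_algebra \<Rightarrow> complex mat) \<Rightarrow> nat \<Rightarrow> nat \<Rightarrow> nat \<Rightarrow> (nat \<Rightarrow> 'a) \<Rightarrow>
    (nat \<Rightarrow> nat \<Rightarrow> nat \<Rightarrow> complex) \<Rightarrow> 'a \<Rightarrow> complex mat" where
  "compression \<Phi> n N M x R s = mat N N (\<lambda>(\<alpha>, \<beta>). \<Sum>c<M. \<Sum>d<M. \<Sum>i<n. \<Sum>j<n.
     cnj (R c i \<alpha>) * \<Phi> (star (x c) * s * x d) $$ (i, j) * R d j \<beta>)"

text \<open>The products \<open>b l p * x c\<close>, indexed by pairs \<open>(p, c)\<close>, have
  Gram entries \<open>star (x c) * gram m b p q * x d\<close>. The form of the compression at
  \<open>v\<close> is therefore a form of \<open>\<Phi>\<close> at the vector that \<open>R\<close>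
  produces from \<open>v\<close>. Keeping \<open>S\<close> and \<open>B\<close> apart permits
  vectors \<open>x c\<close> outside \<open>S\<close>.\<close>

lemma compression_linear_cp:
  assumes S: "operator_system S" and B: "operator_system B"
    and L: "linear_map_on B n \<Phi>" and cp: "completely_positive B n \<Phi>"
    and x: "\<And>c d s. c < M \<Longrightarrow> d < M \<Longrightarrow> s \<in> S \<Longrightarrow> star (x c) * s * x d \<in> B"
  shows "linear_map_on S N (compression \<Phi> n N M x R)"
    and "completely_positive S N (compression \<Phi> n N M x R)"
proof -
  show "linear_map_on S N (compression \<Phi> n N M x R)"
    unfolding linear_map_on_def
  proof (intro conjI ballI allI)
    show "compression \<Phi> n N M x R s \<in> carrier_mat N N" for s by (simp add: compression_def)
    fix s t assume st: "s \<in> S" "t \<in> S"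
    show "compression \<Phi> n N M x R (s + t) = compression \<Phi> n N M x R s + compression \<Phi> n N M x R t"
    proof (rule eq_matI)
      fix \<alpha> \<beta> assume "\<alpha> < dim_row (compression \<Phi> n N M x R s + compression \<Phi> n N M x R t)"
        "\<beta> < dim_col (compression \<Phi> n N M x R s + compression \<Phi> n N M x R t)"
      then have "\<alpha> < N" "\<beta> < N" by (auto simp: compression_def)
      then show "compression \<Phi> n N M x R (s + t) $$ (\<alpha>, \<beta>) =
          (compression \<Phi> n N M x R s + compression \<Phi> n N M x R t) $$ (\<alpha>, \<beta>)"
        unfolding compression_def
        by (simp, unfold sum.distrib[symmetric], intro sum.cong refl)
          (simp add: distrib_left distrib_right linear_map_on_index(1)[OF L B] x st)
    qed (auto simp: compression_def)
  next
    fix c s assume s: "s \<in> S"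
    show "compression \<Phi> n N M x R (scaleC c s) = c \<cdot>\<^sub>m compression \<Phi> n N M x R s"
    proof (rule eq_matI)
      fix \<alpha> \<beta> assume "\<alpha> < dim_row (c \<cdot>\<^sub>m compression \<Phi> n N M x R s)"
        "\<beta> < dim_col (c \<cdot>\<^sub>m compression \<Phi> n N M x R s)"
      then have "\<alpha> < N" "\<beta> < N" by (auto simp: compression_def)
      then show "compression \<Phi> n N M x R (scaleC c s) $$ (\<alpha>, \<beta>) =
          (c \<cdot>\<^sub>m compression \<Phi> n N M x R s) $$ (\<alpha>, \<beta>)"
        unfolding compression_def
        by (simp, unfold sum_distrib_left, intro sum.cong refl)
          (simp add: scaleC_mult_left scaleC_mult_right linear_map_on_index(2)[OF L B] x s)
    qed (auto simp: compression_def)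
  qed
  show "completely_positive S N (compression \<Phi> n N M x R)"
  proof (rule completely_positiveI[OF S])
    fix k m and v :: "nat \<Rightarrow> nat \<Rightarrow> complex" and b :: "nat \<Rightarrow> nat \<Rightarrow> 'a"
    assume gS: "\<And>p q. p < k \<Longrightarrow> q < k \<Longrightarrow> gram m b p q \<in> S"
    define b' where "b' l = (\<lambda>(p, c). b l p * x c)" for l
    define w where "w = (\<lambda>(p, c) i. \<Sum>\<alpha><N. R c i \<alpha> * v p \<alpha>)"
    have g': "gram m b' (p, c) (q, d) = star (x c) * gram m b p q * x d" for p c q d
      by (simp add: gram_def b'_def star_mult sum_distrib_left sum_distrib_right mult.assoc)
    have "0 \<le> mform \<Phi> n ({..<k} \<times> {..<M}) (gram m b') w"
      by (rule completely_positive_form_nonneg[OF B cp]) (auto simp: g' x gS)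
    also have "\<dots> = (\<Sum>p<k. \<Sum>c<M. \<Sum>q<k. \<Sum>d<M. \<Sum>i<n. \<Sum>j<n.
        cnj (w (p, c) i) * \<Phi> (star (x c) * gram m b p q * x d) $$ (i, j) * w (q, d) j)"
      unfolding mform_def by (simp add: g' sum.cartesian_product')
    also have "\<dots> = (\<Sum>p<k. \<Sum>q<k. \<Sum>c<M. \<Sum>d<M. \<Sum>i<n. \<Sum>j<n.
        cnj (w (p, c) i) * \<Phi> (star (x c) * gram m b p q * x d) $$ (i, j) * w (q, d) j)"
      by (intro sum.cong refl sum.swap)
    also have "\<dots> = (\<Sum>p<k. \<Sum>q<k. \<Sum>c<M. \<Sum>d<M. \<Sum>i<n. \<Sum>j<n. \<Sum>\<alpha><N. \<Sum>\<beta><N.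
        cnj (v p \<alpha>) * (cnj (R c i \<alpha>) * \<Phi> (star (x c) * gram m b p q * x d) $$ (i, j) * R d j \<beta>) * v q \<beta>)"
      by (intro sum.cong refl) (simp add: w_def sum_distrib_left sum_distrib_right mult_ac)
    also have "\<dots> = (\<Sum>p<k. \<Sum>q<k. \<Sum>\<alpha><N. \<Sum>\<beta><N. \<Sum>c<M. \<Sum>d<M. \<Sum>i<n. \<Sum>j<n.
        cnj (v p \<alpha>) * (cnj (R c i \<alpha>) * \<Phi> (star (x c) * gram m b p q * x d) $$ (i, j) * R d j \<beta>) * v q \<beta>)"
      by (intro sum.cong refl sum_swap_inner[symmetric])
    also have "\<dots> = mform (compression \<Phi> n N M x R) N {..<k} (gram m b) v"
      unfolding mform_def
      by (intro sum.cong refl) (simp add: compression_def sum_distrib_left sum_distrib_right)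
    finally show "0 \<le> mform (compression \<Phi> n N M x R) N {..<k} (gram m b) v" .
  qed
qed

section \<open>Arveson's extension theorem\<close>

lemma gram_0 [simp]: "gram 0 b p q = 0"
  by (simp add: gram_def)

lemma star_gram: "star (gram m b p q) = gram m b q p"
  by (simp add: gram_def star_sum star_mult star_star)

text \<open>Stacking the rows of the two families; this is what makes the cone below closed under
  sums without any square root.\<close>

lemma gram_add:
  "gram m b p q + gram m' b' p q = gram (m + m') (\<lambda>l. if l < m then b l else b' (l - m)) p q"
proof -
  have "gram (m + m') (\<lambda>l. if l < m then b l else b' (l - m)) p q =
    (\<Sum>l<m. star (b l p) * b l q) + (\<Sum>l=m..<m + m'. star (b' (l - m) p) * b' (l - m) q)"
    unfolding gram_def
    by (subst sum.atLeastLessThan_concat[of 0 m "m + m'", symmetric, simplified lessThan_atLeast0[symmetric]])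
      (auto simp: lessThan_atLeast0)
  also have "(\<Sum>l=m..<m + m'. star (b' (l - m) p) * b' (l - m) q) = gram m' b' p q"
    using sum.shift_bounds_nat_ivl[of "\<lambda>l. star (b' (l - m) p) * b' (l - m) q" 0 m m']
    by (simp add: gram_def lessThan_atLeast0 add.commute)
  finally show ?thesis by (simp add: gram_def)
qed

lemma gram_scaleR:
  assumes "0 \<le> t"
  shows "t *\<^sub>R gram m b p q = gram m (\<lambda>l p. sqrt t *\<^sub>R b l p) p q"
  using assms by (simp add: gram_def star_scaleR scaleR_sum_right)

text \<open>The cone of \<open>n \<times> n\<close> matrices whose Hermitian part is a Gram matrix; it is used in place of the
  positive cone so that it spans all matrices together with \<open>M\<^sub>n(S)\<close>. Only entries below \<open>n\<close> matter.\<close>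

definition hpos :: "nat \<Rightarrow> (nat \<Rightarrow> nat \<Rightarrow> 'a::unital_cstar_algebra) set" where
  "hpos n = {x. \<exists>m b. \<forall>i<n. \<forall>j<n. x i j + star (x j i) = gram m b i j}"

lemma hpos_cong: "(\<And>i j. i < n \<Longrightarrow> j < n \<Longrightarrow> x i j = y i j) \<Longrightarrow> x \<in> hpos n \<longleftrightarrow> y \<in> hpos n"
  by (simp add: hpos_def)

lemma hpos_zero: "0 \<in> hpos n"
  unfolding hpos_def by (auto intro!: exI[of _ 0])

lemma hpos_add: 
  assumes "x \<in> hpos n" "y \<in> hpos n" shows "x + y \<in> hpos n"
proof -
  obtain m b m' b' where x: "\<And>i j. i < n \<Longrightarrow> j < n \<Longrightarrow> x i j + star (x j i) = gram m b i j"
    and y: "\<And>i j. i < n \<Longrightarrow> j < n \<Longrightarrow> y i j + star (y j i) = gram m' b' i j"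
    using assms unfolding hpos_def by blast
  have "(x + y) i j + star ((x + y) j i) = gram (m + m') (\<lambda>l. if l < m then b l else b' (l - m)) i j"
    if "i < n" "j < n" for i j
  proof -
    have "(x + y) i j + star ((x + y) j i) = (x i j + star (x j i)) + (y i j + star (y j i))"
      by (simp add: star_add add_ac)
    then show ?thesis by (simp only: x[OF that] y[OF that] gram_add)
  qed
  then show ?thesis unfolding hpos_def by blast
qed

lemma hpos_scaleR: 
  assumes "0 \<le> t" "x \<in> hpos n" shows "t *\<^sub>R x \<in> hpos n"
proof -
  obtain m b where x: "\<And>i j. i < n \<Longrightarrow> j < n \<Longrightarrow> x i j + star (x j i) = gram m b i j"
    using assms unfolding hpos_def by blast
  have "(t *\<^sub>R x) i j + star ((t *\<^sub>R x) j i) = gram m (\<lambda>l p. sqrt t *\<^sub>R b l p) i j"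
    if "i < n" "j < n" for i j
  proof -
    have "(t *\<^sub>R x) i j + star ((t *\<^sub>R x) j i) = t *\<^sub>R (x i j + star (x j i))"
      by (simp add: scaleR_fun_def star_scaleR scaleR_add_right)
    then show ?thesis by (simp only: x[OF that] gram_scaleR[OF assms(1)])
  qed
  then show ?thesis unfolding hpos_def by blast
qed

lemma hpos_sum: "(\<And>k. k \<in> I \<Longrightarrow> f k \<in> hpos n) \<Longrightarrow> (\<Sum>k\<in>I. f k) \<in> hpos n"
  by (induction I rule: infinite_finite_induct) (auto simp: hpos_zero hpos_add)

definition matrix_unit :: "nat \<Rightarrow> nat \<Rightarrow> 'a::zero \<Rightarrow> nat \<Rightarrow> nat \<Rightarrow> 'a" where
  "matrix_unit k l a = (\<lambda>i j. if i = k \<and> j = l then a else 0)"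

lemma sum_fun_apply: "(\<Sum>k\<in>I. f k) x = (\<Sum>k\<in>I. f k x)"
  by (induction I rule: infinite_finite_induct) auto

lemma sum_matrix_unit:
  assumes "i < n" "j < n"
  shows "(\<Sum>k<n. \<Sum>l<n. matrix_unit k l (x k l)) i j = (x i j :: 'a::comm_monoid_add)"
proof -
  have "(\<Sum>k<n. \<Sum>l<n. matrix_unit k l (x k l)) i j = (\<Sum>k<n. \<Sum>l<n. if k = i then (if l = j then x k l else 0) else 0)"
    by (simp add: sum_fun_apply matrix_unit_def) (intro sum.cong refl, auto)
  also have "\<dots> = (\<Sum>k<n. if k = i then (\<Sum>l<n. if l = j then x k l else 0) else 0)"
    by (intro sum.cong refl) auto
  also have "\<dots> = x i j" using assms by simp
  finally show ?thesis .
qed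

text \<open>For a single entry \<open>y\<close> at \<open>(k, l)\<close>, take the rows
  \<open>e\<^sub>k - y e\<^sub>l\<close> and \<open>z e\<^sub>l\<close> with
  \<open>star z * z = t\<^sup>2 - star y * y\<close>. Their Gram matrix has diagonal contributions 1
  at \<open>k\<close> and \<open>t\<^sup>2\<close> at \<open>l\<close>, and off-diagonal
  contributions \<open>- y\<close> and \<open>- star y\<close>. The cone adds the adjoint matrix,
  whence the factor 1/2 in \<open>d\<close>. A general \<open>x\<close> is the sum of its entries,
  and the cone is closed under sums.\<close>

lemma hpos_cofinal:
  fixes x :: "nat \<Rightarrow> nat \<Rightarrow> 'a::unital_cstar_algebra"
  shows "\<exists>d :: nat \<Rightarrow> nat \<Rightarrow> real. (\<lambda>i j. d i j *\<^sub>R 1) - x \<in> hpos n"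
proof -
  have 1: "\<exists>d :: nat \<Rightarrow> nat \<Rightarrow> real. (\<lambda>i j. d i j *\<^sub>R 1) - matrix_unit k l y \<in> hpos n" for k l and y :: 'a
  proof -
    obtain t where t: "norm (- y) < t" using gt_ex by blast
    obtain z where z: "star z * z = t\<^sup>2 *\<^sub>R 1 - star (- y) * (- y)"
      by (rule scaled_one_minus_star_mult[OF unital_cstar_subalgebra_UNIV UNIV_I t])
    define d where "d i j = (if i = j then ((if i = k then 1 else 0) + (if i = l then t\<^sup>2 else 0)) / 2 else 0)" for i j
    define b where "b r p = (if r = (0::nat) then (if p = k then 1 else 0) + (if p = l then - y else 0) else (if p = l then z else 0))" for r p
    have "((\<lambda>i j. d i j *\<^sub>R 1) - matrix_unit k l y) i j + star (((\<lambda>i j. d i j *\<^sub>R 1) - matrix_unit k l y) j i)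
      = gram 2 b i j" for i j
    proof -
      have "gram 2 b i j = star (b 0 i) * b 0 j + star (b 1 i) * b 1 j" by (simp add: gram_def numeral_2_eq_2)
      also have "star (b 1 i) * b 1 j = (if i = l \<and> j = l then t\<^sup>2 *\<^sub>R 1 - star y * y else 0)"
        using z by (simp add: b_def star_minus)
      finally have g: "gram 2 b i j = star (b 0 i) * b 0 j +
        (if i = l \<and> j = l then t\<^sup>2 *\<^sub>R 1 - star y * y else 0)" .
      have dd: "d i j *\<^sub>R 1 + d j i *\<^sub>R (1::'a) =
          (if i = j then (if i = k then 1 else 0) + (if i = l then t\<^sup>2 *\<^sub>R 1 else 0) else 0)"
        by (auto simp: d_def simp flip: scaleR_add_left) (simp_all add: scaleR_add_left add_divide_distrib)
      have "((\<lambda>i j. d i j *\<^sub>R 1) - matrix_unit k l y) i j + star (((\<lambda>i j. d i j *\<^sub>R 1) - matrix_unit k l y) j i)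
        = (d i j *\<^sub>R 1 + d j i *\<^sub>R 1) - matrix_unit k l y i j - star (matrix_unit k l y j i)"
        by (simp add: star_diff star_scaleR)
      then show ?thesis
        unfolding dd g by (auto simp: b_def matrix_unit_def star_diff star_add star_minus algebra_simps)
    qed
    then show ?thesis unfolding hpos_def by blast
  qed
  define D where "D k l = (SOME d :: nat \<Rightarrow> nat \<Rightarrow> real. (\<lambda>i j. d i j *\<^sub>R 1) - matrix_unit k l (x k l) \<in> hpos n)" for k l
  have D: "(\<lambda>i j. D k l i j *\<^sub>R 1) - matrix_unit k l (x k l) \<in> hpos n" for k l
    unfolding D_def by (rule someI_ex[OF 1])
  define d where "d i j = (\<Sum>k<n. \<Sum>l<n. D k l i j)" for i j
  have "(\<Sum>k<n. \<Sum>l<n. (\<lambda>i j. D k l i j *\<^sub>R 1) - matrix_unit k l (x k l)) \<in> hpos n"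
    by (intro hpos_sum D)
  moreover have "(\<Sum>k<n. \<Sum>l<n. (\<lambda>i j. D k l i j *\<^sub>R 1) - matrix_unit k l (x k l)) i j
      = ((\<lambda>i j. d i j *\<^sub>R 1) - x) i j" if "i < n" "j < n" for i j
    using sum_matrix_unit[OF that, of x] 
    by (simp add: sum_subtractf sum_fun_apply d_def scaleR_sum_left)
  ultimately have "(\<lambda>i j. d i j *\<^sub>R 1) - x \<in> hpos n" by (subst hpos_cong) auto
  then show ?thesis by blast
qed

text \<open>The map \<open>\<phi>\<close> corresponds to the functional \<open>[x\<^sub>i\<^sub>j] \<mapsto> \<Sum>i j. \<phi> (x\<^sub>i\<^sub>j) $$ (i, j)\<close>
  on \<open>M\<^sub>n(S)\<close>; its real part is extended, then complexified.\<close>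

theorem Arveson_extension:
  fixes S :: "'a::unital_cstar_algebra set"
  assumes S: "operator_system S" and \<phi>: "\<phi> \<in> UCP S n"
  obtains \<Phi> where "\<Phi> \<in> UCP UNIV n" "\<And>x. x \<in> S \<Longrightarrow> \<Phi> x = \<phi> x"
proof -
  note So = operator_systemD[OF S] and L = UCP_D(1)[OF \<phi>]
  note Li = linear_map_on_index[OF L S]
  define M where "M = {x :: nat \<Rightarrow> nat \<Rightarrow> 'a. \<forall>i<n. \<forall>j<n. x i j \<in> S}"
  define f where "f x = Re (\<Sum>i<n. \<Sum>j<n. \<phi> (x i j) $$ (i, j))" for x :: "nat \<Rightarrow> nat \<Rightarrow> 'a"
  have fpos: "0 \<le> f x" if xM: "x \<in> M" and xC: "x \<in> hpos n" for x
  proof -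
    obtain m b where g: "\<And>i j. i < n \<Longrightarrow> j < n \<Longrightarrow> x i j + star (x j i) = gram m b i j"
      using xC unfolding hpos_def by blast
    have "gram m b p q \<in> S" if "p < n" "q < n" for p q
      using g[OF that] xM that So by (auto simp: M_def simp flip: g)
    \<comment> \<open>The vector with \<open>e\<^sub>p\<close> in block \<open>p\<close> turns the
      form into the functional: it sums the entries \<open>(p, q)\<close> of the blocks
      \<open>(p, q)\<close>. Since the Gram matrix is \<open>x\<close> plus its adjoint, the result
      is \<open>2 * f x\<close>.\<close>
    then have "0 \<le> mform \<phi> n {..<n} (gram m b) (\<lambda>p i. if i = p then 1 else 0)"
      by (intro completely_positive_form_nonneg[OF S UCP_D(3)[OF \<phi>]]) auto
    also have "\<dots> = (\<Sum>p<n. \<Sum>q<n. cnj 1 * \<phi> (gram m b p q) $$ (p, q) * 1)"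
      by (rule mform_single) auto
    also have "\<dots> = (\<Sum>p<n. \<Sum>q<n. \<phi> (x p q) $$ (p, q) + cnj (\<phi> (x q p) $$ (q, p)))"
    proof (intro sum.cong refl)
      fix p q assume "p \<in> {..<n}" "q \<in> {..<n}"
      then have pq: "p < n" "q < n" by auto
      have x: "x p q \<in> S" "x q p \<in> S" using xM pq by (auto simp: M_def)
      then show "cnj 1 * \<phi> (gram m b p q) $$ (p, q) * 1 = \<phi> (x p q) $$ (p, q) + cnj (\<phi> (x q p) $$ (q, p))"
        using pq linear_map_onD(1)[OF L x(2)] UCP_star[OF S \<phi> x(2)] So(6)
        by (simp add: g[symmetric] Li)
    qed
    finally have "0 \<le> Re (\<Sum>p<n. \<Sum>q<n. \<phi> (x p q) $$ (p, q) + cnj (\<phi> (x q p) $$ (q, p)))"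
      by (simp add: less_eq_complex_def)
    also have "\<dots> = f x + (\<Sum>p<n. \<Sum>q<n. Re (\<phi> (x q p) $$ (q, p)))"
      by (simp add: f_def sum.distrib)
    also have "(\<Sum>p<n. \<Sum>q<n. Re (\<phi> (x q p) $$ (q, p))) = f x"
      by (subst sum.swap) (simp add: f_def)
    finally show ?thesis by simp
  qed
  obtain F where F: "linear F" and FM: "\<And>x. x \<in> M \<Longrightarrow> F x = f x" and FC: "\<And>x. x \<in> hpos n \<Longrightarrow> 0 \<le> F x"
  proof (rule positive_linear_extension[of M f "hpos n"])
    show "subspace M" by (auto simp: subspace_def M_def So scaleR_fun_def)
    show "f (x + y) = f x + f y" if "x \<in> M" "y \<in> M" for x y
      using that by (simp add: f_def M_def Li sum.distrib)
    show "f (t *\<^sub>R x) = t * f x" if "x \<in> M" for t x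
      using that by (simp add: f_def M_def Li scaleR_fun_def sum_distrib_left)
    show "\<exists>m\<in>M. m - x \<in> hpos n" for x
    proof -
      obtain d :: "nat \<Rightarrow> nat \<Rightarrow> real" where "(\<lambda>i j. d i j *\<^sub>R 1) - x \<in> hpos n"
        using hpos_cofinal by blast
      moreover have "(\<lambda>i j. d i j *\<^sub>R 1) \<in> M" using So(1,5) by (auto simp: M_def)
      ultimately show ?thesis by blast
    qed
  qed (auto simp: hpos_zero hpos_add hpos_scaleR fpos)
  define g where "g i j a = F (matrix_unit i j a)" for i j a
  have mu_add: "matrix_unit i j (a + b) = matrix_unit i j a + matrix_unit i j b" for i j and a b :: 'a
    by (auto simp: matrix_unit_def fun_eq_iff)
  have mu_sc: "matrix_unit i j (r *\<^sub>R a) = r *\<^sub>R matrix_unit i j a" for i j r and a :: 'a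
    by (auto simp: matrix_unit_def fun_eq_iff scaleR_fun_def)
  have g_add: "g i j (a + b) = g i j a + g i j b" for i j a b
    by (simp add: g_def mu_add linear_add[OF F])
  have g_sc: "g i j (r *\<^sub>R a) = r * g i j a" for i j r a
    by (simp add: g_def mu_sc linear_cmul[OF F])
  \<comment> \<open>The usual complexification of a real functional,
    \<open>g(a) - \<i> g(\<i> a)\<close>, in each entry.\<close>
  define \<Phi> where "\<Phi> a = mat n n (\<lambda>(i, j). Complex (g i j a) (- g i j (scaleC \<i> a)))" for a
  have sc_ri: "scaleC c a = Re c *\<^sub>R a + Im c *\<^sub>R scaleC \<i> a" for c and a :: 'a
  proof -
    have "c = of_real (Re c) + of_real (Im c) * \<i>" by (simp add: complex_eq_iff)
    then have "scaleC c a = scaleC (of_real (Re c) + of_real (Im c) * \<i>) a" by simp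
    then show ?thesis
      by (simp only: scaleC_add_left scaleC_scaleC[symmetric] scaleC_of_real)
  qed
  have L': "linear_map_on UNIV n \<Phi>"
    unfolding linear_map_on_def
  proof (intro conjI ballI allI)
    show "\<Phi> a \<in> carrier_mat n n" for a by (simp add: \<Phi>_def)
    show "\<Phi> (a + b) = \<Phi> a + \<Phi> b" for a b
      by (rule eq_matI) (auto simp: \<Phi>_def g_add scaleC_add_right complex_eq_iff)
    show "\<Phi> (scaleC c a) = c \<cdot>\<^sub>m \<Phi> a" for c a
    proof -
      have "g i j (scaleC c a) = Re c * g i j a + Im c * g i j (scaleC \<i> a)" for i j
        by (subst sc_ri) (simp only: g_add g_sc)
      moreover have "scaleC \<i> (scaleC c a) = Re c *\<^sub>R scaleC \<i> a + (- Im c) *\<^sub>R a"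
        using sc_ri[of "\<i> * c" a] by (simp add: scaleC_scaleC)
      then have "g i j (scaleC \<i> (scaleC c a)) = Re c * g i j (scaleC \<i> a) - Im c * g i j a" for i j
        by (simp only: g_add g_sc)
      ultimately show ?thesis by (intro eq_matI) (auto simp: \<Phi>_def complex_eq_iff)
    qed
  qed
  have ext: "\<Phi> s = \<phi> s" if s: "s \<in> S" for s
  proof (rule eq_matI)
    have c: "\<phi> s \<in> carrier_mat n n" using linear_map_onD(1)[OF L s] .
    then show "dim_row (\<Phi> s) = dim_row (\<phi> s)" "dim_col (\<Phi> s) = dim_col (\<phi> s)" by (auto simp: \<Phi>_def)
    fix i j assume "i < dim_row (\<phi> s)" "j < dim_col (\<phi> s)"
    then have ij: "i < n" "j < n" using c by auto
    have gs: "g i j t = Re (\<phi> t $$ (i, j))" if t: "t \<in> S" for t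
    proof -
      have "matrix_unit i j t \<in> M" using t So(2) by (auto simp: M_def matrix_unit_def)
      then have "g i j t = Re (\<Sum>k<n. \<Sum>l<n. \<phi> (matrix_unit i j t k l) $$ (k, l))"
        by (simp add: g_def FM f_def)
      also have "(\<Sum>k<n. \<Sum>l<n. \<phi> (matrix_unit i j t k l) $$ (k, l)) =
        (\<Sum>k<n. \<Sum>l<n. if k = i then (if l = j then \<phi> t $$ (k, l) else 0) else 0)"
        by (intro sum.cong refl) (auto simp: matrix_unit_def Li)
      also have "\<dots> = (\<Sum>k<n. if k = i then (\<Sum>l<n. if l = j then \<phi> t $$ (k, l) else 0) else 0)"
        by (intro sum.cong refl) simp
      also have "\<dots> = \<phi> t $$ (i, j)" using ij by simp
      finally show ?thesis .
    qed
    show "\<Phi> s $$ (i, j) = \<phi> s $$ (i, j)"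
      using ij s by (simp add: \<Phi>_def gs So Li complex_eq_iff)
  qed
  note LU = linear_map_on_index[OF L' unital_cstar_subalgebraD(1)[OF unital_cstar_subalgebra_UNIV]]
    linear_map_on_index_sum[OF L' unital_cstar_subalgebraD(1)[OF unital_cstar_subalgebra_UNIV]]
  have cp: "completely_positive UNIV n \<Phi>"
  proof (rule completely_positiveI[OF unital_cstar_subalgebraD(1)[OF unital_cstar_subalgebra_UNIV]])
    fix k m and v :: "nat \<Rightarrow> nat \<Rightarrow> complex" and b :: "nat \<Rightarrow> nat \<Rightarrow> 'a"
    \<comment> \<open>Absorbing \<open>v\<close> into the rows compresses the \<open>k\<close>
      columns to \<open>n\<close>. Positivity of \<open>\<Phi>\<close> at every order is thereby
      reduced to positivity of the one functional on matrices of size \<open>n\<close>.\<close>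
    define c where "c l i = (\<Sum>p<k. scaleC (v p i) (b l p))" for l i
    define X where "X = gram m c"
    have Xe: "X i j = (\<Sum>p<k. \<Sum>q<k. scaleC (cnj (v p i) * v q j) (gram m b p q))" for i j
    proof -
      have "X i j = (\<Sum>l<m. \<Sum>p<k. \<Sum>q<k. scaleC (cnj (v p i) * v q j) (star (b l p) * b l q))"
        by (simp add: X_def gram_def c_def star_sum star_scaleC sum_product scaleC_mult_left
            scaleC_mult_right scaleC_scaleC mult.commute[of "v _ j"])
      also have "\<dots> = (\<Sum>p<k. \<Sum>l<m. \<Sum>q<k. scaleC (cnj (v p i) * v q j) (star (b l p) * b l q))"
        by (rule sum.swap)
      also have "\<dots> = (\<Sum>p<k. \<Sum>q<k. \<Sum>l<m. scaleC (cnj (v p i) * v q j) (star (b l p) * b l q))"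
        by (intro sum.cong refl sum.swap)
      finally show ?thesis by (simp add: gram_def scaleC_sum_right)
    qed
    have "mform \<Phi> n {..<k} (gram m b) v =
        (\<Sum>p<k. \<Sum>q<k. \<Sum>i<n. \<Sum>j<n. \<Phi> (scaleC (cnj (v p i) * v q j) (gram m b p q)) $$ (i, j))"
      unfolding mform_def by (intro sum.cong refl) (simp add: LU)
    also have "\<dots> = (\<Sum>i<n. \<Sum>j<n. \<Sum>p<k. \<Sum>q<k. \<Phi> (scaleC (cnj (v p i) * v q j) (gram m b p q)) $$ (i, j))"
      by (simp only: sum.swap[where A = "{..<k}" and B = "{..<n}"])
    also have "\<dots> = (\<Sum>i<n. \<Sum>j<n. \<Phi> (X i j) $$ (i, j))"
      by (intro sum.cong refl) (simp add: Xe LU)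
    also have "\<dots> = (\<Sum>i<n. \<Sum>j<n. Complex (g i j (X i j)) (- g i j (scaleC \<i> (X i j))))"
      by (intro sum.cong refl) (simp add: \<Phi>_def)
    finally have eq: "mform \<Phi> n {..<k} (gram m b) v = \<dots>" .
    have sumF: "(\<Sum>i<n. \<Sum>j<n. g i j (Y i j)) = F (\<Sum>i<n. \<Sum>j<n. matrix_unit i j (Y i j))" for Y
      by (simp add: g_def linear_sum[OF F])
    have hY: "(\<Sum>i<n. \<Sum>j<n. matrix_unit i j (Y i j)) \<in> hpos n \<longleftrightarrow> Y \<in> hpos n" for Y :: "nat \<Rightarrow> nat \<Rightarrow> 'a"
      by (rule hpos_cong) (rule sum_matrix_unit)
    have "X i j + star (X j i) = gram m (\<lambda>l p. sqrt 2 *\<^sub>R c l p) i j" for i j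
      using gram_scaleR[of 2 m c i j] by (simp add: X_def star_gram scaleR_2)
    then have "X \<in> hpos n" unfolding hpos_def by blast
    then have "0 \<le> (\<Sum>i<n. \<Sum>j<n. g i j (X i j))" unfolding sumF by (intro FC) (simp add: hY)
    then have re: "0 \<le> Re (mform \<Phi> n {..<k} (gram m b) v)" unfolding eq by simp
    \<comment> \<open>\<open>X\<close> equals its adjoint matrix, so \<open>\<i> X\<close> is
      skew-adjoint: it and its negative have Hermitian part 0, which is the Gram matrix with no
      rows. Both lie in the cone, so the functional vanishes there, and this value is the imaginary
      part of the form up to sign.\<close>
    define Y where "Y i j = scaleC \<i> (X i j)" for i j
    define Z where "Z i j = - Y i j" for i j
    have "Y i j + star (Y j i) = gram 0 c i j" "Z i j + star (Z j i) = gram 0 c i j" for i j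
      unfolding Y_def Z_def X_def star_minus star_scaleC star_gram
      by (simp_all add: scaleC_minus_right scaleC_minus_left)
    then have "Y \<in> hpos n" "Z \<in> hpos n" unfolding hpos_def by blast+
    then have "0 \<le> (\<Sum>i<n. \<Sum>j<n. g i j (Y i j))" "0 \<le> (\<Sum>i<n. \<Sum>j<n. g i j (Z i j))"
      unfolding sumF by (intro FC; simp add: hY)+
    moreover have "g i j (Z i j) = - g i j (Y i j)" for i j
      using g_sc[of i j "-1" "Y i j"] by (simp add: Z_def)
    ultimately have "(\<Sum>i<n. \<Sum>j<n. g i j (Y i j)) = 0" by (simp add: sum_negf)
    then have "Im (mform \<Phi> n {..<k} (gram m b) v) = 0" unfolding eq by (simp add: Y_def sum_negf)
    with re show "0 \<le> mform \<Phi> n {..<k} (gram m b) v" by (simp add: less_eq_complex_def)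
  qed
  have "\<Phi> 1 = 1\<^sub>m n" using ext[OF So(1)] UCP_D(2)[OF \<phi>] by simp
  then have "\<Phi> \<in> UCP UNIV n" using L' cp by (simp add: UCP_def)
  then show thesis using ext that by blast
qed

section \<open>The Schwarz inequality and multiplicative domains\<close>

lemma index_adjoint_mult:
  assumes "A \<in> carrier_mat n k" "B \<in> carrier_mat n m" "i < k" "j < m"
  shows "(mat_adjoint A * B) $$ (i, j) = (\<Sum>l<n. cnj (A $$ (l, i)) * B $$ (l, j))"
  using assms by (auto simp: scalar_prod_def lessThan_atLeast0 intro!: sum.cong)

lemma index_mult:
  assumes "A \<in> carrier_mat k n" "B \<in> carrier_mat n m" "i < k" "j < m"
  shows "(A * B) $$ (i, j) = (\<Sum>l<n. A $$ (i, l) * B $$ (l, j))"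
  using assms by (auto simp: scalar_prod_def lessThan_atLeast0 intro!: sum.cong)

text \<open>Complete positivity on the column \<open>(1, x\<^sub>1, x\<^sub>2, \<dots>)\<close>, with the vector chosen so that
  the first coordinate completes the square.\<close>

lemma UCP_Schwarz_form:
  fixes x :: "'i \<Rightarrow> 'a::unital_cstar_algebra"
  assumes B: "unital_cstar_subalgebra B" and \<Phi>: "\<Phi> \<in> UCP B n" and I: "finite I"
    and x: "\<And>p. p \<in> I \<Longrightarrow> x p \<in> B"
  shows "0 \<le> (\<Sum>p\<in>I. \<Sum>q\<in>I. \<Sum>i<n. \<Sum>j<n. cnj (v p i) *
    (\<Phi> (star (x p) * x q) $$ (i, j) - (mat_adjoint (\<Phi> (x p)) * \<Phi> (x q)) $$ (i, j)) * v q j)"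
proof -
  note Bs = unital_cstar_subalgebraD(1)[OF B] and Bm = unital_cstar_subalgebraD(2)[OF B]
  note Bo = operator_systemD[OF Bs]
  note L = UCP_D(1)[OF \<Phi>]
  have car: "\<Phi> (x p) \<in> carrier_mat n n" if "p \<in> I" for p using linear_map_onD(1)[OF L] x that by blast
  define T where "T i = (\<Sum>q\<in>I. \<Sum>j<n. \<Phi> (x q) $$ (i, j) * v q j)" for i
  define y where "y = case_option 1 x"
  define w where "w = case_option (\<lambda>i. - T i) v"
  define J where "J = insert None (Some ` I)"
  have J_sum: "(\<Sum>p\<in>J. h p) = h None + (\<Sum>p\<in>I. h (Some p))" for h :: "'i option \<Rightarrow> complex"
    using I by (simp add: J_def sum.reindex)
  have "0 \<le> mform \<Phi> n J (gram 1 (\<lambda>_. y)) w"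
  proof (rule completely_positive_form_nonneg[OF Bs UCP_D(3)[OF \<Phi>]])
    show "finite J" using I by (simp add: J_def)
    have "y p \<in> B" if "p \<in> J" for p using that x Bo(1) by (auto simp: J_def y_def)
    then show "gram 1 (\<lambda>_. y) p q \<in> B" if "p \<in> J" "q \<in> J" for p q
      using that Bm Bo(6) by (simp add: gram_def)
  qed
  \<comment> \<open>Splitting off the index \<open>None\<close> leaves four groups. The first three
    all equal the squared norm of \<open>T\<close> and carry the signs plus, minus, minus, so
    together they contribute that norm once with a minus sign.\<close>
  also have "\<dots> = (\<Sum>i<n. \<Sum>j<n. cnj (T i) * (if i = j then 1 else 0) * T j)
      - (\<Sum>q\<in>I. \<Sum>i<n. \<Sum>j<n. cnj (T i) * \<Phi> (x q) $$ (i, j) * v q j)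
      - (\<Sum>p\<in>I. \<Sum>i<n. \<Sum>j<n. cnj (v p i) * cnj (\<Phi> (x p) $$ (j, i)) * T j)
      + (\<Sum>p\<in>I. \<Sum>q\<in>I. \<Sum>i<n. \<Sum>j<n. cnj (v p i) * \<Phi> (star (x p) * x q) $$ (i, j) * v q j)"
  proof -
    have "\<Phi> (star (x p)) $$ (i, j) = cnj (\<Phi> (x p) $$ (j, i))" if "p \<in> I" "i < n" "j < n" for p i j
      using UCP_star[OF Bs \<Phi> x[OF that(1)]] car[OF that(1)] that by simp
    then show ?thesis
      unfolding mform_def J_sum
      by (simp add: y_def w_def gram_def UCP_D(2)[OF \<Phi>] sum.distrib sum_negf sum_subtractf)
  qed
  also have "(\<Sum>i<n. \<Sum>j<n. cnj (T i) * (if i = j then 1 else 0) * T j) = (\<Sum>l<n. cnj (T l) * T l)"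
  proof (intro sum.cong refl)
    fix l assume "l \<in> {..<n}"
    then show "(\<Sum>j<n. cnj (T l) * (if l = j then 1 else 0) * T j) = cnj (T l) * T l"
      by (subst sum.remove[of _ l]) auto
  qed
  also have "(\<Sum>q\<in>I. \<Sum>i<n. \<Sum>j<n. cnj (T i) * \<Phi> (x q) $$ (i, j) * v q j) = (\<Sum>l<n. cnj (T l) * T l)"
    by (subst sum.swap) (simp add: T_def[of "_::nat"] sum_distrib_left mult.assoc)
  also have "(\<Sum>p\<in>I. \<Sum>i<n. \<Sum>j<n. cnj (v p i) * cnj (\<Phi> (x p) $$ (j, i)) * T j) = (\<Sum>l<n. cnj (T l) * T l)"
  proof -
    have "(\<Sum>p\<in>I. \<Sum>i<n. \<Sum>j<n. cnj (v p i) * cnj (\<Phi> (x p) $$ (j, i)) * T j) =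
      (\<Sum>j<n. \<Sum>p\<in>I. \<Sum>i<n. cnj (v p i) * cnj (\<Phi> (x p) $$ (j, i)) * T j)"
      by (subst sum.swap[where B = "{..<n}" and A = "{..<n}"], rule sum.swap)
    also have "\<dots> = (\<Sum>l<n. cnj (T l) * T l)"
    proof (intro sum.cong refl)
      fix l
      have "cnj (T l) = (\<Sum>p\<in>I. \<Sum>i<n. cnj (v p i) * cnj (\<Phi> (x p) $$ (l, i)))"
        by (simp add: T_def mult.commute)
      then show "(\<Sum>p\<in>I. \<Sum>i<n. cnj (v p i) * cnj (\<Phi> (x p) $$ (l, i)) * T l) = cnj (T l) * T l"
        by (simp only: sum_distrib_right)
    qed
    finally show ?thesis .
  qed
  also have "(\<Sum>l<n. cnj (T l) * T l) = (\<Sum>p\<in>I. \<Sum>q\<in>I. \<Sum>i<n. \<Sum>j<n. cnj (v p i) *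
      (mat_adjoint (\<Phi> (x p)) * \<Phi> (x q)) $$ (i, j) * v q j)"
  proof -
    have "(\<Sum>l<n. cnj (T l) * T l) = (\<Sum>l<n. \<Sum>p\<in>I. \<Sum>q\<in>I. \<Sum>i<n. \<Sum>j<n.
        cnj (v p i) * (cnj (\<Phi> (x p) $$ (l, i)) * \<Phi> (x q) $$ (l, j)) * v q j)"
    proof (intro sum.cong refl)
      fix l
      have "cnj (T l) * T l = (\<Sum>p\<in>I. \<Sum>q\<in>I. (\<Sum>i<n. cnj (\<Phi> (x p) $$ (l, i)) * cnj (v p i)) *
          (\<Sum>j<n. \<Phi> (x q) $$ (l, j) * v q j))"
        unfolding T_def by (simp add: sum_product)
      also have "\<dots> = (\<Sum>p\<in>I. \<Sum>q\<in>I. \<Sum>i<n. \<Sum>j<n.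
          cnj (v p i) * (cnj (\<Phi> (x p) $$ (l, i)) * \<Phi> (x q) $$ (l, j)) * v q j)"
        by (simp only: sum_product) (intro sum.cong refl, simp add: mult_ac)
      finally show "cnj (T l) * T l = \<dots>" .
    qed
    also have "\<dots> = (\<Sum>p\<in>I. \<Sum>q\<in>I. \<Sum>i<n. \<Sum>j<n. \<Sum>l<n.
        cnj (v p i) * (cnj (\<Phi> (x p) $$ (l, i)) * \<Phi> (x q) $$ (l, j)) * v q j)"
      by (subst sum.swap, rule sum.cong[OF refl])+ rule
    also have "\<dots> = (\<Sum>p\<in>I. \<Sum>q\<in>I. \<Sum>i<n. \<Sum>j<n. cnj (v p i) *
        (mat_adjoint (\<Phi> (x p)) * \<Phi> (x q)) $$ (i, j) * v q j)"
      by (intro sum.cong refl) (simp add: index_adjoint_mult[OF car car] sum_distrib_left sum_distrib_right)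
    finally show ?thesis .
  qed
  finally show ?thesis
    by (simp add: right_diff_distrib left_diff_distrib sum_subtractf)
qed

text \<open>Common ground of UCP maps and star representations: the diagonal Schwarz inequality is
  enough for continuity, and representations satisfy it by direct computation, with no detour
  through complete positivity.\<close>

definition schwarz_map :: "'a::unital_cstar_algebra set \<Rightarrow> nat \<Rightarrow> ('a \<Rightarrow> complex mat) \<Rightarrow> bool" where
  "schwarz_map B n \<Phi> \<longleftrightarrow> linear_map_on B n \<Phi> \<and> \<Phi> 1 = 1\<^sub>m n \<and>
     (\<forall>a\<in>B. \<forall>j<n. (\<Sum>l<n. (cmod (\<Phi> a $$ (l, j)))\<^sup>2) \<le> Re (\<Phi> (star a * a) $$ (j, j)))"

lemma UCP_schwarz_map:
  assumes B: "unital_cstar_subalgebra B" and \<Phi>: "\<Phi> \<in> UCP B n"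
  shows "schwarz_map B n \<Phi>"
  unfolding schwarz_map_def
proof (intro conjI ballI allI impI UCP_D[OF \<Phi>])
  fix a j assume a: "a \<in> B" and j: "j < n"
  have car: "\<Phi> a \<in> carrier_mat n n" using linear_map_onD(1)[OF UCP_D(1)[OF \<Phi>] a] .
  define e :: "nat \<Rightarrow> complex" where "e i = (if i = j then 1 else 0)" for i
  define D where "D i k = \<Phi> (star a * a) $$ (i, k) - (mat_adjoint (\<Phi> a) * \<Phi> a) $$ (i, k)" for i k
  have "0 \<le> (\<Sum>i<n. \<Sum>k<n. cnj (e i) * D i k * e k)"
    using UCP_Schwarz_form[OF B \<Phi>, of "{()}" "\<lambda>_. a" "\<lambda>_. e"] a by (simp add: D_def)
  also have "\<dots> = (\<Sum>i<n. (\<Sum>k<n. D i k * (if k = j then 1 else 0)) * (if i = j then 1 else 0))"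
    by (intro sum.cong refl) (simp add: e_def)
  also have "\<dots> = D j j" using j by (simp only: sum_mult_delta finite_lessThan lessThan_iff mult_1_right)
  also have "\<dots> = \<Phi> (star a * a) $$ (j, j) - (\<Sum>l<n. cnj (\<Phi> a $$ (l, j)) * \<Phi> a $$ (l, j))"
    unfolding D_def by (simp add: index_adjoint_mult[OF car car j j])
  also have "(\<Sum>l<n. cnj (\<Phi> a $$ (l, j)) * \<Phi> a $$ (l, j)) = of_real (\<Sum>l<n. (cmod (\<Phi> a $$ (l, j)))\<^sup>2)"
    unfolding of_real_sum by (intro sum.cong refl) (metis complex_norm_square mult.commute)
  finally show "(\<Sum>l<n. (cmod (\<Phi> a $$ (l, j)))\<^sup>2) \<le> Re (\<Phi> (star a * a) $$ (j, j))"
    by (simp add: less_eq_complex_def)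
qed

lemma star_representation_schwarz_map:
  assumes B: "unital_cstar_subalgebra B" and \<pi>: "star_representation B n \<pi>"
  shows "schwarz_map B n \<pi>"
  unfolding schwarz_map_def
proof (intro conjI ballI allI impI)
  show L: "linear_map_on B n \<pi>" and "\<pi> 1 = 1\<^sub>m n" using \<pi> by (auto simp: star_representation_def)
  fix a j assume a: "a \<in> B" and j: "j < n"
  have car: "\<pi> a \<in> carrier_mat n n" using linear_map_onD(1)[OF L a] .
  have "\<pi> (star a * a) = mat_adjoint (\<pi> a) * \<pi> a"
    using \<pi> a operator_systemD(6)[OF unital_cstar_subalgebraD(1)[OF B] a]
    by (simp add: star_representation_def)
  then have "Re (\<pi> (star a * a) $$ (j, j)) = (\<Sum>l<n. Re (cnj (\<pi> a $$ (l, j)) * \<pi> a $$ (l, j)))"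
    by (simp add: index_adjoint_mult[OF car car j j])
  also have "\<dots> = (\<Sum>l<n. (cmod (\<pi> a $$ (l, j)))\<^sup>2)"
    by (intro sum.cong refl) (metis Re_complex_of_real complex_norm_square mult.commute)
  finally show "(\<Sum>l<n. (cmod (\<pi> a $$ (l, j)))\<^sup>2) \<le> Re (\<pi> (star a * a) $$ (j, j))" by simp
qed

text \<open>Applied to \<open>z\<close> with \<open>star z * z = t\<^sup>2 - star a * a\<close>, the
  inequality bounds the diagonal of \<open>\<Phi> (star a * a)\<close> by \<open>t\<^sup>2\<close>;
  applied to \<open>a\<close>, it bounds the entries in column \<open>j\<close>. Then
  \<open>t\<close> tends to \<open>norm a\<close>. Entrywise contractivity is all the continuity
  required, since limits of matrices are taken entrywise.\<close>

lemma schwarz_map_bound: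
  assumes B: "unital_cstar_subalgebra B" and \<Phi>: "schwarz_map B n \<Phi>"
    and a: "a \<in> B" and ij: "i < n" "j < n"
  shows "cmod (\<Phi> a $$ (i, j)) \<le> norm a"
proof (rule dense_ge)
  note Bs = unital_cstar_subalgebraD(1)[OF B] and Bm = unital_cstar_subalgebraD(2)[OF B]
  note Bo = operator_systemD[OF Bs]
  have L: "linear_map_on B n \<Phi>" and one: "\<Phi> 1 = 1\<^sub>m n"
    and sch: "\<And>a j. a \<in> B \<Longrightarrow> j < n \<Longrightarrow> (\<Sum>l<n. (cmod (\<Phi> a $$ (l, j)))\<^sup>2) \<le> Re (\<Phi> (star a * a) $$ (j, j))"
    using \<Phi> unfolding schwarz_map_def by auto
  fix t assume t: "norm a < t"
  then have t0: "0 \<le> t" using norm_ge_zero[of a] by linarith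
  obtain z where z: "z \<in> B" "star z * z = t\<^sup>2 *\<^sub>R 1 - star a * a"
    using scaled_one_minus_star_mult[OF B a t] .
  have "0 \<le> Re (\<Phi> (star z * z) $$ (j, j))"
    by (rule order_trans[OF _ sch[OF z(1) ij(2)]]) (simp add: sum_nonneg)
  also have "\<Phi> (star z * z) $$ (j, j) = of_real (t\<^sup>2) - \<Phi> (star a * a) $$ (j, j)"
  proof -
    have "\<Phi> (star z * z) $$ (j, j) = t\<^sup>2 *\<^sub>R \<Phi> 1 $$ (j, j) - \<Phi> (star a * a) $$ (j, j)"
      using Bo(1,5,6) Bm a
      by (simp only: z(2) linear_map_on_index(6)[OF L Bs ij(2) ij(2)] linear_map_on_index(3)[OF L Bs ij(2) ij(2)])
    then show ?thesis using ij by (simp add: one scaleR_conv_of_real)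
  qed
  finally have "Re (\<Phi> (star a * a) $$ (j, j)) \<le> t\<^sup>2" by simp
  moreover have "(cmod (\<Phi> a $$ (i, j)))\<^sup>2 \<le> (\<Sum>l<n. (cmod (\<Phi> a $$ (l, j)))\<^sup>2)"
    by (rule member_le_sum) (use ij in auto)
  ultimately have "(cmod (\<Phi> a $$ (i, j)))\<^sup>2 \<le> t\<^sup>2" using sch[OF a ij(2)] by linarith
  then show "cmod (\<Phi> a $$ (i, j)) \<le> t" using t0 by (rule power2_le_imp_le)
qed

lemma schwarz_map_tendsto:
  assumes B: "unital_cstar_subalgebra B" and \<Phi>: "schwarz_map B n \<Phi>"
    and a: "\<And>k. a k \<in> B" "a \<longlonglongrightarrow> l" "l \<in> B" and ij: "i < n" "j < n"
  shows "(\<lambda>k. \<Phi> (a k) $$ (i, j)) \<longlonglongrightarrow> \<Phi> l $$ (i, j)"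
proof -
  note Bs = unital_cstar_subalgebraD(1)[OF B]
  have L: "linear_map_on B n \<Phi>" using \<Phi> unfolding schwarz_map_def by auto
  have "(\<lambda>k. \<Phi> (a k) $$ (i, j) - \<Phi> l $$ (i, j)) \<longlonglongrightarrow> 0"
  proof (rule tendsto_0_le[where K = 1])
    have "norm (\<Phi> (a k) $$ (i, j) - \<Phi> l $$ (i, j)) \<le> norm (a k - l) * 1" for k
      using schwarz_map_bound[OF B \<Phi> operator_systemD(8)[OF Bs a(1)[of k] a(3)] ij]
      by (simp add: linear_map_on_index(6)[OF L Bs ij a(1) a(3)])
    then show "\<forall>\<^sub>F k in sequentially. norm (\<Phi> (a k) $$ (i, j) - \<Phi> l $$ (i, j)) \<le> norm (a k - l) * 1"
      by simp
    show "(\<lambda>k. a k - l) \<longlonglongrightarrow> 0" using a(2) by (rule LIM_zero)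
  qed
  then show ?thesis by (rule LIM_zero_cancel)
qed

text \<open>The agreement set is a unital star subalgebra containing \<open>S\<close>; it is closed
  because both maps are automatically continuous.\<close>

lemma star_representations_eq_on_generated:
  assumes \<pi>: "star_representation (generated_cstar S) n \<pi>"
    and \<rho>: "star_representation (generated_cstar S) n \<rho>"
    and eq: "\<And>x. x \<in> S \<Longrightarrow> \<pi> x = \<rho> x" and a: "a \<in> generated_cstar S"
  shows "\<pi> a = \<rho> a"
proof -
  define B where "B = generated_cstar S"
  have B: "unital_cstar_subalgebra B" unfolding B_def by (rule unital_cstar_subalgebra_generated)
  note Bs = unital_cstar_subalgebraD(1)[OF B] and Bm = unital_cstar_subalgebraD(2)[OF B]
  note Bo = operator_systemD[OF Bs]
  note \<pi>' = \<pi>[folded B_def] and \<rho>' = \<rho>[folded B_def]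
  note D = \<pi>'[unfolded star_representation_def linear_map_on_def] \<rho>'[unfolded star_representation_def linear_map_on_def]
  define T where "T = {a \<in> B. \<pi> a = \<rho> a}"
  have "closed T"
    unfolding closed_sequential_limits
  proof (intro allI impI)
    fix f l assume *: "(\<forall>k. f k \<in> T) \<and> f \<longlonglongrightarrow> l"
    then have fB: "f k \<in> B" and fe: "\<pi> (f k) = \<rho> (f k)" for k by (auto simp: T_def)
    have lB: "l \<in> B" using unital_cstar_subalgebraD(3)[OF B] fB * closed_sequentially by blast
    have "\<pi> l $$ (i, j) = \<rho> l $$ (i, j)" if "i < n" "j < n" for i j
    proof (rule LIMSEQ_unique)
      show "(\<lambda>k. \<pi> (f k) $$ (i, j)) \<longlonglongrightarrow> \<pi> l $$ (i, j)"
        by (rule schwarz_map_tendsto[OF B star_representation_schwarz_map[OF B \<pi>'] fB _ lB that]) (use * in auto)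
      show "(\<lambda>k. \<pi> (f k) $$ (i, j)) \<longlonglongrightarrow> \<rho> l $$ (i, j)"
        unfolding fe
        by (rule schwarz_map_tendsto[OF B star_representation_schwarz_map[OF B \<rho>'] fB _ lB that]) (use * in auto)
    qed
    moreover have "\<pi> l \<in> carrier_mat n n" "\<rho> l \<in> carrier_mat n n" using D lB by auto
    ultimately have "\<pi> l = \<rho> l" by (intro eq_matI) auto
    then show "l \<in> T" using lB by (simp add: T_def)
  qed
  then have "unital_cstar_subalgebra T"
    using D Bo Bm by (auto simp: unital_cstar_subalgebra_def operator_system_def T_def)
  moreover have "S \<subseteq> T" using eq subset_generated_cstar unfolding T_def B_def by blast
  ultimately have "B \<subseteq> T" unfolding B_def by (intro generated_cstar_minimal)
  then show ?thesis using a unfolding B_def T_def by blast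
qed

text \<open>Choi's multiplicative domain argument. The Schwarz defects of the pair
  \<open>star b\<close>, \<open>a\<close> form a positive matrix; a zero on its diagonal forces the
  whole row and column to vanish, and the off-diagonal block is
  \<open>\<Phi> (b * a) - \<Phi> b * \<Phi> a\<close>.\<close>

lemma UCP_multiplicative_right:
  assumes B: "unital_cstar_subalgebra B" and \<Phi>: "\<Phi> \<in> UCP B n"
    and a: "a \<in> B" and eq: "\<And>j. j < n \<Longrightarrow> \<Phi> (star a * a) $$ (j, j) = (mat_adjoint (\<Phi> a) * \<Phi> a) $$ (j, j)"
    and b: "b \<in> B"
  shows "\<Phi> (b * a) = \<Phi> b * \<Phi> a"
proof -
  note Bs = unital_cstar_subalgebraD(1)[OF B] and Bm = unital_cstar_subalgebraD(2)[OF B]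
  note Bo = operator_systemD[OF Bs]
  note L = UCP_D(1)[OF \<Phi>]
  have car: "\<Phi> c \<in> carrier_mat n n" if "c \<in> B" for c using linear_map_onD(1)[OF L that] .
  have adj: "mat_adjoint (\<Phi> (star b)) = \<Phi> b"
    using UCP_star[OF Bs \<Phi> Bo(6)[OF b]] by (simp add: star_star)
  define x where "x p = (if p then star b else a)" for p
  define D where "D p q = \<Phi> (star (x p) * x q) - mat_adjoint (\<Phi> (x p)) * \<Phi> (x q)" for p q
  have xB: "x p \<in> B" for p using a b Bo by (simp add: x_def)
  have "\<Phi> (b * a) $$ (i, j) = (\<Phi> b * \<Phi> a) $$ (i, j)" if ij: "i < n" "j < n" for i j
  proof -
    define r where "r = (\<lambda>p. if p then i else j)"
    define z where "z = D True False $$ (i, j)"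
    define z' where "z' = D False True $$ (j, i)"
    define d where "d = D True True $$ (i, i)"
    have pos: "0 \<le> cnj u * d * u + cnj u * z + z' * u" for u
    proof -
      define v where "v = (\<lambda>p i. if i = r p then (if p then u else 1) else 0)"
      have "0 \<le> (\<Sum>p\<in>UNIV. \<Sum>q\<in>UNIV. \<Sum>i<n. \<Sum>j<n. cnj (v p i) *
        (\<Phi> (star (x p) * x q) $$ (i, j) - (mat_adjoint (\<Phi> (x p)) * \<Phi> (x q)) $$ (i, j)) * v q j)"
        by (rule UCP_Schwarz_form[OF B \<Phi> _ xB]) simp
      also have "\<dots> = mform id n UNIV D v"
        unfolding mform_def by (intro sum.cong refl) (use car xB in \<open>simp add: D_def carrier_matD[OF car[OF xB]]\<close>)
      also have "\<dots> = (\<Sum>p\<in>UNIV. \<Sum>q\<in>UNIV. cnj (if p then u else 1) * id (D p q) $$ (r p, r q) * (if q then u else 1))"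
        unfolding v_def by (rule mform_single) (use ij in \<open>simp add: r_def\<close>)
      also have "\<dots> = D False False $$ (j, j) + z' * u + (cnj u * z + cnj u * d * u)"
        by (simp add: UNIV_bool r_def z_def z'_def d_def)
      also have "D False False $$ (j, j) = 0"
        using eq[OF ij(2)] ij car[OF a] car[OF Bm[OF Bo(6)[OF a] a]] by (simp add: D_def x_def del: index_mult_mat(1))
      finally show ?thesis by (simp add: algebra_simps)
    qed
    have "Im d = 0" using pos[of 1] pos[of "-1"] by (simp add: less_eq_complex_def)
    then have "z' = cnj z" using pos[of 1] pos[of \<i>] by (auto simp: less_eq_complex_def complex_eq_iff)
    \<comment> \<open>The test vector \<open>- t z\<close> gives \<open>t * (t * d - 2)\<close>
      times the squared modulus of \<open>z\<close>. With \<open>t * d \<le> 1\<close> the factor is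
      negative, so nonnegativity leaves only \<open>z = 0\<close>.\<close>
    define t where "t = 1 / (\<bar>Re d\<bar> + 1)"
    have t: "0 < t" "t * Re d \<le> 1" by (auto simp: t_def field_simps)
    have "0 \<le> Re (cnj (- (of_real t * z)) * d * (- (of_real t * z)) + cnj (- (of_real t * z)) * z + z' * (- (of_real t * z)))"
      using pos[of "- (of_real t * z)"] by (simp add: less_eq_complex_def)
    also have "\<dots> = t * ((Re z)\<^sup>2 + (Im z)\<^sup>2) * (t * Re d - 2)"
      using \<open>Im d = 0\<close> by (simp add: \<open>z' = cnj z\<close> power2_eq_square algebra_simps)
    finally have "0 \<le> t * ((Re z)\<^sup>2 + (Im z)\<^sup>2) * (t * Re d - 2)" .
    then have "(Re z)\<^sup>2 + (Im z)\<^sup>2 \<le> 0" using t by (smt (verit) mult_pos_neg mult_pos_pos)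
    then have "z = 0" by (simp add: complex_eq_iff sum_power2_le_zero_iff)
    then show ?thesis
      using car[OF Bm[OF b a]] car[OF a] car[OF b] ij adj by (simp add: z_def D_def x_def star_star)
  qed
  then show ?thesis using car[OF Bm[OF b a]] car[OF a] car[OF b] by (intro eq_matI) auto
qed

text \<open>The elements that can be split off on the right form a closed unital subalgebra
  \<open>R\<close>, which need not be invariant under \<open>star\<close>. Its self-adjoint part
  \<open>T\<close> is a C*-subalgebra, and it contains \<open>S\<close> because the hypothesis is
  available for both \<open>s\<close> and \<open>star s\<close>.\<close>

lemma UCP_multiplicative_on_generated:
  assumes S: "operator_system S" and \<Phi>: "\<Phi> \<in> UCP (generated_cstar S) n"
    and eq: "\<And>a j. a \<in> S \<Longrightarrow> j < n \<Longrightarrow> \<Phi> (star a * a) $$ (j, j) = (mat_adjoint (\<Phi> a) * \<Phi> a) $$ (j, j)"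
    and ab: "a \<in> generated_cstar S" "b \<in> generated_cstar S"
  shows "\<Phi> (a * b) = \<Phi> a * \<Phi> b"
proof -
  define B where "B = generated_cstar S"
  have B: "unital_cstar_subalgebra B" unfolding B_def by (rule unital_cstar_subalgebra_generated)
  note Bs = unital_cstar_subalgebraD(1)[OF B] and Bm = unital_cstar_subalgebraD(2)[OF B]
  note Bo = operator_systemD[OF Bs]
  note \<Phi>B = \<Phi>[folded B_def]
  note L = UCP_D(1)[OF \<Phi>B]
  have car: "\<Phi> c \<in> carrier_mat n n" if "c \<in> B" for c using linear_map_onD(1)[OF L that] .
  define R where "R = {a \<in> B. \<forall>b\<in>B. \<Phi> (b * a) = \<Phi> b * \<Phi> a}"
  have R: "a \<in> R \<longleftrightarrow> a \<in> B \<and> (\<forall>b\<in>B. \<Phi> (b * a) = \<Phi> b * \<Phi> a)" for a by (simp add: R_def)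
  have R1: "1 \<in> R" using Bo(1) car by (auto simp: R UCP_D(2)[OF \<Phi>B] right_mult_one_mat[OF car])
  have Radd: "x + y \<in> R" if "x \<in> R" "y \<in> R" for x y
    using that Bo Bm
    by (auto simp: R distrib_left linear_map_onD(2)[OF L] mult_add_distrib_mat[OF car car car])
  have Rsc: "scaleC c x \<in> R" if "x \<in> R" for x c
    using that Bo Bm
    by (auto simp: R scaleC_mult_right linear_map_onD(3)[OF L] mult_smult_distrib[OF car car])
  have Rmult: "x * y \<in> R" if xy: "x \<in> R" "y \<in> R" for x y
  proof -
    have B': "x \<in> B" "y \<in> B" using xy by (auto simp: R)
    have "\<Phi> (c * (x * y)) = \<Phi> c * \<Phi> (x * y)" if c: "c \<in> B" for c
    proof -
      have "\<Phi> (c * (x * y)) = \<Phi> (c * x) * \<Phi> y" using xy c Bm B' by (simp add: R flip: mult.assoc)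
      also have "\<dots> = \<Phi> c * \<Phi> x * \<Phi> y" using xy c by (simp add: R)
      also have "\<dots> = \<Phi> c * (\<Phi> x * \<Phi> y)" by (rule assoc_mult_mat[OF car car car]) (use c B' in auto)
      also have "\<Phi> x * \<Phi> y = \<Phi> (x * y)" using xy B' by (simp add: R)
      finally show ?thesis .
    qed
    then show ?thesis using Bm B' by (simp add: R)
  qed
  have "closed R"
    unfolding closed_sequential_limits
  proof (intro allI impI)
    fix f l assume *: "(\<forall>k. f k \<in> R) \<and> f \<longlonglongrightarrow> l"
    then have fB: "f k \<in> B" and fe: "b \<in> B \<Longrightarrow> \<Phi> (b * f k) = \<Phi> b * \<Phi> (f k)" for k b by (auto simp: R)
    have lB: "l \<in> B" using unital_cstar_subalgebraD(3)[OF B] fB * closed_sequentially by blast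
    note lim = schwarz_map_tendsto[OF B UCP_schwarz_map[OF B \<Phi>B]]
    have "\<Phi> (b * l) = \<Phi> b * \<Phi> l" if b: "b \<in> B" for b
    proof (rule eq_matI)
      show "dim_row (\<Phi> (b * l)) = dim_row (\<Phi> b * \<Phi> l)" "dim_col (\<Phi> (b * l)) = dim_col (\<Phi> b * \<Phi> l)"
        using car[OF b] car[OF lB] car[OF Bm[OF b lB]] by auto
      fix i j assume "i < dim_row (\<Phi> b * \<Phi> l)" "j < dim_col (\<Phi> b * \<Phi> l)"
      then have ij: "i < n" "j < n" using car[OF b] car[OF lB] by auto
      show "\<Phi> (b * l) $$ (i, j) = (\<Phi> b * \<Phi> l) $$ (i, j)"
      proof (rule LIMSEQ_unique)
        show "(\<lambda>k. \<Phi> (b * f k) $$ (i, j)) \<longlonglongrightarrow> \<Phi> (b * l) $$ (i, j)"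
          by (rule lim[OF _ _ _ ij]) (use * b fB lB Bm in \<open>auto intro: tendsto_intros\<close>)
        show "(\<lambda>k. \<Phi> (b * f k) $$ (i, j)) \<longlonglongrightarrow> (\<Phi> b * \<Phi> l) $$ (i, j)"
          unfolding fe[OF b] index_mult[OF car[OF b] car[OF fB] ij] index_mult[OF car[OF b] car[OF lB] ij]
          by (intro tendsto_sum tendsto_mult tendsto_const lim[OF fB _ lB]) (use * ij in auto)
      qed
    qed
    then show "l \<in> R" using lB by (simp add: R)
  qed
  define T where "T = R \<inter> star -` R"
  have "closed T"
    unfolding T_def using \<open>closed R\<close> bounded_linear.continuous_on[OF bounded_linear_star continuous_on_id]
    by (intro closed_Int closed_vimage) (auto simp: id_def)
  then have "unital_cstar_subalgebra T"
    by (auto simp: unital_cstar_subalgebra_def operator_system_def T_def star_add star_mult star_scaleC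
        star_star R1 Radd Rsc Rmult)
  moreover have "S \<subseteq> T"
  proof
    fix s assume s: "s \<in> S"
    then have "s \<in> B" "star s \<in> B" "star s \<in> S" 
      using subset_generated_cstar[of S] operator_systemD(6)[OF S] unfolding B_def by auto
    then show "s \<in> T"
      using s UCP_multiplicative_right[OF B \<Phi>B] eq by (auto simp: T_def R)
  qed
  ultimately have "B \<subseteq> T" unfolding B_def by (intro generated_cstar_minimal)
  then show ?thesis using ab unfolding B_def T_def R_def by blast
qed

section \<open>Isometries, traces and commutants\<close>

lemma mat_adjoint_adjoint [simp]: "mat_adjoint (mat_adjoint A) = (A :: complex mat)"
  by (rule eq_matI) auto

lemma mat_adjoint_mult:
  assumes "A \<in> carrier_mat m k" "B \<in> carrier_mat k l"
  shows "mat_adjoint (A * B) = mat_adjoint B * mat_adjoint (A :: complex mat)"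
  by (rule eq_matI) (use assms in \<open>auto simp: scalar_prod_def mult.commute intro!: sum.cong\<close>)

lemma mat_adjoint_one [simp]: "mat_adjoint (1\<^sub>m n :: complex mat) = 1\<^sub>m n"
  by (rule eq_matI) auto

lemma index_mult_vec:
  assumes "A \<in> carrier_mat k n" "v \<in> carrier_vec n" "i < k"
  shows "(A *\<^sub>v v) $ i = (\<Sum>l<n. A $$ (i, l) * v $ l)"
  using assms by (auto simp: scalar_prod_def lessThan_atLeast0 intro!: sum.cong)

lemma index_adjoint_mult_vec:
  assumes "A \<in> carrier_mat n k" "v \<in> carrier_vec n" "i < k"
  shows "(mat_adjoint A *\<^sub>v v) $ i = (\<Sum>l<n. cnj (A $$ (l, i)) * v $ l)"
  using assms by (auto simp: scalar_prod_def lessThan_atLeast0 intro!: sum.cong)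

lemma mat_eq_on_vecI:
  fixes A B :: "complex mat"
  assumes A: "A \<in> carrier_mat m n" and B: "B \<in> carrier_mat m n"
    and eq: "\<And>v. v \<in> carrier_vec n \<Longrightarrow> A *\<^sub>v v = B *\<^sub>v v"
  shows "A = B"
proof (rule eq_matI)
  fix i j assume "i < dim_row B" "j < dim_col B"
  then have ij: "i < m" "j < n" using B by auto
  have "(C *\<^sub>v unit_vec n j) $ i = C $$ (i, j)" if "C \<in> carrier_mat m n" for C :: "complex mat"
    using that ij by simp
  then show "A $$ (i, j) = B $$ (i, j)" using A B eq[of "unit_vec n j"] by (metis unit_vec_carrier)
qed (use A B in auto)

section \<open>Traces and Frobenius norms\<close>

definition mat_trace :: "complex mat \<Rightarrow> complex" where
  "mat_trace A = (\<Sum>i<dim_row A. A $$ (i, i))"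

lemma mat_trace_mult_commute:
  assumes "A \<in> carrier_mat n m" "B \<in> carrier_mat m n"
  shows "mat_trace (A * B) = mat_trace (B * A)"
proof -
  have "mat_trace (A * B) = (\<Sum>i<n. \<Sum>l<m. A $$ (i, l) * B $$ (l, i))"
    unfolding mat_trace_def using assms by (auto simp: index_mult[OF assms] simp del: index_mult_mat(1) intro!: sum.cong)
  also have "\<dots> = (\<Sum>l<m. \<Sum>i<n. B $$ (l, i) * A $$ (i, l))"
    by (subst sum.swap) (simp add: mult.commute)
  also have "\<dots> = mat_trace (B * A)"
    unfolding mat_trace_def using assms by (auto simp: index_mult[OF assms(2,1)] simp del: index_mult_mat(1) intro!: sum.cong)
  finally show ?thesis .
qed

lemma mat_trace_adjoint_mult:
  assumes "A \<in> carrier_mat n m"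
  shows "mat_trace (mat_adjoint A * A) = of_real (\<Sum>j<m. \<Sum>i<n. (cmod (A $$ (i, j)))\<^sup>2)"
proof -
  have "mat_trace (mat_adjoint A * A) = (\<Sum>j<m. \<Sum>i<n. cnj (A $$ (i, j)) * A $$ (i, j))"
    unfolding mat_trace_def using assms
    by (auto simp: index_adjoint_mult[OF assms assms] simp del: index_mult_mat(1) intro!: sum.cong)
  also have "\<dots> = of_real (\<Sum>j<m. \<Sum>i<n. (cmod (A $$ (i, j)))\<^sup>2)"
    unfolding of_real_sum by (intro sum.cong refl) (metis complex_norm_square mult.commute)
  finally show ?thesis .
qed

lemma unitary_matD:
  assumes "unitary_mat n u"
  shows "u \<in> carrier_mat n n" "mat_adjoint u * u = 1\<^sub>m n" "u * mat_adjoint u = 1\<^sub>m n"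
  using assms by (auto simp: unitary_mat_def)

lemma mat_trace_conjugate:
  assumes u: "unitary_mat n u" and A: "A \<in> carrier_mat n n"
  shows "mat_trace (mat_adjoint u * A * u) = mat_trace A"
proof -
  note U = unitary_matD[OF u]
  have "mat_trace (mat_adjoint u * A * u) = mat_trace (u * (mat_adjoint u * A))"
    by (rule mat_trace_mult_commute) (use U A in auto)
  also have "u * (mat_adjoint u * A) = A"
    using assoc_mult_mat[of u n n "mat_adjoint u" n A n] U A by simp
  finally show ?thesis .
qed

text \<open>The squared Frobenius norm is the trace of \<open>mat_adjoint A * A\<close>, and this
  product is itself conjugated by \<open>u\<close>.\<close>

lemma frobenius_conjugate:
  assumes u: "unitary_mat n u" and A: "A \<in> carrier_mat n n"
  shows "(\<Sum>j<n. \<Sum>i<n. (cmod ((mat_adjoint u * A * u) $$ (i, j)))\<^sup>2) = (\<Sum>j<n. \<Sum>i<n. (cmod (A $$ (i, j)))\<^sup>2)"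
proof -
  note U = unitary_matD[OF u]
  define C where "C = mat_adjoint u * A * u"
  have C: "C \<in> carrier_mat n n" using U A by (auto simp: C_def)
  have "mat_adjoint C = mat_adjoint u * mat_adjoint A * u"
    unfolding C_def using U A
    by (simp add: mat_adjoint_mult[of _ n n _ n] assoc_mult_mat[of _ n n _ n _ n] mult_carrier_mat[of _ n n])
  then have "mat_adjoint C * C = mat_adjoint u * mat_adjoint A * (u * mat_adjoint u) * A * u"
    unfolding C_def using U(1) A by (simp add: assoc_mult_mat[of _ n n _ n _ n] mult_carrier_mat[of _ n n])
  also have "\<dots> = mat_adjoint u * (mat_adjoint A * A) * u"
    using U A by (simp add: assoc_mult_mat[of _ n n _ n _ n] mult_carrier_mat[of _ n n])
  finally have "mat_trace (mat_adjoint C * C) = mat_trace (mat_adjoint A * A)"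
    using mat_trace_conjugate[OF u, of "mat_adjoint A * A"] A by (simp add: mult_carrier_mat[of _ n n])
  then show ?thesis
    unfolding mat_trace_adjoint_mult[OF C] mat_trace_adjoint_mult[OF A]
    by (simp only: of_real_eq_iff C_def)
qed

text \<open>If \<open>d < m\<close>, zero rows make \<open>w\<close> a square matrix with a left
  inverse, hence with a right inverse; but row \<open>d\<close> of it is zero.\<close>

lemma isometry_dim_le:
  assumes w: "w \<in> carrier_mat d m" and iso: "mat_adjoint w * w = (1\<^sub>m m :: complex mat)"
  shows "m \<le> d"
proof (rule ccontr)
  assume "\<not> m \<le> d"
  then have dm: "d < m" by simp
  define w' where "w' = mat m m (\<lambda>(i, j). if i < d then w $$ (i, j) else 0)"
  have w': "w' \<in> carrier_mat m m" by (simp add: w'_def)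
  have "mat_adjoint w' * w' = 1\<^sub>m m"
  proof (rule eq_matI)
    fix i j assume "i < dim_row (1\<^sub>m m :: complex mat)" "j < dim_col (1\<^sub>m m :: complex mat)"
    then have ij: "i < m" "j < m" by auto
    have "(mat_adjoint w' * w') $$ (i, j) = (\<Sum>l<m. cnj (w' $$ (l, i)) * w' $$ (l, j))"
      by (rule index_adjoint_mult[OF w' w' ij])
    also have "\<dots> = (\<Sum>l<d. cnj (w $$ (l, i)) * w $$ (l, j))"
      by (rule sum.mono_neutral_cong_right) (use dm ij in \<open>auto simp: w'_def\<close>)
    also have "\<dots> = (mat_adjoint w * w) $$ (i, j)"
      by (rule index_adjoint_mult[OF w w ij, symmetric])
    finally show "(mat_adjoint w' * w') $$ (i, j) = 1\<^sub>m m $$ (i, j)" by (simp only: iso)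
  qed (use w' in auto)
  then have "w' * mat_adjoint w' = 1\<^sub>m m"
    by (rule mat_mult_left_right_inverse[rotated 2]) (use w' in auto)
  moreover have "(w' * mat_adjoint w') $$ (d, d) = 0"
    using dm unfolding index_mult[OF w' mat_adjoint_carrier[OF w'] dm dm] by (simp add: w'_def)
  ultimately show False using dm by simp
qed

section \<open>Completion of isometries and commutants\<close>

definition subspace_vec :: "nat \<Rightarrow> complex vec set \<Rightarrow> bool" where
  "subspace_vec d W \<longleftrightarrow> W \<subseteq> carrier_vec d \<and> 0\<^sub>v d \<in> W \<and> (\<forall>v\<in>W. \<forall>w\<in>W. v + w \<in> W) \<and> (\<forall>c. \<forall>v\<in>W. c \<cdot>\<^sub>v v \<in> W)"

text \<open>Gram-Schmidt as a maximality argument: among the isometries into \<open>W\<close> that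
  extend \<open>w0\<close>, one with the most columns exists because there are at most
  \<open>d\<close>. If some \<open>v\<close> in \<open>W\<close> were not fixed by
  \<open>w * mat_adjoint w\<close>, the normalised difference would provide another column. Taking
  \<open>W\<close> to be the whole space completes \<open>w0\<close> to a unitary; an empty
  \<open>w0\<close> gives an orthonormal basis of \<open>W\<close>.\<close>

lemma isometry_extend_to_subspace:
  assumes W: "subspace_vec d W" and w0: "w0 \<in> carrier_mat d m"
    and iso0: "mat_adjoint w0 * w0 = 1\<^sub>m m"
    and ran0: "\<And>x. x \<in> carrier_vec m \<Longrightarrow> w0 *\<^sub>v x \<in> W"
  obtains M w where "m \<le> M" "w \<in> carrier_mat d M" "mat_adjoint w * w = 1\<^sub>m M"
    "\<And>x. x \<in> carrier_vec M \<Longrightarrow> w *\<^sub>v x \<in> W"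
    "\<And>i j. i < d \<Longrightarrow> j < m \<Longrightarrow> w $$ (i, j) = w0 $$ (i, j)"
    "\<And>v. v \<in> W \<Longrightarrow> w *\<^sub>v (mat_adjoint w *\<^sub>v v) = v"
proof -
  define P where "P M w \<longleftrightarrow> m \<le> M \<and> w \<in> carrier_mat d M \<and> mat_adjoint w * w = 1\<^sub>m M \<and>
    (\<forall>x\<in>carrier_vec M. w *\<^sub>v x \<in> W) \<and> (\<forall>i<d. \<forall>j<m. w $$ (i, j) = w0 $$ (i, j))" for M w
  have P0: "P m w0" using assms by (simp add: P_def)
  have bound: "M \<le> d" if "\<exists>w. P M w" for M using that isometry_dim_le unfolding P_def by blast
  define M where "M = (GREATEST M. \<exists>w. P M w)"
  have "\<exists>w. P M w" unfolding M_def by (rule GreatestI_nat[of _ m d]) (use P0 bound in auto)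
  then obtain w where Pw: "P M w" by blast
  have mx: "M' \<le> M" if "P M' w'" for M' w'
    unfolding M_def by (rule Greatest_le_nat[of _ _ d]) (use that bound in auto)
  have w: "m \<le> M" "w \<in> carrier_mat d M" "mat_adjoint w * w = 1\<^sub>m M"
    and ran: "\<And>x. x \<in> carrier_vec M \<Longrightarrow> w *\<^sub>v x \<in> W"
    and ext: "\<And>i j. i < d \<Longrightarrow> j < m \<Longrightarrow> w $$ (i, j) = w0 $$ (i, j)"
    using Pw by (auto simp: P_def)
  have "w *\<^sub>v (mat_adjoint w *\<^sub>v v) = v" if v: "v \<in> W" for v
  proof (rule ccontr)
    assume ne: "w *\<^sub>v (mat_adjoint w *\<^sub>v v) \<noteq> v"
    have vc: "v \<in> carrier_vec d" using v W by (auto simp: subspace_vec_def)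
    define y where "y = mat_adjoint w *\<^sub>v v"
    have y: "y \<in> carrier_vec M" using mult_mat_vec_carrier[OF mat_adjoint_carrier[OF w(2)] vc] by (simp add: y_def)
    define u where "u = v + (- 1) \<cdot>\<^sub>v (w *\<^sub>v y)"
    have uW: "u \<in> W" using W v ran[OF y] by (auto simp: u_def subspace_vec_def)
    then have uc: "u \<in> carrier_vec d" using W by (auto simp: subspace_vec_def)
    have wu: "mat_adjoint w *\<^sub>v u = 0\<^sub>v M"
    proof -
      have "mat_adjoint w *\<^sub>v u = mat_adjoint w *\<^sub>v v + (- 1) \<cdot>\<^sub>v (mat_adjoint w *\<^sub>v (w *\<^sub>v y))"
        unfolding u_def using w vc y
        by (simp add: mult_add_distrib_mat_vec[of _ M d] mult_mat_vec[of _ M d])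
      also have "mat_adjoint w *\<^sub>v (w *\<^sub>v y) = y"
        using w y by (simp add: assoc_mult_mat_vec[of _ M d _ M, symmetric])
      also have "mat_adjoint w *\<^sub>v v + (- 1) \<cdot>\<^sub>v y = 0\<^sub>v M"
        unfolding y_def[symmetric] by (rule eq_vecI) (use y in auto)
      finally show ?thesis .
    qed
    have orth: "(\<Sum>i<d. cnj (w $$ (i, j)) * u $ i) = 0" if "j < M" for j
      using index_adjoint_mult_vec[OF w(2) uc that] wu that by simp
    have orth': "(\<Sum>i<d. cnj (u $ i) * w $$ (i, j)) = 0" if "j < M" for j
    proof -
      have "(\<Sum>i<d. cnj (u $ i) * w $$ (i, j)) = cnj (\<Sum>i<d. cnj (w $$ (i, j)) * u $ i)"
        by (simp add: mult.commute)
      then show ?thesis using orth[OF that] by simp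
    qed
    define N where "N = (\<Sum>i<d. (cmod (u $ i))\<^sup>2)"
    have "N \<noteq> 0"
    proof
      assume "N = 0"
      then have z: "u $ i = 0" if "i < d" for i
        using that unfolding N_def by (subst (asm) sum_nonneg_eq_0_iff) auto
      have "v $ i = (w *\<^sub>v y) $ i" if "i < d" for i
        using z[OF that] that vc w y by (simp add: u_def)
      then have "w *\<^sub>v y = v" using vc w by (intro eq_vecI) auto
      then show False using ne by (simp add: y_def)
    qed
    moreover have "0 \<le> N" unfolding N_def by (intro sum_nonneg) auto
    ultimately have N: "0 < N" by simp
    define c where "c = complex_of_real (1 / sqrt N)"
    have uu: "(\<Sum>i<d. cnj (u $ i) * u $ i) = of_real N"
      unfolding N_def of_real_sum by (intro sum.cong refl) (metis complex_norm_square mult.commute)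
    have cc: "cnj c * c * of_real N = 1"
      using N by (simp add: c_def power2_eq_square flip: of_real_mult)
    define w' where "w' = mat d (Suc M) (\<lambda>(i, j). if j < M then w $$ (i, j) else c * u $ i)"
    have w': "w' \<in> carrier_mat d (Suc M)" by (simp add: w'_def)
    have "P (Suc M) w'"
      unfolding P_def
    proof (intro conjI ballI allI impI w')
      show "m \<le> Suc M" using w by simp
      show "w' $$ (i, j) = w0 $$ (i, j)" if "i < d" "j < m" for i j
        using that w(1) ext by (simp add: w'_def)
      show "mat_adjoint w' * w' = 1\<^sub>m (Suc M)"
      proof (rule eq_matI)
        fix i j assume "i < dim_row (1\<^sub>m (Suc M) :: complex mat)" "j < dim_col (1\<^sub>m (Suc M) :: complex mat)"
        then have ij: "i < Suc M" "j < Suc M" by auto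
        have e: "(mat_adjoint w' * w') $$ (i, j) = (\<Sum>l<d. cnj (w' $$ (l, i)) * w' $$ (l, j))"
          by (rule index_adjoint_mult[OF w' w' ij])
        consider "i < M" "j < M" | "i < M" "j = M" | "i = M" "j < M" | "i = M" "j = M" using ij by linarith
        then show "(mat_adjoint w' * w') $$ (i, j) = 1\<^sub>m (Suc M) $$ (i, j)"
        proof cases
          case 1
          then have "(\<Sum>l<d. cnj (w' $$ (l, i)) * w' $$ (l, j)) = (mat_adjoint w * w) $$ (i, j)"
            by (simp add: index_adjoint_mult[OF w(2) w(2)] w'_def del: index_mult_mat(1))
          then show ?thesis unfolding e w(3) using 1 by simp
        next
          case 2
          then have "(\<Sum>l<d. cnj (w' $$ (l, i)) * w' $$ (l, j)) = c * (\<Sum>l<d. cnj (w $$ (l, i)) * u $ l)"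
            by (simp add: w'_def sum_distrib_left mult_ac)
          then show ?thesis unfolding e using 2 orth by simp
        next
          case 3
          then have "(\<Sum>l<d. cnj (w' $$ (l, i)) * w' $$ (l, j)) = cnj c * (\<Sum>l<d. cnj (u $ l) * w $$ (l, j))"
            by (simp add: w'_def sum_distrib_left mult_ac)
          then show ?thesis unfolding e using 3 orth' by simp
        next
          case 4
          then have "(\<Sum>l<d. cnj (w' $$ (l, i)) * w' $$ (l, j)) = cnj c * c * (\<Sum>l<d. cnj (u $ l) * u $ l)"
            by (simp add: w'_def sum_distrib_left mult_ac)
          then show ?thesis unfolding e using 4 cc uu by simp
        qed
      qed (use w' in auto)
      fix x :: "complex vec" assume x: "x \<in> carrier_vec (Suc M)"
      have x': "vec M (($) x) \<in> carrier_vec M" by simp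
      have "w' *\<^sub>v x = w *\<^sub>v vec M (($) x) + (x $ M * c) \<cdot>\<^sub>v u"
        by (rule eq_vecI) (use w w' x uc in
          \<open>auto simp: index_mult_vec[OF w' x] index_mult_vec[OF w(2) x'] simp del: index_mult_mat_vec, auto simp: w'_def mult_ac\<close>)
      then show "w' *\<^sub>v x \<in> W" using ran[OF x'] uW W by (auto simp: subspace_vec_def)
    qed
    then show False using mx by fastforce
  qed
  then show thesis using that w ran ext by blast
qed

text \<open>With \<open>W\<close> the whole space, \<open>u * mat_adjoint u\<close> is the identity,
  and the dimension bound for \<open>u\<close> and for its adjoint makes \<open>u\<close>
  square.\<close>

lemma isometry_extend_to_unitary:
  assumes w: "w \<in> carrier_mat d m" "mat_adjoint w * w = 1\<^sub>m m"
  obtains u where "unitary_mat d u" "\<And>i j. i < d \<Longrightarrow> j < m \<Longrightarrow> u $$ (i, j) = w $$ (i, j)" "m \<le> d"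
proof -
  obtain M u where u: "m \<le> M" "u \<in> carrier_mat d M" "mat_adjoint u * u = 1\<^sub>m M"
    "\<And>i j. i < d \<Longrightarrow> j < m \<Longrightarrow> u $$ (i, j) = w $$ (i, j)"
    "\<And>v. v \<in> carrier_vec d \<Longrightarrow> u *\<^sub>v (mat_adjoint u *\<^sub>v v) = v"
    by (rule isometry_extend_to_subspace[of d "carrier_vec d" w m]) (use w in \<open>auto simp: subspace_vec_def\<close>)
  have "(u * mat_adjoint u) *\<^sub>v v = 1\<^sub>m d *\<^sub>v v" if "v \<in> carrier_vec d" for v
    using u that by (simp add: assoc_mult_mat_vec[of _ d M _ d])
  then have uu: "u * mat_adjoint u = 1\<^sub>m d"
    by (intro mat_eq_on_vecI[of _ d d]) (use u in auto)
  have "d \<le> M" using isometry_dim_le[of "mat_adjoint u" M d] u uu by simp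
  moreover have "M \<le> d" using isometry_dim_le u by blast
  ultimately have "M = d" by simp
  then show thesis using that u uu by (auto simp: unitary_mat_def)
qed

text \<open>Schur's lemma: \<open>A\<close> has an eigenvalue, and its eigenspace is nonzero and
  invariant under \<open>\<pi>\<close>, hence the whole space.\<close>

lemma irreducible_commutant:
  assumes irr: "irreducible_representation B n \<pi>" and A: "A \<in> carrier_mat n n"
    and comm: "\<And>a. a \<in> B \<Longrightarrow> A * \<pi> a = \<pi> a * A"
  obtains t where "A = t \<cdot>\<^sub>m 1\<^sub>m n"
proof -
  have n: "0 < n" and rep: "star_representation B n \<pi>" using irr by (auto simp: irreducible_representation_def)
  have car: "\<pi> a \<in> carrier_mat n n" if "a \<in> B" for a
    using rep that by (auto simp: star_representation_def linear_map_on_def)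
  obtain t where "eigenvalue A t" using spectrum_non_empty[OF A n] by (auto simp: spectrum_def)
  then obtain v where v: "v \<in> carrier_vec n" "v \<noteq> 0\<^sub>v n" "A *\<^sub>v v = t \<cdot>\<^sub>v v"
    using A by (auto simp: eigenvalue_def eigenvector_def)
  define W where "W = {v \<in> carrier_vec n. A *\<^sub>v v = t \<cdot>\<^sub>v v}"
  have inv: "\<pi> a *\<^sub>v x \<in> W" if a: "a \<in> B" and x: "x \<in> W" for a x
  proof -
    have xc: "x \<in> carrier_vec n" and xe: "A *\<^sub>v x = t \<cdot>\<^sub>v x" using x by (auto simp: W_def)
    have "A *\<^sub>v (\<pi> a *\<^sub>v x) = (\<pi> a * A) *\<^sub>v x"
      by (simp only: assoc_mult_mat_vec[OF A car[OF a] xc, symmetric] comm[OF a])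
    also have "\<dots> = \<pi> a *\<^sub>v (t \<cdot>\<^sub>v x)" by (simp only: assoc_mult_mat_vec[OF car[OF a] A xc] xe)
    also have "\<dots> = t \<cdot>\<^sub>v (\<pi> a *\<^sub>v x)" using car[OF a] xc by (simp add: mult_mat_vec[of _ n n])
    finally show ?thesis using car[OF a] xc by (simp add: W_def)
  qed
  have "x + y \<in> W" if "x \<in> W" "y \<in> W" for x y
    using that A by (simp add: W_def mult_add_distrib_mat_vec[of _ n n] smult_add_distrib_vec[of _ n])
  moreover have "c \<cdot>\<^sub>v x \<in> W" if "x \<in> W" for c x
    using that A by (simp add: W_def mult_mat_vec[of _ n n] smult_smult_assoc mult.commute)
  moreover have "0\<^sub>v n \<in> W" using A by (auto simp: W_def)
  moreover have "W \<subseteq> carrier_vec n" by (auto simp: W_def)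
  ultimately have "W \<subseteq> carrier_vec n \<and> 0\<^sub>v n \<in> W \<and> (\<forall>v\<in>W. \<forall>w\<in>W. v + w \<in> W) \<and>
      (\<forall>c. \<forall>v\<in>W. c \<cdot>\<^sub>v v \<in> W) \<and> (\<forall>a\<in>B. \<forall>v\<in>W. \<pi> a *\<^sub>v v \<in> W)"
    using inv by blast
  then have "W = {0\<^sub>v n} \<or> W = carrier_vec n" using irr by (auto simp: irreducible_representation_def)
  moreover have "v \<in> W" using v by (simp add: W_def)
  ultimately have "W = carrier_vec n" using v by auto
  then have all: "A *\<^sub>v x = t \<cdot>\<^sub>v x" if "x \<in> carrier_vec n" for x using that by (auto simp: W_def)
  have "(t \<cdot>\<^sub>m 1\<^sub>m n) *\<^sub>v x = t \<cdot>\<^sub>v x" if "x \<in> carrier_vec n" for x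
    using that by (intro eq_vecI) auto
  then have "A = t \<cdot>\<^sub>m 1\<^sub>m n"
    by (intro mat_eq_on_vecI[of _ n n]) (use A all in auto)
  then show thesis by (rule that)
qed

section \<open>Boundary representations are absolute matrix extreme points\<close>

lemma index_sandwich:
  assumes A: "A \<in> carrier_mat d p" and X: "X \<in> carrier_mat d e" and C: "C \<in> carrier_mat e q"
    and ij: "i < p" "j < q"
  shows "(mat_adjoint A * X * C) $$ (i, j) = (\<Sum>k<d. \<Sum>l<e. cnj (A $$ (k, i)) * X $$ (k, l) * C $$ (l, j))"
proof -
  have "(mat_adjoint A * X * C) $$ (i, j) = (\<Sum>l<e. (\<Sum>k<d. cnj (A $$ (k, i)) * X $$ (k, l)) * C $$ (l, j))"
    using A X C ij
    by (simp add: index_mult[of "mat_adjoint A * X" p e C q] index_adjoint_mult[OF A X] mult_carrier_mat[of _ p d]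
        del: index_mult_mat(1))
  also have "\<dots> = (\<Sum>l<e. \<Sum>k<d. cnj (A $$ (k, i)) * X $$ (k, l) * C $$ (l, j))"
    by (simp add: sum_distrib_right)
  also have "\<dots> = (\<Sum>k<d. \<Sum>l<e. cnj (A $$ (k, i)) * X $$ (k, l) * C $$ (l, j))" by (rule sum.swap)
  finally show ?thesis .
qed

text \<open>With the single vector 1, compression is conjugation by \<open>w\<close>; its linearity
  and complete positivity thus need no separate argument.\<close>

lemma sandwich_eq_compression:
  assumes w: "w \<in> carrier_mat d n" and X: "\<Phi> a \<in> carrier_mat d d"
  shows "mat_adjoint w * \<Phi> a * w = compression \<Phi> d n 1 (\<lambda>_. 1) (\<lambda>_ i \<alpha>. w $$ (i, \<alpha>)) a"
  by (rule eq_matI)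
    (use w X in \<open>auto simp: compression_def index_sandwich[OF w X w] simp del: index_mult_mat(1)\<close>)

lemma sandwich_linear_cp:
  assumes T: "operator_system T" and L: "linear_map_on T d \<Phi>" and cp: "completely_positive T d \<Phi>"
    and w: "w \<in> carrier_mat d n"
  shows "linear_map_on T n (\<lambda>a. mat_adjoint w * \<Phi> a * w)"
    and "completely_positive T n (\<lambda>a. mat_adjoint w * \<Phi> a * w)"
proof -
  let ?C = "compression \<Phi> d n 1 (\<lambda>_. 1) (\<lambda>_ i \<alpha>. w $$ (i, \<alpha>))"
  have C: "linear_map_on T n ?C" "completely_positive T n ?C"
    by (rule compression_linear_cp[OF T T L cp]; simp)+
  have eq: "mat_adjoint w * \<Phi> a * w = ?C a" if "a \<in> T" for a
    by (rule sandwich_eq_compression[where \<Phi> = \<Phi>, OF w linear_map_onD(1)[OF L that]])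
  show "linear_map_on T n (\<lambda>a. mat_adjoint w * \<Phi> a * w)"
    using C(1) operator_systemD[OF T] by (simp add: linear_map_on_def eq)
  show "completely_positive T n (\<lambda>a. mat_adjoint w * \<Phi> a * w)"
  proof (rule completely_positiveI[OF T])
    fix k m v and b :: "nat \<Rightarrow> nat \<Rightarrow> 'a"
    assume g: "\<And>p q. p < k \<Longrightarrow> q < k \<Longrightarrow> gram m b p q \<in> T"
    have "mform (\<lambda>a. mat_adjoint w * \<Phi> a * w) n {..<k} (gram m b) v = mform ?C n {..<k} (gram m b) v"
      unfolding mform_def by (intro sum.cong refl) (simp only: eq g lessThan_iff)
    then show "0 \<le> mform (\<lambda>a. mat_adjoint w * \<Phi> a * w) n {..<k} (gram m b) v"
      using completely_positive_form_nonneg[OF T C(2) finite_lessThan, of k m b v] g by simp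
  qed
qed

lemma sandwich_UCP:
  assumes T: "operator_system T" and \<Phi>: "\<Phi> \<in> UCP T d"
    and w: "w \<in> carrier_mat d n" "mat_adjoint w * w = 1\<^sub>m n"
  shows "(\<lambda>a. mat_adjoint w * \<Phi> a * w) \<in> UCP T n"
  using sandwich_linear_cp[OF T UCP_D(1,3)[OF \<Phi>] w(1)] w
  by (simp add: UCP_def UCP_D(2)[OF \<Phi>] right_mult_one_mat[of _ n d])

section \<open>Matrix convex combinations of UCP maps\<close>

lemma mat_sum_carrier [simp]: "mat_sum n k M \<in> carrier_mat n n"
  by (simp add: mat_sum_def)

lemma index_mat_sum [simp]: "i < n \<Longrightarrow> j < n \<Longrightarrow> mat_sum n k M $$ (i, j) = (\<Sum>l<k. M l $$ (i, j))"
  by (simp add: mat_sum_def)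

lemma mat_sum_mult_left:
  assumes A: "A \<in> carrier_mat n n" and M: "\<And>l. l < k \<Longrightarrow> M l \<in> carrier_mat n n"
  shows "mat_sum n k (\<lambda>l. A * M l) = A * mat_sum n k M"
proof (rule eq_matI)
  fix i j assume "i < dim_row (A * mat_sum n k M)" "j < dim_col (A * mat_sum n k M)"
  then have ij: "i < n" "j < n" using A by (auto simp: mat_sum_def)
  have "mat_sum n k (\<lambda>l. A * M l) $$ (i, j) = (\<Sum>l<k. \<Sum>r<n. A $$ (i, r) * M l $$ (r, j))"
    using ij by (simp add: index_mult[OF A M ij] del: index_mult_mat(1))
  also have "\<dots> = (A * mat_sum n k M) $$ (i, j)"
    using ij unfolding index_mult[OF A mat_sum_carrier ij]
    by (subst sum.swap) (simp add: sum_distrib_left)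
  finally show "mat_sum n k (\<lambda>l. A * M l) $$ (i, j) = (A * mat_sum n k M) $$ (i, j)" .
qed (use A in \<open>auto simp: mat_sum_def\<close>)

lemma mat_sum_mult_right:
  assumes A: "A \<in> carrier_mat n n" and M: "\<And>l. l < k \<Longrightarrow> M l \<in> carrier_mat n n"
  shows "mat_sum n k (\<lambda>l. M l * A) = mat_sum n k M * A"
proof (rule eq_matI)
  fix i j assume "i < dim_row (mat_sum n k M * A)" "j < dim_col (mat_sum n k M * A)"
  then have ij: "i < n" "j < n" using A by (auto simp: mat_sum_def)
  have "mat_sum n k (\<lambda>l. M l * A) $$ (i, j) = (\<Sum>l<k. \<Sum>r<n. M l $$ (i, r) * A $$ (r, j))"
    using ij by (simp add: index_mult[OF M A ij] del: index_mult_mat(1))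
  also have "\<dots> = (mat_sum n k M * A) $$ (i, j)"
    using ij unfolding index_mult[OF mat_sum_carrier A ij]
    by (subst sum.swap) (simp add: sum_distrib_right)
  finally show "mat_sum n k (\<lambda>l. M l * A) $$ (i, j) = (mat_sum n k M * A) $$ (i, j)" .
qed (use A in \<open>auto simp: mat_sum_def\<close>)

text \<open>Positivity holds summand by summand, and the normalisation of the coefficients is
  exactly unitality. Applied to extensions of the \<open>\<psi> i\<close>, this makes the extended
  combination a competitor in the unique extension property.\<close>

lemma UCP_mat_sum:
  assumes T: "operator_system T" and \<Psi>: "\<And>i. i < k \<Longrightarrow> \<Psi> i \<in> UCP T (d i)"
    and \<gamma>: "\<And>i. i < k \<Longrightarrow> \<gamma> i \<in> carrier_mat (d i) n"
    and one: "mat_sum n k (\<lambda>i. mat_adjoint (\<gamma> i) * \<gamma> i) = 1\<^sub>m n"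
  shows "(\<lambda>a. mat_sum n k (\<lambda>i. mat_adjoint (\<gamma> i) * \<Psi> i a * \<gamma> i)) \<in> UCP T n" (is "?\<Theta> \<in> _")
proof -
  define \<theta> where "\<theta> i a = mat_adjoint (\<gamma> i) * \<Psi> i a * \<gamma> i" for i a
  have L: "linear_map_on T n (\<theta> i)" and cp: "completely_positive T n (\<theta> i)" if "i < k" for i
    unfolding \<theta>_def using sandwich_linear_cp[OF T UCP_D(1,3)[OF \<Psi>[OF that]] \<gamma>[OF that]] by auto
  have lin: "linear_map_on T n (\<lambda>a. mat_sum n k (\<lambda>i. \<theta> i a))"
    unfolding linear_map_on_def
    by (auto intro!: eq_matI simp: mat_sum_def linear_map_on_index(1,2)[OF L T] sum.distrib sum_distrib_left)
  have "completely_positive T n (\<lambda>a. mat_sum n k (\<lambda>i. \<theta> i a))"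
  proof (rule completely_positiveI[OF T])
    fix k' m and v :: "nat \<Rightarrow> nat \<Rightarrow> complex" and b :: "nat \<Rightarrow> nat \<Rightarrow> 'a"
    assume g: "\<And>p q. p < k' \<Longrightarrow> q < k' \<Longrightarrow> gram m b p q \<in> T"
    have "mform (\<lambda>a. mat_sum n k (\<lambda>i. \<theta> i a)) n {..<k'} (gram m b) v =
      (\<Sum>p<k'. \<Sum>q<k'. \<Sum>i<n. \<Sum>j<n. \<Sum>l<k. cnj (v p i) * \<theta> l (gram m b p q) $$ (i, j) * v q j)"
      unfolding mform_def by (intro sum.cong refl) (simp add: sum_distrib_left sum_distrib_right)
    also have "\<dots> = (\<Sum>l<k. mform (\<theta> l) n {..<k'} (gram m b) v)"
      unfolding mform_def by (simp only: sum.swap[where B = "{..<k}"])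
    also have "0 \<le> \<dots>"
      using g by (intro sum_nonneg completely_positive_form_nonneg[OF T cp]) auto
    finally show "0 \<le> mform (\<lambda>a. mat_sum n k (\<lambda>i. \<theta> i a)) n {..<k'} (gram m b) v" .
  qed
  moreover have "mat_sum n k (\<lambda>i. \<theta> i 1) = mat_sum n k (\<lambda>i. mat_adjoint (\<gamma> i) * \<gamma> i)"
  proof -
    have "\<theta> i 1 = mat_adjoint (\<gamma> i) * \<gamma> i" if "i < k" for i
      unfolding \<theta>_def UCP_D(2)[OF \<Psi>[OF that]]
      by (simp add: right_mult_one_mat[OF mat_adjoint_carrier[OF \<gamma>[OF that]]])
    then show ?thesis by (auto simp: mat_sum_def intro!: cong_mat sum.cong)
  qed
  ultimately show ?thesis using lin one by (simp add: UCP_def \<theta>_def)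
qed

text \<open>The Schwarz inequality for \<open>a\<close> alone, tested on column \<open>j\<close> of
  \<open>w\<close>.\<close>

lemma UCP_Schwarz_sandwich:
  assumes B: "unital_cstar_subalgebra B" and \<Psi>: "\<Psi> \<in> UCP B d" and w: "w \<in> carrier_mat d n"
    and a: "a \<in> B" and j: "j < n"
  shows "(mat_adjoint w * (mat_adjoint (\<Psi> a) * \<Psi> a) * w) $$ (j, j) \<le> (mat_adjoint w * \<Psi> (star a * a) * w) $$ (j, j)"
proof -
  note Bo = operator_systemD[OF unital_cstar_subalgebraD(1)[OF B]]
  have car: "\<Psi> b \<in> carrier_mat d d" if "b \<in> B" for b using linear_map_onD(1)[OF UCP_D(1)[OF \<Psi>] that] .
  have "0 \<le> (\<Sum>i<d. \<Sum>k<d. cnj (w $$ (i, j)) *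
      (\<Psi> (star a * a) $$ (i, k) - (mat_adjoint (\<Psi> a) * \<Psi> a) $$ (i, k)) * w $$ (k, j))"
    using UCP_Schwarz_form[OF B \<Psi>, of "{()}" "\<lambda>_. a" "\<lambda>_ i. w $$ (i, j)"] a by simp
  also have "\<dots> = (mat_adjoint w * \<Psi> (star a * a) * w) $$ (j, j) - (mat_adjoint w * (mat_adjoint (\<Psi> a) * \<Psi> a) * w) $$ (j, j)"
  proof -
    have "\<Psi> (star a * a) \<in> carrier_mat d d" "mat_adjoint (\<Psi> a) * \<Psi> a \<in> carrier_mat d d"
      using car[OF unital_cstar_subalgebraD(2)[OF B Bo(6)[OF a] a]] car[OF a] by (auto simp: mult_carrier_mat[of _ d d])
    from index_sandwich[OF w this(1) w j j] index_sandwich[OF w this(2) w j j] show ?thesis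
      by (simp add: right_diff_distrib left_diff_distrib sum_subtractf del: index_mult_mat(1))
  qed
  finally show ?thesis by (simp add: less_eq_complex_def)
qed

text \<open>The sum of \<open>|\<Psi>\<^sub>i(a) \<gamma>\<^sub>i - \<gamma>\<^sub>i \<pi>(a)|\<^sup>2\<close> over all \<open>i\<close> is at most
  \<open>\<pi>(a\<^sup>* a) - \<pi>(a)\<^sup>* \<pi>(a) = 0\<close>.\<close>

lemma multiplicative_combination_intertwines:
  assumes B: "unital_cstar_subalgebra B" and \<pi>: "star_representation B n \<pi>"
    and \<Psi>: "\<And>i. i < k \<Longrightarrow> \<Psi> i \<in> UCP B (d i)"
    and \<gamma>: "\<And>i. i < k \<Longrightarrow> \<gamma> i \<in> carrier_mat (d i) n"
    and one: "mat_sum n k (\<lambda>i. mat_adjoint (\<gamma> i) * \<gamma> i) = 1\<^sub>m n"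
    and eq: "\<And>a. a \<in> B \<Longrightarrow> mat_sum n k (\<lambda>i. mat_adjoint (\<gamma> i) * \<Psi> i a * \<gamma> i) = \<pi> a"
    and i: "i < k" and a: "a \<in> B"
  shows "\<Psi> i a * \<gamma> i = \<gamma> i * \<pi> a"
proof -
  note Bs = unital_cstar_subalgebraD(1)[OF B]
  note Bo = operator_systemD[OF Bs]
  define P where "P = \<pi> a"
  have P: "P \<in> carrier_mat n n" using \<pi> a by (auto simp: P_def star_representation_def linear_map_on_def)
  have \<pi>aa: "\<pi> (star a * a) = mat_adjoint P * P" and \<pi>sa: "\<pi> (star a) = mat_adjoint P"
    using \<pi> a Bo(6)[OF a] by (auto simp: star_representation_def P_def)
  define X where "X l = \<Psi> l a" for l
  have X: "X l \<in> carrier_mat (d l) (d l)" if "l < k" for l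
    using linear_map_onD(1)[OF UCP_D(1)[OF \<Psi>[OF that]] a] by (simp add: X_def)
  have Xs: "mat_adjoint (X l) = \<Psi> l (star a)" if "l < k" for l
    using UCP_star[OF Bs \<Psi>[OF that] a] by (simp add: X_def)
  define E where "E l = X l * \<gamma> l - \<gamma> l * P" for l
  have E: "E l \<in> carrier_mat (d l) n" if "l < k" for l
    using X[OF that] \<gamma>[OF that] P by (auto simp: E_def)
  have G: "mat_adjoint (\<gamma> l) * M * \<gamma> l \<in> carrier_mat n n" if "l < k" "M \<in> carrier_mat (d l) (d l)" for l M
    using \<gamma>[OF that(1)] that(2) by (meson mat_adjoint_carrier mult_carrier_mat)
  have EE: "mat_adjoint (E l) * E l = mat_adjoint (\<gamma> l) * (mat_adjoint (X l) * X l) * \<gamma> l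
      - mat_adjoint (\<gamma> l) * \<Psi> l (star a) * \<gamma> l * P
      - mat_adjoint P * (mat_adjoint (\<gamma> l) * \<Psi> l a * \<gamma> l)
      + mat_adjoint P * (mat_adjoint (\<gamma> l) * \<gamma> l) * P" if l: "l < k" for l
  proof -
    note c = X[OF l] \<gamma>[OF l] P mat_adjoint_carrier[OF X[OF l]] mat_adjoint_carrier[OF \<gamma>[OF l]] mat_adjoint_carrier[OF P]
    define D where "D = d l"
    note c' = c[folded D_def]
    have Xg: "X l * \<gamma> l \<in> carrier_mat D n" and gP: "\<gamma> l * P \<in> carrier_mat D n"
      and gX: "mat_adjoint (\<gamma> l) * mat_adjoint (X l) \<in> carrier_mat n D"
      and Pg: "mat_adjoint P * mat_adjoint (\<gamma> l) \<in> carrier_mat n D"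
      using c' by (auto intro: mult_carrier_mat)
    have "mat_adjoint (E l) = mat_adjoint (X l * \<gamma> l) - mat_adjoint (\<gamma> l * P)"
      unfolding E_def using c' by (intro eq_matI) (auto simp del: index_mult_mat(1))
    also have "\<dots> = mat_adjoint (\<gamma> l) * mat_adjoint (X l) - mat_adjoint P * mat_adjoint (\<gamma> l)"
      by (simp only: mat_adjoint_mult[OF c'(1,2)] mat_adjoint_mult[OF c'(2,3)])
    finally have "mat_adjoint (E l) * E l =
      (mat_adjoint (\<gamma> l) * mat_adjoint (X l) - mat_adjoint P * mat_adjoint (\<gamma> l)) * (X l * \<gamma> l - \<gamma> l * P)"
      by (simp only: E_def)
    also have "\<dots> = mat_adjoint (\<gamma> l) * mat_adjoint (X l) * (X l * \<gamma> l)
      - mat_adjoint (\<gamma> l) * mat_adjoint (X l) * (\<gamma> l * P)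
      - (mat_adjoint P * mat_adjoint (\<gamma> l) * (X l * \<gamma> l) - mat_adjoint P * mat_adjoint (\<gamma> l) * (\<gamma> l * P))"
      by (simp only: minus_mult_distrib_mat[OF gX Pg minus_carrier_mat[OF gP]]
          mult_minus_distrib_mat[OF gX Xg gP] mult_minus_distrib_mat[OF Pg Xg gP])
    also have "mat_adjoint (\<gamma> l) * mat_adjoint (X l) * (X l * \<gamma> l) = mat_adjoint (\<gamma> l) * (mat_adjoint (X l) * X l) * \<gamma> l"
      using c' by (simp add: assoc_mult_mat[of _ n D _ D _ n] assoc_mult_mat[of _ n D _ D _ D]
        assoc_mult_mat[of _ D D _ D _ n] mult_carrier_mat[of _ D D] mult_carrier_mat[of _ n D])
    also have "mat_adjoint (\<gamma> l) * mat_adjoint (X l) * (\<gamma> l * P) = mat_adjoint (\<gamma> l) * \<Psi> l (star a) * \<gamma> l * P"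
      using assoc_mult_mat[OF gX c'(2,3)] by (simp add: Xs[OF l])
    also have "mat_adjoint P * mat_adjoint (\<gamma> l) * (X l * \<gamma> l) = mat_adjoint P * (mat_adjoint (\<gamma> l) * \<Psi> l a * \<gamma> l)"
      using assoc_mult_mat[OF c'(6,5) Xg] assoc_mult_mat[OF c'(5,1,2)] by (simp add: X_def)
    also have "mat_adjoint P * mat_adjoint (\<gamma> l) * (\<gamma> l * P) = mat_adjoint P * (mat_adjoint (\<gamma> l) * \<gamma> l) * P"
      using assoc_mult_mat[OF Pg c'(2,3)] assoc_mult_mat[OF c'(6,5,2)] by simp
    finally have *: "mat_adjoint (E l) * E l = mat_adjoint (\<gamma> l) * (mat_adjoint (X l) * X l) * \<gamma> l
      - mat_adjoint (\<gamma> l) * \<Psi> l (star a) * \<gamma> l * P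
      - (mat_adjoint P * (mat_adjoint (\<gamma> l) * \<Psi> l a * \<gamma> l) - mat_adjoint P * (mat_adjoint (\<gamma> l) * \<gamma> l) * P)" .
    show ?thesis unfolding *
      by (rule eq_matI) (use c' in \<open>auto simp del: index_mult_mat(1)\<close>)
  qed
  \<comment> \<open>Summed over \<open>l\<close>, the last three terms of \<open>EE\<close> become
    \<open>mat_adjoint P * P\<close> with the signs minus, minus, plus. Schwarz bounds the first by
    \<open>\<pi> (star a * a)\<close>, which is the same matrix on the diagonal. The squared norms
    of the columns of all \<open>E l\<close> therefore sum to at most 0.\<close>
  have zero: "E l $$ (r, j) = 0" if l: "l < k" and r: "r < d l" and j: "j < n" for l r j
  proof -
    have adjP: "mat_adjoint P \<in> carrier_mat n n" using P by simp
    have s: "(\<Sum>l<k. M l $$ (j, j)) = mat_sum n k M $$ (j, j)" for M using j by simp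
    have g1: "\<Psi> l b \<in> carrier_mat (d l) (d l)" if "l < k" "b \<in> B" for l b
      using linear_map_onD(1)[OF UCP_D(1)[OF \<Psi>[OF that(1)]] that(2)] .
    have gg: "mat_adjoint (\<gamma> l) * \<gamma> l \<in> carrier_mat n n" if "l < k" for l
      using \<gamma>[OF that] by (meson mat_adjoint_carrier mult_carrier_mat)
    have "(\<Sum>l<k. (mat_adjoint (E l) * E l) $$ (j, j)) =
      (\<Sum>l<k. (mat_adjoint (\<gamma> l) * (mat_adjoint (X l) * X l) * \<gamma> l) $$ (j, j)
      - (mat_adjoint (\<gamma> l) * \<Psi> l (star a) * \<gamma> l * P) $$ (j, j)
      - (mat_adjoint P * (mat_adjoint (\<gamma> l) * \<Psi> l a * \<gamma> l)) $$ (j, j)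
      + (mat_adjoint P * (mat_adjoint (\<gamma> l) * \<gamma> l) * P) $$ (j, j))"
    proof (intro sum.cong refl)
      fix l assume "l \<in> {..<k}"
      then have l: "l < k" by simp
      note c = \<gamma>[OF l] P
      show "(mat_adjoint (E l) * E l) $$ (j, j) =
        (mat_adjoint (\<gamma> l) * (mat_adjoint (X l) * X l) * \<gamma> l) $$ (j, j)
        - (mat_adjoint (\<gamma> l) * \<Psi> l (star a) * \<gamma> l * P) $$ (j, j)
        - (mat_adjoint P * (mat_adjoint (\<gamma> l) * \<Psi> l a * \<gamma> l)) $$ (j, j)
        + (mat_adjoint P * (mat_adjoint (\<gamma> l) * \<gamma> l) * P) $$ (j, j)"
        unfolding EE[OF l] using c j by (simp del: index_mult_mat(1))
    qed
    also have "\<dots> = (\<Sum>l<k. (mat_adjoint (\<gamma> l) * (mat_adjoint (X l) * X l) * \<gamma> l) $$ (j, j))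
      - mat_sum n k (\<lambda>l. mat_adjoint (\<gamma> l) * \<Psi> l (star a) * \<gamma> l * P) $$ (j, j)
      - mat_sum n k (\<lambda>l. mat_adjoint P * (mat_adjoint (\<gamma> l) * \<Psi> l a * \<gamma> l)) $$ (j, j)
      + mat_sum n k (\<lambda>l. mat_adjoint P * (mat_adjoint (\<gamma> l) * \<gamma> l) * P) $$ (j, j)"
      by (simp only: sum.distrib sum_subtractf s)
    also have "mat_sum n k (\<lambda>l. mat_adjoint (\<gamma> l) * \<Psi> l (star a) * \<gamma> l * P) = mat_adjoint P * P"
      by (subst mat_sum_mult_right[OF P]) (auto simp: eq[OF Bo(6)[OF a]] \<pi>sa intro!: G g1 Bo(6) a)
    also have "mat_sum n k (\<lambda>l. mat_adjoint P * (mat_adjoint (\<gamma> l) * \<Psi> l a * \<gamma> l)) = mat_adjoint P * P"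
      by (subst mat_sum_mult_left[OF adjP]) (auto simp: eq[OF a] P_def[symmetric] intro!: G g1 a)
    also have "mat_sum n k (\<lambda>l. mat_adjoint P * (mat_adjoint (\<gamma> l) * \<gamma> l) * P) = mat_adjoint P * P"
    proof -
      have "mat_sum n k (\<lambda>l. mat_adjoint P * (mat_adjoint (\<gamma> l) * \<gamma> l) * P) =
        mat_sum n k (\<lambda>l. mat_adjoint P * (mat_adjoint (\<gamma> l) * \<gamma> l)) * P"
        by (rule mat_sum_mult_right[OF P]) (rule mult_carrier_mat[OF adjP gg])
      also have "mat_sum n k (\<lambda>l. mat_adjoint P * (mat_adjoint (\<gamma> l) * \<gamma> l)) = mat_adjoint P * 1\<^sub>m n"
        unfolding one[symmetric] by (rule mat_sum_mult_left[OF adjP gg])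
      finally show ?thesis by (simp only: right_mult_one_mat[OF adjP])
    qed
    also have "(\<Sum>l<k. (mat_adjoint (\<gamma> l) * (mat_adjoint (X l) * X l) * \<gamma> l) $$ (j, j))
      \<le> (\<Sum>l<k. (mat_adjoint (\<gamma> l) * \<Psi> l (star a * a) * \<gamma> l) $$ (j, j))"
      unfolding X_def by (rule sum_mono) (use UCP_Schwarz_sandwich[OF B \<Psi> \<gamma> a j] in auto)
    also have "\<dots> = (mat_adjoint P * P) $$ (j, j)"
      unfolding s using eq[OF unital_cstar_subalgebraD(2)[OF B Bo(6)[OF a] a]] by (simp only: \<pi>aa)
    finally have le: "(\<Sum>l<k. (mat_adjoint (E l) * E l) $$ (j, j)) \<le> 0" by simp
    have "(\<Sum>l<k. (mat_adjoint (E l) * E l) $$ (j, j)) = of_real (\<Sum>l<k. \<Sum>r<d l. (cmod (E l $$ (r, j)))\<^sup>2)"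
      unfolding of_real_sum
    proof (intro sum.cong refl)
      fix l assume "l \<in> {..<k}"
      then have "(mat_adjoint (E l) * E l) $$ (j, j) = (\<Sum>r<d l. cnj (E l $$ (r, j)) * E l $$ (r, j))"
        using index_adjoint_mult[OF E E j j] by simp
      also have "\<dots> = (\<Sum>r<d l. complex_of_real ((cmod (E l $$ (r, j)))\<^sup>2))"
        by (intro sum.cong refl) (metis complex_norm_square mult.commute)
      finally show "(mat_adjoint (E l) * E l) $$ (j, j) = \<dots>" .
    qed
    then have "(\<Sum>l<k. \<Sum>r<d l. (cmod (E l $$ (r, j)))\<^sup>2) \<le> 0"
      using le by (simp add: less_eq_complex_def)
    then have "(\<Sum>l<k. \<Sum>r<d l. (cmod (E l $$ (r, j)))\<^sup>2) = 0"
      by (intro antisym sum_nonneg) auto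
    then have "(\<Sum>r<d l. (cmod (E l $$ (r, j)))\<^sup>2) = 0"
      using l by (subst (asm) sum_nonneg_eq_0_iff) (auto intro: sum_nonneg)
    then show ?thesis using r by (subst (asm) sum_nonneg_eq_0_iff) auto
  qed
  show ?thesis
  proof (rule eq_matI)
    show d: "dim_row (\<Psi> i a * \<gamma> i) = dim_row (\<gamma> i * \<pi> a)" "dim_col (\<Psi> i a * \<gamma> i) = dim_col (\<gamma> i * \<pi> a)"
      using X[OF i] \<gamma>[OF i] P by (auto simp: X_def P_def)
    fix r j assume "r < dim_row (\<gamma> i * \<pi> a)" "j < dim_col (\<gamma> i * \<pi> a)"
    then have rj: "r < d i" "j < n" using \<gamma>[OF i] P by (auto simp: P_def)
    show "(\<Psi> i a * \<gamma> i) $$ (r, j) = (\<gamma> i * \<pi> a) $$ (r, j)"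
      using zero[OF i rj] rj \<gamma>[OF i] P by (simp add: E_def X_def P_def del: index_mult_mat(1))
  qed
qed

text \<open>Complete \<open>w\<close> to a unitary \<open>u\<close> whose first \<open>n\<close>
  columns are \<open>w\<close>. Intertwining at \<open>x\<close> kills one off-diagonal block of the
  conjugated \<open>\<psi> x\<close>, and intertwining at \<open>star x\<close>, after taking
  adjoints, kills the other. The remaining block is the compression of \<open>\<psi>\<close> to the
  complementary columns. The required unitary is the adjoint of \<open>u\<close>, since the
  definition conjugates the direct sum rather than \<open>\<psi>\<close>.\<close>

lemma intertwining_isometry_summand:
  assumes S: "operator_system S" and \<phi>: "\<phi> \<in> UCP S n" and \<psi>: "\<psi> \<in> UCP S d"
    and w: "w \<in> carrier_mat d n" "mat_adjoint w * w = 1\<^sub>m n"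
    and int: "\<And>x. x \<in> S \<Longrightarrow> \<psi> x * w = w * \<phi> x"
  shows "n \<le> d" and "d = n \<Longrightarrow> \<exists>u. unitary_mat n u \<and> (\<forall>x\<in>S. \<phi> x = mat_adjoint u * \<psi> x * u)"
    and "n < d \<Longrightarrow> \<exists>\<rho>\<in>UCP S (d - n). \<exists>u. unitary_mat d u \<and>
      (\<forall>x\<in>S. \<psi> x = mat_adjoint u * direct_sum_mat (\<phi> x) (\<rho> x) * u)"
proof -
  obtain u where u: "unitary_mat d u" and uw: "\<And>i j. i < d \<Longrightarrow> j < n \<Longrightarrow> u $$ (i, j) = w $$ (i, j)"
    and nd: "n \<le> d"
    using isometry_extend_to_unitary[OF w] by blast
  note U = unitary_matD[OF u]
  have c: "\<phi> x \<in> carrier_mat n n" "\<psi> x \<in> carrier_mat d d" if "x \<in> S" for x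
    using linear_map_onD(1)[OF UCP_D(1)[OF \<phi>] that] linear_map_onD(1)[OF UCP_D(1)[OF \<psi>] that] by auto
  have wa: "mat_adjoint w \<in> carrier_mat n d" using w by simp
  have comp: "mat_adjoint w * \<psi> x * w = \<phi> x" if "x \<in> S" for x
    using assoc_mult_mat[OF wa c(2)[OF that] w(1)] assoc_mult_mat[OF wa w(1) c(1)[OF that]] c(1)[OF that]
    by (simp add: int[OF that] w(2))
  show "n \<le> d" by (rule nd)
  show "\<exists>u. unitary_mat n u \<and> (\<forall>x\<in>S. \<phi> x = mat_adjoint u * \<psi> x * u)" if "d = n"
  proof -
    have "u = w" by (rule eq_matI) (use U w uw that in auto)
    then show ?thesis using u comp that by auto
  qed
  show "\<exists>\<rho>\<in>UCP S (d - n). \<exists>u. unitary_mat d u \<and>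
      (\<forall>x\<in>S. \<psi> x = mat_adjoint u * direct_sum_mat (\<phi> x) (\<rho> x) * u)" if lt: "n < d"
  proof -
    define w2 where "w2 = mat d (d - n) (\<lambda>(i, j). u $$ (i, j + n))"
    have w2: "w2 \<in> carrier_mat d (d - n)" by (simp add: w2_def)
    have w2i: "w2 $$ (l, j) = u $$ (l, j + n)" if "l < d" "j < d - n" for l j
      using that by (simp add: w2_def)
    have w2a: "mat_adjoint w2 \<in> carrier_mat (d - n) d" using w2 by simp
    have uu: "(\<Sum>l<d. cnj (u $$ (l, i)) * u $$ (l, j)) = (if i = j then 1 else 0)" if "i < d" "j < d" for i j
      using index_adjoint_mult[OF U(1) U(1) that] that by (simp add: U(2))
    have "mat_adjoint w2 * w2 = 1\<^sub>m (d - n)"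
      by (rule eq_matI) (use w2 in \<open>auto simp: index_adjoint_mult[OF w2 w2] w2i uu simp del: index_mult_mat(1)\<close>)
    then have \<rho>: "(\<lambda>a. mat_adjoint w2 * \<psi> a * w2) \<in> UCP S (d - n)" by (rule sandwich_UCP[OF S \<psi> w2])
    have ww2: "mat_adjoint w2 * w = 0\<^sub>m (d - n) n"
      by (rule eq_matI) (use w w2 lt in \<open>auto simp: index_adjoint_mult[OF w2 w(1)] w2i uw[symmetric] uu simp del: index_mult_mat(1)\<close>)
    have ww2': "mat_adjoint w * w2 = 0\<^sub>m n (d - n)"
      by (rule eq_matI) (use w w2 lt in \<open>auto simp: index_adjoint_mult[OF w(1) w2] w2i uw[symmetric] uu simp del: index_mult_mat(1)\<close>)
    have "\<psi> x = mat_adjoint (mat_adjoint u) * direct_sum_mat (\<phi> x) (mat_adjoint w2 * \<psi> x * w2) * mat_adjoint u" if x: "x \<in> S" for x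
    proof -
      have off1: "mat_adjoint w2 * \<psi> x * w = 0\<^sub>m (d - n) n"
        using assoc_mult_mat[OF w2a c(2)[OF x] w(1)] assoc_mult_mat[OF w2a w(1) c(1)[OF x]] c(1)[OF x]
        by (simp add: int[OF x] ww2)
      have sx: "star x \<in> S" using operator_systemD(6)[OF S x] .
      have "mat_adjoint w * \<psi> x = mat_adjoint (\<psi> (star x) * w)"
        using mat_adjoint_mult[OF c(2)[OF sx] w(1)] UCP_star[OF S \<psi> x] by simp
      also have "\<dots> = \<phi> x * mat_adjoint w"
        unfolding int[OF sx] using mat_adjoint_mult[OF w(1) c(1)[OF sx]] UCP_star[OF S \<phi> x] by simp
      finally have off2: "mat_adjoint w * \<psi> x * w2 = 0\<^sub>m n (d - n)"
        using assoc_mult_mat[OF c(1)[OF x] wa w2] c(1)[OF x] by (simp add: ww2')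
      have "mat_adjoint u * \<psi> x * u = direct_sum_mat (\<phi> x) (mat_adjoint w2 * \<psi> x * w2)" (is "?L = ?R")
      proof (rule eq_matI)
        show "dim_row ?L = dim_row ?R" "dim_col ?L = dim_col ?R"
          using U c[OF x] w2 lt by (auto simp: direct_sum_mat_def)
        fix i j assume "i < dim_row ?R" "j < dim_col ?R"
        then have ij: "i < d" "j < d" using c[OF x] w2 lt by (auto simp: direct_sum_mat_def)
        have L: "?L $$ (i, j) = (\<Sum>k<d. \<Sum>l<d. cnj (u $$ (k, i)) * \<psi> x $$ (k, l) * u $$ (l, j))"
          by (rule index_sandwich[OF U(1) c(2)[OF x] U(1) ij])
        have R: "?R $$ (i, j) = (if i < n then if j < n then \<phi> x $$ (i, j) else 0
            else if j < n then 0 else (mat_adjoint w2 * \<psi> x * w2) $$ (i - n, j - n))"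
          using ij c[OF x] w2 lt by (simp add: direct_sum_mat_def del: index_mult_mat(1))
        consider "i < n" "j < n" | "i < n" "\<not> j < n" | "\<not> i < n" "j < n" | "\<not> i < n" "\<not> j < n" by blast
        then show "?L $$ (i, j) = ?R $$ (i, j)"
        proof cases
          case 1
          have "?L $$ (i, j) = (mat_adjoint w * \<psi> x * w) $$ (i, j)"
            unfolding L index_sandwich[OF w(1) c(2)[OF x] w(1) 1] using 1 by (simp add: uw)
          then show ?thesis using 1 by (simp only: R comp[OF x] if_True)
        next
          case 2
          then have j: "j - n < d - n" using ij by simp
          have "?L $$ (i, j) = (mat_adjoint w * \<psi> x * w2) $$ (i, j - n)"
            unfolding L index_sandwich[OF w(1) c(2)[OF x] w2 2(1) j] using 2 j by (simp add: uw w2_def)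
          then show ?thesis using 2 j by (simp add: R off2)
        next
          case 3
          then have j: "i - n < d - n" using ij by simp
          have "?L $$ (i, j) = (mat_adjoint w2 * \<psi> x * w) $$ (i - n, j)"
            unfolding L index_sandwich[OF w2 c(2)[OF x] w(1) j 3(2)] using 3 j by (simp add: uw w2_def)
          then show ?thesis using 3 j by (simp add: R off1)
        next
          case 4
          then have j: "i - n < d - n" "j - n < d - n" using ij by auto
          have "?L $$ (i, j) = (mat_adjoint w2 * \<psi> x * w2) $$ (i - n, j - n)"
            unfolding L index_sandwich[OF w2 c(2)[OF x] w2 j] using 4 j by (simp add: w2_def)
          then show ?thesis using 4 by (simp only: R if_False)
        qed
      qed
      then have "u * direct_sum_mat (\<phi> x) (mat_adjoint w2 * \<psi> x * w2) * mat_adjoint u = u * (mat_adjoint u * \<psi> x * u) * mat_adjoint u"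
        by simp
      also have "\<dots> = (u * mat_adjoint u) * \<psi> x * (u * mat_adjoint u)"
        using U(1) c(2)[OF x] mat_adjoint_carrier[OF U(1)]
        by (simp add: assoc_mult_mat[of _ d d _ d _ d] mult_carrier_mat[of _ d d])
      also have "\<dots> = \<psi> x" using U c(2)[OF x] by simp
      finally show ?thesis by simp
    qed
    moreover have "unitary_mat d (mat_adjoint u)" using U by (simp add: unitary_mat_def)
    ultimately show ?thesis
      by (intro bexI[OF _ \<rho>] exI[of _ "mat_adjoint u"]) simp
  qed
qed

text \<open>The unique extension property provides some multiplicative extension, not
  \<open>\<pi>\<close> itself. That extension is a star representation agreeing with
  \<open>\<pi>\<close> on \<open>S\<close>, hence equal to it on the generated algebra, and
  uniqueness passes to \<open>\<pi>\<close>.\<close>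

lemma boundary_representation_restriction:
  assumes "boundary_representation S n \<pi>"
  shows "irreducible_representation (generated_cstar S) n \<pi>"
    and "\<Psi> \<in> UCP (generated_cstar S) n \<Longrightarrow> (\<And>x. x \<in> S \<Longrightarrow> \<Psi> x = \<pi> x) \<Longrightarrow> a \<in> generated_cstar S \<Longrightarrow> \<Psi> a = \<pi> a"
proof -
  show irr: "irreducible_representation (generated_cstar S) n \<pi>"
    using assms by (simp add: boundary_representation_def)
  then have rep: "star_representation (generated_cstar S) n \<pi>" by (simp add: irreducible_representation_def)
  obtain \<Phi> where \<Phi>: "\<Phi> \<in> UCP (generated_cstar S) n" "\<And>x. x \<in> S \<Longrightarrow> \<Phi> x = \<pi> x"
    and uniq: "\<And>\<Psi> a. \<Psi> \<in> UCP (generated_cstar S) n \<Longrightarrow> (\<forall>x\<in>S. \<Psi> x = \<pi> x) \<Longrightarrow> a \<in> generated_cstar S \<Longrightarrow> \<Psi> a = \<Phi> a"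
    and mult: "\<And>a b. a \<in> generated_cstar S \<Longrightarrow> b \<in> generated_cstar S \<Longrightarrow> \<Phi> (a * b) = \<Phi> a * \<Phi> b"
    using assms unfolding boundary_representation_def unique_extension_property_def by blast
  note Bs = unital_cstar_subalgebraD(1)[OF unital_cstar_subalgebra_generated[of S]]
  have "star_representation (generated_cstar S) n \<Phi>"
    using UCP_D[OF \<Phi>(1)] mult UCP_star[OF Bs \<Phi>(1)] by (simp add: star_representation_def)
  from star_representations_eq_on_generated[OF this rep \<Phi>(2)]
  show "\<Psi> a = \<pi> a" if "\<Psi> \<in> UCP (generated_cstar S) n" "\<And>x. x \<in> S \<Longrightarrow> \<Psi> x = \<pi> x" "a \<in> generated_cstar S"
    using uniq[OF that(1) _ that(3)] that by auto
qed

lemma boundary_representation_absolute_matrix_extreme: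
  assumes S: "operator_system S" and \<phi>: "\<phi> \<in> UCP S n"
    and bd: "boundary_representation S n \<pi>" and ext: "\<And>x. x \<in> S \<Longrightarrow> \<pi> x = \<phi> x"
  shows "absolute_matrix_extreme_point S n \<phi>"
  unfolding absolute_matrix_extreme_point_def
proof (intro conjI[OF \<phi>] allI impI)
  fix k d \<psi> \<gamma> i
  assume comb: "matrix_convex_combination S n \<phi> k d \<psi> \<gamma>" and i: "i < k"
  define B where "B = generated_cstar S"
  have B: "unital_cstar_subalgebra B" unfolding B_def by (rule unital_cstar_subalgebra_generated)
  note Bs = unital_cstar_subalgebraD(1)[OF B]
  note Bo = operator_systemD[OF Bs]
  have SB: "S \<subseteq> B" unfolding B_def by (rule subset_generated_cstar)
  have \<psi>: "\<And>i. i < k \<Longrightarrow> \<psi> i \<in> UCP S (d i)" and \<gamma>: "\<And>i. i < k \<Longrightarrow> \<gamma> i \<in> carrier_mat (d i) n"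
    and \<gamma>0: "\<And>i. i < k \<Longrightarrow> \<gamma> i \<noteq> 0\<^sub>m (d i) n"
    and one: "mat_sum n k (\<lambda>i. mat_adjoint (\<gamma> i) * \<gamma> i) = 1\<^sub>m n"
    and sum: "\<And>x. x \<in> S \<Longrightarrow> \<phi> x = mat_sum n k (\<lambda>i. mat_adjoint (\<gamma> i) * \<psi> i x * \<gamma> i)"
    using comb by (auto simp: matrix_convex_combination_def)
  have irr: "irreducible_representation B n \<pi>"
    using boundary_representation_restriction(1)[OF bd] by (simp add: B_def)
  then have rep: "star_representation B n \<pi>" by (simp add: irreducible_representation_def)
  have "\<exists>\<Psi>\<in>UCP B (d l). \<forall>x\<in>S. \<Psi> x = \<psi> l x" if "l < k" for l
    using Arveson_extension[OF S \<psi>[OF that]] UCP_subset[of _ UNIV] by (metis subset_UNIV)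
  then obtain \<Psi> where \<Psi>: "\<And>l. l < k \<Longrightarrow> \<Psi> l \<in> UCP B (d l)" "\<And>l x. l < k \<Longrightarrow> x \<in> S \<Longrightarrow> \<Psi> l x = \<psi> l x"
    by metis
  have "(\<lambda>a. mat_sum n k (\<lambda>i. mat_adjoint (\<gamma> i) * \<Psi> i a * \<gamma> i)) \<in> UCP B n"
    by (rule UCP_mat_sum[OF Bs \<Psi>(1) \<gamma> one])
  moreover have "mat_sum n k (\<lambda>i. mat_adjoint (\<gamma> i) * \<Psi> i x * \<gamma> i) = \<pi> x" if "x \<in> S" for x
    using that by (auto simp: ext sum \<Psi>(2) mat_sum_def intro!: cong_mat sum.cong)
  ultimately have eq: "mat_sum n k (\<lambda>i. mat_adjoint (\<gamma> i) * \<Psi> i a * \<gamma> i) = \<pi> a" if "a \<in> B" for a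
    using boundary_representation_restriction(2)[OF bd] that unfolding B_def by blast
  have int: "\<Psi> i a * \<gamma> i = \<gamma> i * \<pi> a" if "a \<in> B" for a
    by (rule multiplicative_combination_intertwines[OF B rep \<Psi>(1) \<gamma> one eq i that])
  note g = \<gamma>[OF i] and ga = mat_adjoint_carrier[OF \<gamma>[OF i]]
  have c: "\<pi> a \<in> carrier_mat n n" "\<Psi> i a \<in> carrier_mat (d i) (d i)" if "a \<in> B" for a
    using rep that linear_map_onD(1)[OF UCP_D(1)[OF \<Psi>(1)[OF i]]] by (auto simp: star_representation_def linear_map_on_def)
  have gg: "mat_adjoint (\<gamma> i) * \<gamma> i \<in> carrier_mat n n" using g ga by (rule mult_carrier_mat[rotated])
  \<comment> \<open>The adjoint of the intertwining relation at \<open>star a\<close> lets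
    \<open>\<pi> a\<close> pass through \<open>mat_adjoint (\<gamma> i)\<close>; both sides are then
    equal to \<open>mat_adjoint (\<gamma> i) * \<Psi> i a * \<gamma> i\<close>.\<close>
  have comm: "mat_adjoint (\<gamma> i) * \<gamma> i * \<pi> a = \<pi> a * (mat_adjoint (\<gamma> i) * \<gamma> i)" if a: "a \<in> B" for a
  proof -
    have "mat_adjoint (\<gamma> i) * \<Psi> i a = mat_adjoint (\<Psi> i (star a) * \<gamma> i)"
      using mat_adjoint_mult[OF c(2)[OF Bo(6)[OF a]] g] UCP_star[OF Bs \<Psi>(1)[OF i] a] by simp
    also have "\<dots> = \<pi> a * mat_adjoint (\<gamma> i)"
      unfolding int[OF Bo(6)[OF a]] using mat_adjoint_mult[OF g c(1)[OF Bo(6)[OF a]]] rep a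
      by (simp add: star_representation_def)
    finally have "\<pi> a * mat_adjoint (\<gamma> i) * \<gamma> i = mat_adjoint (\<gamma> i) * \<Psi> i a * \<gamma> i" by simp
    then show ?thesis
      using assoc_mult_mat[OF c(1)[OF a] ga g] assoc_mult_mat[OF ga c(2)[OF a] g] assoc_mult_mat[OF ga g c(1)[OF a]]
      by (simp add: int[OF a])
  qed
  obtain t where t: "mat_adjoint (\<gamma> i) * \<gamma> i = t \<cdot>\<^sub>m 1\<^sub>m n"
    by (rule irreducible_commutant[OF irr gg comm])
  \<comment> \<open>The scalar is the squared norm of every column of \<open>\<gamma> i\<close>. It
    is therefore real, and a nonzero entry makes it positive, so that \<open>\<gamma> i\<close> can
    be divided by its square root.\<close>
  have tj: "t = of_real (\<Sum>l<d i. (cmod (\<gamma> i $$ (l, j)))\<^sup>2)" if j: "j < n" for j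
  proof -
    have "t = (mat_adjoint (\<gamma> i) * \<gamma> i) $$ (j, j)" using t j by simp
    also have "\<dots> = (\<Sum>l<d i. cnj (\<gamma> i $$ (l, j)) * \<gamma> i $$ (l, j))" by (rule index_adjoint_mult[OF g g j j])
    also have "\<dots> = of_real (\<Sum>l<d i. (cmod (\<gamma> i $$ (l, j)))\<^sup>2)"
      unfolding of_real_sum by (intro sum.cong refl) (metis complex_norm_square mult.commute)
    finally show ?thesis .
  qed
  obtain l j where lj: "l < d i" "j < n" "\<gamma> i $$ (l, j) \<noteq> 0"
  proof -
    have "\<exists>l j. l < d i \<and> j < n \<and> \<gamma> i $$ (l, j) \<noteq> 0"
    proof (rule ccontr)
      assume "\<not> ?thesis"
      then have "\<gamma> i = 0\<^sub>m (d i) n" using g by (intro eq_matI) auto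
      then show False using \<gamma>0[OF i] by simp
    qed
    then show thesis using that by blast
  qed
  define s where "s = (\<Sum>l<d i. (cmod (\<gamma> i $$ (l, j)))\<^sup>2)"
  have "0 < (cmod (\<gamma> i $$ (l, j)))\<^sup>2" using lj by simp
  also have "\<dots> \<le> s" unfolding s_def by (rule member_le_sum) (use lj in auto)
  finally have s: "0 < s" "t = of_real s" using tj[OF lj(2)] by (auto simp: s_def)
  define c0 where "c0 = complex_of_real (1 / sqrt s)"
  have cc: "cnj c0 * c0 * t = 1" using s by (simp add: c0_def flip: of_real_mult)
  define w where "w = c0 \<cdot>\<^sub>m \<gamma> i"
  have w: "w \<in> carrier_mat (d i) n" using g by (simp add: w_def)
  have "mat_adjoint w * w = 1\<^sub>m n"
  proof (rule eq_matI)
    fix a b assume "a < dim_row (1\<^sub>m n :: complex mat)" "b < dim_col (1\<^sub>m n :: complex mat)"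
    then have ab: "a < n" "b < n" by auto
    have "(mat_adjoint w * w) $$ (a, b) = cnj c0 * c0 * (mat_adjoint (\<gamma> i) * \<gamma> i) $$ (a, b)"
      unfolding index_adjoint_mult[OF w w ab] index_adjoint_mult[OF g g ab]
      using g ab by (simp add: w_def sum_distrib_left mult_ac)
    then show "(mat_adjoint w * w) $$ (a, b) = 1\<^sub>m n $$ (a, b)"
      using ab cc by (simp add: t mult.assoc del: index_mult_mat(1))
  qed (use w in auto)
  moreover have "\<psi> i x * w = w * \<phi> x" if x: "x \<in> S" for x
  proof -
    have xB: "x \<in> B" using SB x by blast
    have "\<psi> i x * w = c0 \<cdot>\<^sub>m (\<Psi> i x * \<gamma> i)"
      unfolding w_def \<Psi>(2)[OF i x, symmetric] by (rule mult_smult_distrib[OF c(2)[OF xB] g])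
    also have "\<dots> = w * \<phi> x"
      unfolding w_def int[OF xB] ext[OF x, symmetric] by (rule mult_smult_assoc_mat[OF g c(1)[OF xB], symmetric])
    finally show ?thesis .
  qed
  ultimately show "(d i \<le> n \<longrightarrow> d i = n \<and>
      (\<exists>u. unitary_mat n u \<and> (\<forall>x\<in>S. \<phi> x = mat_adjoint u * \<psi> i x * u))) \<and>
    (n < d i \<longrightarrow> (\<exists>\<rho>\<in>UCP S (d i - n). \<exists>u. unitary_mat (d i) u \<and>
      (\<forall>x\<in>S. \<psi> i x = mat_adjoint u * direct_sum_mat (\<phi> x) (\<rho> x) * u)))"
    using intertwining_isometry_summand[OF S \<phi> \<psi>[OF i] w] by (metis antisym)
qed

section \<open>Absolute matrix extreme points extend to boundary representations\<close>

text \<open>Compare traces and Frobenius norms of the two unitarily equivalent matrices.\<close>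

lemma dilation_by_one_trivial:
  assumes u: "unitary_mat (Suc n) u" and P: "P \<in> carrier_mat n n" and Q: "Q \<in> carrier_mat 1 1"
    and A: "A = mat_adjoint u * direct_sum_mat P Q * u"
    and corner: "\<And>i j. i < n \<Longrightarrow> j < n \<Longrightarrow> A $$ (i, j) = P $$ (i, j)" and i: "i < n"
  shows "A $$ (i, n) = 0"
proof -
  define C where "C = direct_sum_mat P Q"
  have C: "C \<in> carrier_mat (Suc n) (Suc n)" using P Q by (intro carrier_matI) (auto simp: C_def direct_sum_mat_def)
  have Ci: "i < n \<Longrightarrow> j < n \<Longrightarrow> C $$ (i, j) = P $$ (i, j)" "i < n \<Longrightarrow> C $$ (i, n) = 0"
    "j < n \<Longrightarrow> C $$ (n, j) = 0" for i j
    using P Q by (auto simp: C_def direct_sum_mat_def)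
  note U = unitary_matD(1)[OF u]
  have Ac: "A \<in> carrier_mat (Suc n) (Suc n)"
    unfolding A C_def[symmetric] using U C by (meson mat_adjoint_carrier mult_carrier_mat)
  have "mat_trace A = mat_trace C" unfolding A C_def[symmetric] by (rule mat_trace_conjugate[OF u C])
  then have nn: "A $$ (n, n) = C $$ (n, n)" using Ac C by (simp add: mat_trace_def corner Ci)
  have "(\<Sum>j<Suc n. \<Sum>i<Suc n. (cmod (A $$ (i, j)))\<^sup>2) = (\<Sum>j<Suc n. \<Sum>i<Suc n. (cmod (C $$ (i, j)))\<^sup>2)"
    unfolding A C_def[symmetric] by (rule frobenius_conjugate[OF u C])
  \<comment> \<open>The corner and the last diagonal entry cancel, and the rest of the last row and
    column of \<open>C\<close> is zero; only the last row and column of \<open>A\<close>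
    remain.\<close>
  then have "(\<Sum>j<n. (cmod (A $$ (n, j)))\<^sup>2) + (\<Sum>i<n. (cmod (A $$ (i, n)))\<^sup>2) = 0"
    by (simp add: corner Ci nn sum.distrib)
  then have "(\<Sum>i<n. (cmod (A $$ (i, n)))\<^sup>2) = 0"
    by (smt (verit) sum_nonneg zero_le_power2)
  then show ?thesis using i by (subst (asm) sum_nonneg_eq_0_iff) auto
qed

lemma absolute_matrix_extreme_pointD:
  assumes "absolute_matrix_extreme_point S n \<phi>"
    and comb: "matrix_convex_combination S n \<phi> k d \<psi> \<gamma>" and i: "i < k"
  shows "d i \<le> n \<Longrightarrow> d i = n"
    and "n < d i \<Longrightarrow> \<exists>\<rho>\<in>UCP S (d i - n). \<exists>u. unitary_mat (d i) u \<and>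
      (\<forall>x\<in>S. \<psi> i x = mat_adjoint u * direct_sum_mat (\<phi> x) (\<rho> x) * u)"
proof -
  note * = assms(1)[unfolded absolute_matrix_extreme_point_def, THEN conjunct2, THEN spec[of _ k],
      THEN spec[of _ d], THEN spec[of _ \<psi>], THEN spec[of _ \<gamma>], THEN mp, OF comb, THEN spec[of _ i], THEN mp, OF i]
  show "d i \<le> n \<Longrightarrow> d i = n" using *[THEN conjunct1] by simp
  show "n < d i \<Longrightarrow> \<exists>\<rho>\<in>UCP S (d i - n). \<exists>u. unitary_mat (d i) u \<and>
      (\<forall>x\<in>S. \<psi> i x = mat_adjoint u * direct_sum_mat (\<phi> x) (\<rho> x) * u)"
    by (rule *[THEN conjunct2, THEN mp])
qed

text \<open>A dilation \<open>\<psi>\<close> exhibits \<open>\<phi>\<close> as a one-term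
  combination whose coefficient \<open>g\<close> is the inclusion of the first \<open>n\<close>
  coordinates. The clause for larger sizes applies with a complement of size 1, so
  \<open>\<psi> x\<close> is unitarily equivalent to a direct sum with the same corner.\<close>

lemma absolute_matrix_extreme_dilation:
  assumes abs: "absolute_matrix_extreme_point S n \<phi>" and n: "1 \<le> n" and \<psi>: "\<psi> \<in> UCP S (Suc n)"
    and corner: "\<And>x i j. x \<in> S \<Longrightarrow> i < n \<Longrightarrow> j < n \<Longrightarrow> \<psi> x $$ (i, j) = \<phi> x $$ (i, j)"
    and x: "x \<in> S" and i: "i < n"
  shows "\<psi> x $$ (i, n) = 0"
proof -
  have \<phi>: "\<phi> \<in> UCP S n" using abs by (simp add: absolute_matrix_extreme_point_def)
  have c: "\<phi> x \<in> carrier_mat n n" "\<psi> x \<in> carrier_mat (Suc n) (Suc n)" if "x \<in> S" for x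
    using linear_map_onD(1)[OF UCP_D(1)[OF \<phi>] that] linear_map_onD(1)[OF UCP_D(1)[OF \<psi>] that] by auto
  define g :: "complex mat" where "g = mat (Suc n) n (\<lambda>(i, j). if i = j then 1 else 0)"
  have g: "g \<in> carrier_mat (Suc n) n" by (simp add: g_def)
  have gi: "g $$ (i, j) = (if i = j then 1 else 0)" if "i < Suc n" "j < n" for i j
    using that by (simp add: g_def)
  have one: "mat_adjoint g * g = 1\<^sub>m n"
  proof (rule eq_matI)
    fix i j assume "i < dim_row (1\<^sub>m n :: complex mat)" "j < dim_col (1\<^sub>m n :: complex mat)"
    then have ij: "i < n" "j < n" by auto
    have "(mat_adjoint g * g) $$ (i, j) = (\<Sum>l<Suc n. cnj (g $$ (l, i)) * (if l = j then 1 else 0))"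
      unfolding index_adjoint_mult[OF g g ij] by (intro sum.cong refl) (use ij in \<open>simp add: gi\<close>)
    also have "\<dots> = cnj (g $$ (j, i)) * 1" by (rule sum_mult_delta) (use ij in auto)
    finally show "(mat_adjoint g * g) $$ (i, j) = 1\<^sub>m n $$ (i, j)" using ij by (simp add: gi)
  qed (use g in auto)
  have comp: "mat_adjoint g * \<psi> x * g = \<phi> x" if x: "x \<in> S" for x
  proof (rule eq_matI)
    fix i j assume "i < dim_row (\<phi> x)" "j < dim_col (\<phi> x)"
    then have ij: "i < n" "j < n" using c[OF x] by auto
    have "(mat_adjoint g * \<psi> x * g) $$ (i, j) =
        (\<Sum>k<Suc n. (\<Sum>l<Suc n. \<psi> x $$ (k, l) * (if l = j then 1 else 0)) * (if k = i then 1 else 0))"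
      unfolding index_sandwich[OF g c(2)[OF x] g ij]
      by (intro sum.cong refl) (use ij in \<open>auto simp: gi sum_distrib_left intro!: sum.cong\<close>)
    also have "\<dots> = \<psi> x $$ (i, j)"
      using ij by (simp only: sum_mult_delta finite_lessThan lessThan_iff mult_1_right less_SucI)
    finally show "(mat_adjoint g * \<psi> x * g) $$ (i, j) = \<phi> x $$ (i, j)" using corner[OF x ij] by simp
  qed (use g c[OF x] in auto)
  have "g \<noteq> 0\<^sub>m (Suc n) n"
  proof
    assume "g = 0\<^sub>m (Suc n) n"
    then have "g $$ (0, 0) = 0" using n by simp
    then show False using n gi[of 0 0] by simp
  qed
  moreover have "mat_sum n 1 (\<lambda>_. X) = X" if "X \<in> carrier_mat n n" for X
    by (rule eq_matI) (use that in \<open>auto simp: mat_sum_def\<close>)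
  ultimately have comb: "matrix_convex_combination S n \<phi> 1 (\<lambda>_. Suc n) (\<lambda>_. \<psi>) (\<lambda>_. g)"
    using \<psi> g c(1) by (simp add: matrix_convex_combination_def one comp)
  obtain \<rho> u where \<rho>: "\<rho> \<in> UCP S (Suc n - n)" and u: "unitary_mat (Suc n) u"
    and eq: "\<And>x. x \<in> S \<Longrightarrow> \<psi> x = mat_adjoint u * direct_sum_mat (\<phi> x) (\<rho> x) * u"
    using absolute_matrix_extreme_pointD(2)[OF abs comb, of 0] by auto
  have "\<rho> x \<in> carrier_mat 1 1" using linear_map_onD(1)[OF UCP_D(1)[OF \<rho>] x] by simp
  from dilation_by_one_trivial[OF u c(1)[OF x] this eq[OF x] corner[OF x] i] show ?thesis by simp
qed

text \<open>If \<open>\<Phi>(a\<^sup>* a) \<noteq> \<Phi>(a)\<^sup>* \<Phi>(a)\<close> in the entry \<open>(j, j)\<close>, then the Stinespring vector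
  \<open>a \<otimes> e\<^sub>j - 1 \<otimes> \<Phi>(a) e\<^sub>j\<close> is nonzero and orthogonal to \<open>1 \<otimes> \<complex>\<^sup>n\<close>; adjoining it
  dilates \<open>\<phi>\<close> to dimension \<open>n + 1\<close> nontrivially.\<close>

lemma absolute_matrix_extreme_multiplicative:
  assumes S: "operator_system S" and n: "1 \<le> n" and abs: "absolute_matrix_extreme_point S n \<phi>"
    and \<Phi>: "\<Phi> \<in> UCP (generated_cstar S) n" and ext: "\<And>x. x \<in> S \<Longrightarrow> \<Phi> x = \<phi> x"
    and a: "a \<in> S" and j: "j < n"
  shows "\<Phi> (star a * a) $$ (j, j) = (mat_adjoint (\<Phi> a) * \<Phi> a) $$ (j, j)"
proof (rule ccontr)
  assume ne: "\<Phi> (star a * a) $$ (j, j) \<noteq> (mat_adjoint (\<Phi> a) * \<Phi> a) $$ (j, j)"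
  define B where "B = generated_cstar S"
  have B: "unital_cstar_subalgebra B" unfolding B_def by (rule unital_cstar_subalgebra_generated)
  note Bs = unital_cstar_subalgebraD(1)[OF B] and Bm = unital_cstar_subalgebraD(2)[OF B]
  note Bo = operator_systemD[OF Bs]
  have SB: "x \<in> S \<Longrightarrow> x \<in> B" for x using subset_generated_cstar by (auto simp: B_def)
  note \<Phi>B = \<Phi>[folded B_def]
  note L = UCP_D(1)[OF \<Phi>B]
  have aB: "a \<in> B" using SB a .
  have car: "\<Phi> b \<in> carrier_mat n n" if "b \<in> B" for b using linear_map_onD(1)[OF L that] .
  \<comment> \<open>The squared norm of the Stinespring vector to be adjoined; \<open>c\<close>
    below is the reciprocal of its square root.\<close>
  define \<eta> where "\<eta> = \<Phi> (star a * a) $$ (j, j) - (mat_adjoint (\<Phi> a) * \<Phi> a) $$ (j, j)"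
  have "0 \<le> \<eta>"
  proof -
    have "(mat_adjoint (1\<^sub>m n) * (mat_adjoint (\<Phi> a) * \<Phi> a) * 1\<^sub>m n) $$ (j, j) \<le> (mat_adjoint (1\<^sub>m n) * \<Phi> (star a * a) * 1\<^sub>m n) $$ (j, j)"
      by (rule UCP_Schwarz_sandwich[OF B \<Phi>B _ aB j]) simp
    then show ?thesis using car[OF aB] car[OF Bm[OF Bo(6)[OF aB] aB]]
      by (simp add: \<eta>_def left_mult_one_mat[of _ n n] right_mult_one_mat[of _ n n] mult_carrier_mat[of _ n n] less_eq_complex_def del: index_mult_mat(1))
  qed
  then have \<eta>: "0 < Re \<eta>" "\<eta> = of_real (Re \<eta>)"
    using ne by (auto simp: \<eta>_def less_eq_complex_def complex_eq_iff simp del: index_mult_mat(1))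
  define c where "c = complex_of_real (1 / sqrt (Re \<eta>))"
  have c: "cnj c = c" "c * c * \<eta> = 1" "c \<noteq> 0"
    using \<eta>(1) by (auto simp: c_def simp flip: of_real_mult) (subst \<eta>(2), simp flip: of_real_mult)
  \<comment> \<open>Index 0 stands for the unit and index 1 for \<open>a\<close>. The columns of
    \<open>R\<close> below \<open>n\<close> encode the vectors
    \<open>1 \<otimes> e\<^sub>\<alpha>\<close>, and column \<open>n\<close> encodes the normalised
    vector built from \<open>a \<otimes> e\<^sub>j\<close> and
    \<open>1 \<otimes> \<Phi>(a) e\<^sub>j\<close>.\<close>
  define y where "y r = (if r = (0::nat) then 1 else a)" for r
  define R where "R r i \<alpha> = (if r = (0::nat) then (if \<alpha> < n then (if i = \<alpha> then 1 else 0) else - c * \<Phi> a $$ (i, j))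
      else (if \<alpha> < n then 0 else (if i = j then c else 0)))" for r i \<alpha> :: nat
  define \<psi> where "\<psi> = compression \<Phi> n (Suc n) 2 y R"
  have yB: "star (y r) * s * y r' \<in> B" if "s \<in> S" for r r' s
    using SB[OF that] aB Bo(1,6) Bm by (simp add: y_def)
  have lin: "linear_map_on S (Suc n) \<psi>" and cp: "completely_positive S (Suc n) \<psi>"
    unfolding \<psi>_def using compression_linear_cp[OF S Bs L UCP_D(3)[OF \<Phi>B] yB] by auto
  define bil where "bil X p q = (\<Sum>i<n. \<Sum>k<n. cnj (p i) * X $$ (i, k) * q k)" for X and p q :: "nat \<Rightarrow> complex"
  have \<psi>i: "\<psi> s $$ (\<alpha>, \<beta>) = bil (\<Phi> s) (\<lambda>i. R 0 i \<alpha>) (\<lambda>i. R 0 i \<beta>) + bil (\<Phi> (s * a)) (\<lambda>i. R 0 i \<alpha>) (\<lambda>i. R (Suc 0) i \<beta>)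
      + (bil (\<Phi> (star a * s)) (\<lambda>i. R (Suc 0) i \<alpha>) (\<lambda>i. R 0 i \<beta>) + bil (\<Phi> (star a * s * a)) (\<lambda>i. R (Suc 0) i \<alpha>) (\<lambda>i. R (Suc 0) i \<beta>))"
    if "\<alpha> < Suc n" "\<beta> < Suc n" for s \<alpha> \<beta>
    using that by (simp add: \<psi>_def compression_def bil_def y_def numeral_2_eq_2)
  have delta_left: "bil X (\<lambda>i. if i = \<alpha> then d else 0) q = cnj d * (\<Sum>k<n. X $$ (\<alpha>, k) * q k)" if "\<alpha> < n" for X d q \<alpha>
  proof -
    have "bil X (\<lambda>i. if i = \<alpha> then d else 0) q = (\<Sum>i<n. (\<Sum>k<n. X $$ (i, k) * q k) * (if i = \<alpha> then cnj d else 0))"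
      unfolding bil_def by (intro sum.cong refl) (auto simp: sum_distrib_left mult_ac)
    also have "\<dots> = (\<Sum>k<n. X $$ (\<alpha>, k) * q k) * cnj d"
      using that by (intro sum_mult_delta) auto
    finally show ?thesis by (simp only: mult.commute)
  qed
  have zero: "bil X (\<lambda>i. 0) q = 0" "bil X p (\<lambda>i. 0) = 0" for X p q by (simp_all add: bil_def)
  have Rl: "(\<lambda>i. R 0 i \<alpha>) = (\<lambda>i. if i = \<alpha> then 1 else 0)" "(\<lambda>i. R (Suc 0) i \<alpha>) = (\<lambda>i. 0)" if "\<alpha> < n" for \<alpha>
    using that by (auto simp: R_def)
  have Rn: "(\<lambda>i. R 0 i n) = (\<lambda>i. - c * \<Phi> a $$ (i, j))" "(\<lambda>i. R (Suc 0) i n) = (\<lambda>i. if i = j then c else 0)"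
    by (auto simp: R_def)
  have sumd: "(\<Sum>k<n. X $$ (\<alpha>, k) * (if k = \<beta> then d else 0)) = X $$ (\<alpha>, \<beta>) * d" if "\<beta> < n" for X :: "complex mat" and \<alpha> \<beta> d
    using that by (intro sum_mult_delta) auto
  have corner: "\<psi> s $$ (\<alpha>, \<beta>) = \<Phi> s $$ (\<alpha>, \<beta>)" if "\<alpha> < n" "\<beta> < n" for s \<alpha> \<beta>
    using that by (simp add: \<psi>i Rl[OF that(1)] Rl[OF that(2)] zero delta_left sumd)
  have off: "\<psi> s $$ (\<alpha>, n) = c * (\<Phi> (s * a) $$ (\<alpha>, j) - (\<Phi> s * \<Phi> a) $$ (\<alpha>, j))" if "\<alpha> < n" "s \<in> S" for s \<alpha>
  proof -
    have "(\<Sum>k<n. \<Phi> s $$ (\<alpha>, k) * (- c * \<Phi> a $$ (k, j))) = - c * (\<Phi> s * \<Phi> a) $$ (\<alpha>, j)"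
      unfolding index_mult[OF car[OF SB[OF that(2)]] car[OF aB] that(1) j] by (simp add: sum_distrib_left sum_negf mult_ac)
    then have "\<psi> s $$ (\<alpha>, n) = - c * (\<Phi> s * \<Phi> a) $$ (\<alpha>, j) + \<Phi> (s * a) $$ (\<alpha>, j) * c"
      using that j by (simp add: \<psi>i Rl[OF that(1)] Rn zero delta_left sumd del: index_mult_mat(1))
    then show ?thesis by (simp only: algebra_simps) simp
  qed
  have star1: "\<Phi> (star a) $$ (i, k) = cnj (\<Phi> a $$ (k, i))" if "i < n" "k < n" for i k
    using UCP_star[OF Bs \<Phi>B aB] car[OF aB] that by simp
  \<comment> \<open>Unitality expresses orthonormality of the \<open>n + 1\<close> vectors: the
    mixed entries vanish by orthogonality, and the last entry is 1 by the choice of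
    \<open>c\<close>.\<close>
  have "\<psi> 1 = 1\<^sub>m (Suc n)"
  proof (rule eq_matI)
    show "dim_row (\<psi> 1) = dim_row (1\<^sub>m (Suc n) :: complex mat)" "dim_col (\<psi> 1) = dim_col (1\<^sub>m (Suc n) :: complex mat)"
      by (auto simp: \<psi>_def compression_def)
    fix \<alpha> \<beta> assume "\<alpha> < dim_row (1\<^sub>m (Suc n) :: complex mat)" "\<beta> < dim_col (1\<^sub>m (Suc n) :: complex mat)"
    then have \<alpha>\<beta>: "\<alpha> < Suc n" "\<beta> < Suc n" by auto
    have one_left: "bil (1\<^sub>m n) p q = (\<Sum>k<n. cnj (p k) * q k)" for p q
      unfolding bil_def
    proof (intro sum.cong refl)
      fix i assume "i \<in> {..<n}"
      then have "(\<Sum>k<n. cnj (p i) * 1\<^sub>m n $$ (i, k) * q k) = (\<Sum>k<n. (cnj (p i) * q k) * (if k = i then 1 else 0))"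
        by (intro sum.cong refl) auto
      then show "(\<Sum>k<n. cnj (p i) * 1\<^sub>m n $$ (i, k) * q k) = cnj (p i) * q i"
        using \<open>i \<in> {..<n}\<close> by (simp only: sum_mult_delta finite_lessThan mult_1_right)
    qed
    have n1: "\<psi> 1 $$ (n, \<beta>) = 0" if "\<beta> < n" for \<beta>
    proof -
      have "bil (1\<^sub>m n) (\<lambda>i. - c * \<Phi> a $$ (i, j)) (\<lambda>i. if i = \<beta> then 1 else 0) = - c * cnj (\<Phi> a $$ (\<beta>, j))"
        unfolding one_left using that sum_mult_delta[of "{..<n}" \<beta> "\<lambda>k. cnj (- c * \<Phi> a $$ (k, j))" 1] by (simp add: c)
      then show ?thesis
        using that j by (simp add: \<psi>i Rl[OF that] Rn zero delta_left sumd UCP_D(2)[OF \<Phi>B] star1[OF j that] c)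
    qed
    have n2: "\<psi> 1 $$ (\<alpha>, n) = 0" if "\<alpha> < n" for \<alpha>
      using off[OF that operator_systemD(1)[OF S]] car[OF aB] by (simp add: UCP_D(2)[OF \<Phi>B] del: index_mult_mat(1))
    have n3: "\<psi> 1 $$ (n, n) = 1"
    proof -
      define G where "G = (\<Sum>k<n. cnj (\<Phi> a $$ (k, j)) * \<Phi> a $$ (k, j))"
      have G: "(mat_adjoint (\<Phi> a) * \<Phi> a) $$ (j, j) = G"
        unfolding G_def by (rule index_adjoint_mult[OF car[OF aB] car[OF aB] j j])
      have b1: "bil (1\<^sub>m n) (\<lambda>i. - c * \<Phi> a $$ (i, j)) (\<lambda>i. - c * \<Phi> a $$ (i, j)) = c * c * G"
        unfolding one_left G_def by (simp add: c sum_distrib_left mult_ac)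
      have b2: "bil (\<Phi> a) (\<lambda>i. - c * \<Phi> a $$ (i, j)) (\<lambda>i. if i = j then c else 0) = - (c * c * G)"
      proof -
        have "bil (\<Phi> a) (\<lambda>i. - c * \<Phi> a $$ (i, j)) (\<lambda>i. if i = j then c else 0) =
          (\<Sum>i<n. cnj (- c * \<Phi> a $$ (i, j)) * (\<Sum>k<n. \<Phi> a $$ (i, k) * (if k = j then c else 0)))"
          unfolding bil_def by (simp only: sum_distrib_left mult.assoc)
        also have "\<dots> = - (c * c * G)"
          unfolding sumd[OF j] G_def by (simp add: c sum_distrib_left sum_negf mult_ac)
        finally show ?thesis .
      qed
      have b3: "cnj c * (\<Sum>k<n. \<Phi> (star a) $$ (j, k) * (- c * \<Phi> a $$ (k, j))) = - (c * c * G)"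
        unfolding G_def by (simp add: c star1 j sum_distrib_left sum_negf mult_ac)
      have "\<psi> 1 $$ (n, n) = c * c * G - c * c * G + (- (c * c * G) + cnj c * (\<Phi> (star a * a) $$ (j, j) * c))"
        using j b1 b2 b3 by (simp add: \<psi>i Rn delta_left sumd UCP_D(2)[OF \<Phi>B])
      also have "\<dots> = c * c * (\<Phi> (star a * a) $$ (j, j) - G)" by (simp add: c algebra_simps)
      also have "\<dots> = 1" using c(2) by (simp only: \<eta>_def G)
      finally show ?thesis .
    qed
    consider "\<alpha> < n" "\<beta> < n" | "\<alpha> < n" "\<beta> = n" | "\<alpha> = n" "\<beta> < n" | "\<alpha> = n" "\<beta> = n" using \<alpha>\<beta> by linarith
    then show "\<psi> 1 $$ (\<alpha>, \<beta>) = 1\<^sub>m (Suc n) $$ (\<alpha>, \<beta>)"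
      by cases (simp_all add: corner UCP_D(2)[OF \<Phi>B] n1 n2 n3)
  qed
  then have "\<psi> \<in> UCP S (Suc n)" using lin cp by (simp add: UCP_def)
  \<comment> \<open>At the element \<open>star a\<close>, which lies in \<open>S\<close>, the
    off-diagonal entry in row \<open>j\<close> is \<open>c * \<eta>\<close>, the defect
    itself.\<close>
  from absolute_matrix_extreme_dilation[OF abs n this _ operator_systemD(6)[OF S a] j]
  have "\<psi> (star a) $$ (j, n) = 0" using corner ext by simp
  then have "\<Phi> (star a * a) $$ (j, j) = (\<Phi> (star a) * \<Phi> a) $$ (j, j)"
    using c(3) by (simp add: off[OF j operator_systemD(6)[OF S a]] del: index_mult_mat(1))
  then show False using ne UCP_star[OF Bs \<Phi>B aB] by simp
qed

text \<open>The extension is arbitrary on purpose: the statement yields multiplicativity of one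
  extension and, used for two of them, uniqueness.\<close>

lemma absolute_matrix_extreme_star_representation:
  assumes S: "operator_system S" and n: "1 \<le> n" and abs: "absolute_matrix_extreme_point S n \<phi>"
    and \<Phi>: "\<Phi> \<in> UCP (generated_cstar S) n" and ext: "\<And>x. x \<in> S \<Longrightarrow> \<Phi> x = \<phi> x"
  shows "star_representation (generated_cstar S) n \<Phi>"
proof -
  have "\<Phi> (a * b) = \<Phi> a * \<Phi> b" if "a \<in> generated_cstar S" "b \<in> generated_cstar S" for a b
    by (rule UCP_multiplicative_on_generated[OF S \<Phi> _ that])
      (rule absolute_matrix_extreme_multiplicative[OF S n abs \<Phi> ext])
  then show ?thesis
    using UCP_D[OF \<Phi>] UCP_star[OF unital_cstar_subalgebraD(1)[OF unital_cstar_subalgebra_generated] \<Phi>]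
    by (simp add: star_representation_def)
qed

text \<open>An invariant subspace of dimension \<open>M < n\<close> would split off a compression of size \<open>M\<close>.\<close>

lemma absolute_matrix_extreme_irreducible:
  assumes S: "operator_system S" and n: "1 \<le> n" and abs: "absolute_matrix_extreme_point S n \<phi>"
    and \<pi>: "star_representation (generated_cstar S) n \<pi>" and ext: "\<And>x. x \<in> S \<Longrightarrow> \<pi> x = \<phi> x"
  shows "irreducible_representation (generated_cstar S) n \<pi>"
  unfolding irreducible_representation_def
proof (intro conjI \<pi> allI impI)
  show "0 < n" using n by simp
  fix W
  assume W: "W \<subseteq> carrier_vec n \<and> 0\<^sub>v n \<in> W \<and> (\<forall>v\<in>W. \<forall>w\<in>W. v + w \<in> W) \<and>
    (\<forall>c. \<forall>v\<in>W. c \<cdot>\<^sub>v v \<in> W) \<and> (\<forall>a\<in>generated_cstar S. \<forall>v\<in>W. \<pi> a *\<^sub>v v \<in> W)"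
  show "W = {0\<^sub>v n} \<or> W = carrier_vec n"
  proof (rule ccontr)
    assume no: "\<not> (W = {0\<^sub>v n} \<or> W = carrier_vec n)"
    have \<phi>: "\<phi> \<in> UCP S n" using abs by (simp add: absolute_matrix_extreme_point_def)
    have c: "\<phi> x \<in> carrier_mat n n" if "x \<in> S" for x
      using linear_map_onD(1)[OF UCP_D(1)[OF \<phi>] that] .
    have sub: "subspace_vec n W" using W by (auto simp: subspace_vec_def)
    \<comment> \<open>Starting from the empty isometry, the columns of \<open>w\<close> become an
      orthonormal basis of \<open>W\<close>, and \<open>P\<close> below is the orthogonal projection
      onto \<open>W\<close>.\<close>
    obtain M w where w: "w \<in> carrier_mat n M" "mat_adjoint w * w = 1\<^sub>m M"
      and ran: "\<And>x. x \<in> carrier_vec M \<Longrightarrow> w *\<^sub>v x \<in> W"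
      and w_fix: "\<And>v. v \<in> W \<Longrightarrow> w *\<^sub>v (mat_adjoint w *\<^sub>v v) = v"
    proof (rule isometry_extend_to_subspace[OF sub, of "0\<^sub>m n 0" 0])
      show "mat_adjoint (0\<^sub>m n 0) * 0\<^sub>m n 0 = (1\<^sub>m 0 :: complex mat)" by (rule eq_matI) auto
      show "0\<^sub>m n 0 *\<^sub>v x \<in> W" if "x \<in> carrier_vec 0" for x
      proof -
        have "0\<^sub>m n 0 *\<^sub>v x = 0\<^sub>v n" using that by (intro eq_vecI) (auto simp: scalar_prod_def)
        then show ?thesis using W by simp
      qed
    qed (use that in auto)
    note wa = mat_adjoint_carrier[OF w(1)]
    define P where "P = w * mat_adjoint w"
    have P: "P \<in> carrier_mat n n" using w(1) by (simp add: P_def)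
    have Pv: "P *\<^sub>v v = w *\<^sub>v (mat_adjoint w *\<^sub>v v)" if "v \<in> carrier_vec n" for v
      unfolding P_def by (rule assoc_mult_mat_vec[OF w(1) wa that])
    have PW: "P *\<^sub>v v \<in> W" if "v \<in> carrier_vec n" for v
      unfolding Pv[OF that] by (rule ran) (use wa that in \<open>rule mult_mat_vec_carrier\<close>)
    have M0: "0 < M"
    proof (rule ccontr)
      assume "\<not> 0 < M"
      then have "M = 0" by simp
      have "v = 0\<^sub>v n" if v: "v \<in> W" for v
      proof -
        have "w *\<^sub>v (mat_adjoint w *\<^sub>v v) = 0\<^sub>v n"
          using w(1) \<open>M = 0\<close> by (intro eq_vecI) (auto simp: scalar_prod_def)
        then show ?thesis using w_fix[OF v] by simp
      qed
      then show False using no W by blast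
    qed
    have P1: "P \<noteq> 1\<^sub>m n"
    proof
      assume "P = 1\<^sub>m n"
      then have "v \<in> W" if "v \<in> carrier_vec n" for v using PW[OF that] that by simp
      then show False using no W by blast
    qed
    have Mn: "M < n"
    proof -
      have "M \<noteq> n"
      proof
        assume "M = n"
        then have "P = 1\<^sub>m n" unfolding P_def using mat_mult_left_right_inverse[of "mat_adjoint w" n w] w wa by simp
        then show False using P1 by simp
      qed
      then show ?thesis using isometry_dim_le[OF w] by simp
    qed
    have Pa: "mat_adjoint P = P" unfolding P_def using mat_adjoint_mult[OF w(1) wa] by simp
    have PP: "P * P = P"
    proof -
      have "P * P = w * (mat_adjoint w * w) * mat_adjoint w"
        unfolding P_def using assoc_mult_mat[OF w(1) wa, of "w * mat_adjoint w" n] assoc_mult_mat[OF wa w(1) wa]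
          assoc_mult_mat[OF w(1) mult_carrier_mat[OF wa w(1)] wa] w(1) by simp
      then show ?thesis using w by (simp add: P_def)
    qed
    have PxP: "P * (\<phi> x * P) = \<phi> x * P" if x: "x \<in> S" for x
    proof (rule mat_eq_on_vecI)
      show "P * (\<phi> x * P) \<in> carrier_mat n n" "\<phi> x * P \<in> carrier_mat n n" using P c[OF x] by auto
      fix v :: "complex vec" assume v: "v \<in> carrier_vec n"
      have xW: "\<phi> x *\<^sub>v (P *\<^sub>v v) \<in> W" 
        using W PW[OF v] subset_generated_cstar[of S] x ext[OF x] by (metis subsetD)
      then have xc: "\<phi> x *\<^sub>v (P *\<^sub>v v) \<in> carrier_vec n" using W by blast
      have "P * (\<phi> x * P) *\<^sub>v v = P *\<^sub>v (\<phi> x *\<^sub>v (P *\<^sub>v v))"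
        using assoc_mult_mat_vec[OF P mult_carrier_mat[OF c[OF x] P] v] assoc_mult_mat_vec[OF c[OF x] P v] by simp
      also have "\<dots> = \<phi> x *\<^sub>v (P *\<^sub>v v)" unfolding Pv[OF xc] by (rule w_fix[OF xW])
      finally show "P * (\<phi> x * P) *\<^sub>v v = \<phi> x * P *\<^sub>v v" using assoc_mult_mat_vec[OF c[OF x] P v] by simp
    qed
    \<comment> \<open>Invariance gives only \<open>P \<phi>(x) P = \<phi>(x) P\<close>. The adjoint
      of this identity at \<open>star x\<close> supplies the other side.\<close>
    have comm: "P * \<phi> x = \<phi> x * P" if x: "x \<in> S" for x
    proof -
      have sx: "star x \<in> S" using operator_systemD(6)[OF S x] .
      have \<phi>s: "mat_adjoint (\<phi> (star x)) = \<phi> x" using UCP_star[OF S \<phi> x] by simp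
      have "P * \<phi> x = mat_adjoint (\<phi> (star x) * P)"
        using mat_adjoint_mult[OF c[OF sx] P] by (simp add: Pa \<phi>s)
      also have "\<dots> = mat_adjoint (P * (\<phi> (star x) * P))" by (simp only: PxP[OF sx])
      also have "\<dots> = P * \<phi> x * P"
        using mat_adjoint_mult[OF P mult_carrier_mat[OF c[OF sx] P]] mat_adjoint_mult[OF c[OF sx] P] by (simp add: Pa \<phi>s)
      also have "\<dots> = \<phi> x * P" using assoc_mult_mat[OF P c[OF x] P] PxP[OF x] by simp
      finally show ?thesis .
    qed
    define Q where "Q = 1\<^sub>m n - P"
    have Q: "Q \<in> carrier_mat n n" using P by (simp add: Q_def minus_carrier_mat)
    have Qa: "mat_adjoint Q = Q"
    proof (rule eq_matI)
      fix i k assume "i < dim_row Q" "k < dim_col Q"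
      then have ik: "i < n" "k < n" using Q by auto
      have "cnj (P $$ (k, i)) = P $$ (i, k)" using ik P Pa index_mat_adjoint[of i P k] by simp
      then show "mat_adjoint Q $$ (i, k) = Q $$ (i, k)" using ik Q P by (simp add: Q_def)
    qed (use Q in auto)
    have QX: "Q * X = X - P * X" if "X \<in> carrier_mat n n" for X
      unfolding Q_def using minus_mult_distrib_mat[OF one_carrier_mat P that] that by simp
    have XQ: "X * Q = X - X * P" if "X \<in> carrier_mat n n" for X
      unfolding Q_def using mult_minus_distrib_mat[OF that one_carrier_mat P] that by simp
    have split: "mat_sum n 2 (\<lambda>i. if i = 0 then X else X') = X + X'" if "X \<in> carrier_mat n n" "X' \<in> carrier_mat n n" for X X'
      by (rule eq_matI) (use that in \<open>auto simp: mat_sum_def numeral_2_eq_2\<close>)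
    have QQ: "Q * Q = Q"
      using QX[OF Q] XQ[OF P] P by (simp add: PP Q_def) (intro eq_matI, auto)
    \<comment> \<open>The first term is the compression to \<open>W\<close>, of size
      \<open>M\<close>. The second keeps \<open>\<phi>\<close> at full size with the complementary
      projection \<open>Q\<close> as coefficient, which avoids a basis of the complement. The clause
      for sizes at most \<open>n\<close>, applied to the first term, forces
      \<open>M = n\<close>.\<close>
    define d where "d i = (if i = (0::nat) then M else n)" for i
    define \<psi> where "\<psi> i = (if i = (0::nat) then (\<lambda>x. mat_adjoint w * \<phi> x * w) else \<phi>)" for i
    define \<gamma> where "\<gamma> i = (if i = (0::nat) then mat_adjoint w else Q)" for i
    have "matrix_convex_combination S n \<phi> 2 d \<psi> \<gamma>"
      unfolding matrix_convex_combination_def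
    proof (intro conjI allI impI ballI)
      fix i :: nat assume "i < 2"
      show "1 \<le> d i" using M0 n by (simp add: d_def)
      show "\<psi> i \<in> UCP S (d i)" using sandwich_UCP[OF S \<phi> w] \<phi> by (simp add: \<psi>_def d_def)
      show "\<gamma> i \<in> carrier_mat (d i) n" using wa Q by (simp add: \<gamma>_def d_def)
      show "\<gamma> i \<noteq> 0\<^sub>m (d i) n"
      proof (cases "i = 0")
        case True
        have "mat_adjoint w \<noteq> 0\<^sub>m M n"
        proof
          assume "mat_adjoint w = 0\<^sub>m M n"
          then have "(1\<^sub>m M :: complex mat) = 0\<^sub>m M M" using w by simp
          then have "(1\<^sub>m M :: complex mat) $$ (0, 0) = 0" using M0 by simp
          then show False using M0 by simp
        qed
        then show ?thesis using True by (simp add: \<gamma>_def d_def)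
      next
        case False
        have "Q \<noteq> 0\<^sub>m n n"
        proof
          assume Q0: "Q = 0\<^sub>m n n"
          have "P = 1\<^sub>m n"
          proof (rule eq_matI)
            fix i k assume "i < dim_row (1\<^sub>m n :: complex mat)" "k < dim_col (1\<^sub>m n :: complex mat)"
            then have ik: "i < n" "k < n" by auto
            have "Q $$ (i, k) = 1\<^sub>m n $$ (i, k) - P $$ (i, k)" using ik P by (simp add: Q_def)
            then show "P $$ (i, k) = 1\<^sub>m n $$ (i, k)" using Q0 ik by simp
          qed (use P in auto)
          then show False using P1 by simp
        qed
        then show ?thesis using False by (simp add: \<gamma>_def d_def)
      qed
    next
      have "mat_sum n 2 (\<lambda>i. mat_adjoint (\<gamma> i) * \<gamma> i) = mat_sum n 2 (\<lambda>i. if i = 0 then P else Q)"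
        by (rule arg_cong[where f = "mat_sum n 2"]) (auto simp: \<gamma>_def Qa QQ P_def)
      also have "\<dots> = 1\<^sub>m n"
        unfolding split[OF P Q] by (rule eq_matI) (use P in \<open>auto simp: Q_def\<close>)
      finally show "mat_sum n 2 (\<lambda>i. mat_adjoint (\<gamma> i) * \<gamma> i) = 1\<^sub>m n" .
    next
      fix x assume x: "x \<in> S"
      note cx = c[OF x]
      have e1: "mat_adjoint (mat_adjoint w) * (mat_adjoint w * \<phi> x * w) * mat_adjoint w = \<phi> x * P"
      proof -
        have wx: "mat_adjoint w * \<phi> x \<in> carrier_mat M n" using wa cx by (rule mult_carrier_mat)
        have "w * (mat_adjoint w * \<phi> x * w) * mat_adjoint w = w * (mat_adjoint w * \<phi> x * w * mat_adjoint w)"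
          by (rule assoc_mult_mat[OF w(1) mult_carrier_mat[OF wx w(1)] wa])
        also have "mat_adjoint w * \<phi> x * w * mat_adjoint w = mat_adjoint w * \<phi> x * P"
          unfolding P_def by (rule assoc_mult_mat[OF wx w(1) wa])
        also have "\<dots> = mat_adjoint w * (\<phi> x * P)" by (rule assoc_mult_mat[OF wa cx P])
        also have "w * (mat_adjoint w * (\<phi> x * P)) = P * (\<phi> x * P)"
          unfolding P_def by (rule assoc_mult_mat[OF w(1) wa mult_carrier_mat[OF cx P[unfolded P_def]], symmetric])
        finally show ?thesis by (simp add: PxP[OF x])
      qed
      have e2: "Q * \<phi> x * Q = \<phi> x - \<phi> x * P"
      proof -
        have "Q * \<phi> x = \<phi> x * Q" using QX[OF cx] XQ[OF cx] comm[OF x] by simp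
        then have "Q * \<phi> x * Q = \<phi> x * (Q * Q)" using assoc_mult_mat[OF cx Q Q] by simp
        then show ?thesis using XQ[OF cx] by (simp add: QQ)
      qed
      have "mat_sum n 2 (\<lambda>i. mat_adjoint (\<gamma> i) * \<psi> i x * \<gamma> i) = mat_sum n 2 (\<lambda>i. if i = 0 then \<phi> x * P else \<phi> x - \<phi> x * P)"
        by (rule arg_cong[where f = "mat_sum n 2"]) (use e1 e2 in \<open>auto simp: \<gamma>_def \<psi>_def Qa\<close>)
      also have "\<dots> = \<phi> x * P + (\<phi> x - \<phi> x * P)"
        by (rule split) (use cx P in \<open>auto simp: minus_carrier_mat\<close>)
      also have "\<dots> = \<phi> x" by (rule eq_matI) (use cx P in \<open>auto simp del: index_mult_mat(1)\<close>)
      finally show "\<phi> x = mat_sum n 2 (\<lambda>i. mat_adjoint (\<gamma> i) * \<psi> i x * \<gamma> i)" by simp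
    qed
    from absolute_matrix_extreme_pointD(1)[OF abs this, of 0] show False using Mn by (simp add: d_def)
  qed
qed

theorem theorem2p1:
  fixes S :: "'a::unital_cstar_algebra set"
    and n :: nat
    and \<phi> :: "'a \<Rightarrow> complex mat"
  assumes "operator_system S"
    and "1 \<le> n"
    and "\<phi> \<in> UCP S n"
  shows "absolute_matrix_extreme_point S n \<phi> \<longleftrightarrow>
    (\<exists>\<pi>. boundary_representation S n \<pi> \<and> (\<forall>x\<in>S. \<pi> x = \<phi> x))"
proof
  assume abs: "absolute_matrix_extreme_point S n \<phi>"
  obtain \<Phi> where "\<Phi> \<in> UCP UNIV n" and ext: "\<And>x. x \<in> S \<Longrightarrow> \<Phi> x = \<phi> x"
    using Arveson_extension[OF assms(1,3)] by blast
  then have \<Phi>: "\<Phi> \<in> UCP (generated_cstar S) n" by (auto intro: UCP_subset)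
  note rep = absolute_matrix_extreme_star_representation[OF assms(1,2) abs]
  have "unique_extension_property S n \<Phi>"
    unfolding unique_extension_property_def
  proof (intro conjI bexI[OF _ \<Phi>] ballI impI)
    show "\<Phi> \<in> UCP S n" using \<Phi> subset_generated_cstar by (rule UCP_subset)
    \<comment> \<open>The competitor extends \<open>\<phi>\<close> too, so \<open>rep\<close> makes
      it a star representation, and agreement on \<open>S\<close> decides.\<close>
    show "\<Psi> a = \<Phi> a" if "\<Psi> \<in> UCP (generated_cstar S) n" "\<forall>x\<in>S. \<Psi> x = \<Phi> x" "a \<in> generated_cstar S" for \<Psi> a
      by (rule star_representations_eq_on_generated[OF rep[OF that(1)] rep[OF \<Phi> ext] _ that(3)]) (use that ext in auto)
    show "\<Phi> (a * b) = \<Phi> a * \<Phi> b" if "a \<in> generated_cstar S" "b \<in> generated_cstar S" for a b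
      using rep[OF \<Phi> ext] that by (simp add: star_representation_def)
  qed simp
  moreover have "irreducible_representation (generated_cstar S) n \<Phi>"
    by (rule absolute_matrix_extreme_irreducible[OF assms(1,2) abs rep[OF \<Phi> ext] ext])
  ultimately show "\<exists>\<pi>. boundary_representation S n \<pi> \<and> (\<forall>x\<in>S. \<pi> x = \<phi> x)"
    using ext by (auto simp: boundary_representation_def)
next
  assume "\<exists>\<pi>. boundary_representation S n \<pi> \<and> (\<forall>x\<in>S. \<pi> x = \<phi> x)"
  then show "absolute_matrix_extreme_point S n \<phi>"
    using boundary_representation_absolute_matrix_extreme[OF assms(1,3)] by blast
qed

end
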